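(* Let $f\colon \mathbb{R}\to\mathbb{R}$ be a fixed positive and non-increasing function such that $$\int_{T_{a,b}}\int_{T_{a,b}} |f(d^2(\mathbf{x},\mathbf{y}))|^2\, d\mathbf{x}\, d\mathbf{y} < \infty \qquad \text{for } (a,b)\in U .$$ Consider the two quantities $\|A_f\|_{L^2(T_{a,b})}$ and $\|A_f\|_{\mathrm{H.S.}}$ as functions of $(a,b)\in U$, i.e. over all unit-volume flat tori $T_{a,b}$. Then: (i) the equilateral torus, $(a,b)=\left(\tfrac12,\tfrac{\sqrt3}{2}\right)$, is a maximizer over $U$ of both $\|A_f\|_{L^2(T_{a,b})}$ and $\|A_f\|_{\mathrm{H.S.}}$; (ii) the square torus, $(a,b)=(0,1)$, is a critical point of both quantities; (iii) if $f$ is additionally assumed to be (strictly) decreasing, then the equilateral torus is the unique maximizer over $U$ of each of the two quantities, and the square torus is a saddle point of each of them.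
   Context: Let $$U := \{(a,b)\in\mathbb{R}^2 : b>0,\ a\in[0,1/2],\ a^2+b^2\ge 1\}.$$ For $a\in\mathbb{R}$, $b>0$ let $$B_{a,b}=\begin{pmatrix} \frac{1}{\sqrt b} & \frac{a}{\sqrt b}\\ 0 & \sqrt b\end{pmatrix},\qquad L_{a,b}=B_{a,b}(\mathbb{Z}^2),\qquad T_{a,b}=\mathbb{R}^2/L_{a,b},$$ where $T_{a,b}$ is the flat torus of volume $1$ with the metric inherited from $\mathbb{R}^2$, and $d$ denotes the geodesic distance on $T_{a,b}$. Every unit-volume flat torus is isometric to some $T_{a,b}$ with $(a,b)\in U$. The square torus is $T_{0,1}$ and the equilateral torus is $T_{1/2,\sqrt3/2}$. For each $(a,b)$, $A_f\colon L^2(T_{a,b})\to L^2(T_{a,b})$ is the integral operator $$A_f\psi(\mathbf{x}) := \int_{T_{a,b}} f\left(d^2(\mathbf{x},\mathbf{y})\right)\psi(\mathbf{y})\, d\mathbf{y},$$ with $f$ evaluated at the squared distance. $\|A_f\|_{L^2(T_{a,b})}$ denotes its $L^2(T_{a,b})\to L^2(T_{a,b})$ operator norm and $\|A_f\|_{\mathrm{H.S.}}$ its Hilbert-Schmidt norm. A critical point is a parameter $(a,b)$ at which both partial derivatives (with respect to $a$ and to $b$) of the quantity vanish; since $(0,1)$ lies on the boundary of $U$, the partial derivatives are taken of the same quantity defined for $T_{a,b}$ with $(a,b)$ in a neighbourhood of that point in $\mathbb{R}\times(0,\infty)$. A saddle point is a critical point that is neither a local maximum nor a local minimum. *)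

theory Defs
  imports "HOL-Analysis.Analysis"
begin

section \<open>Unit-volume flat tori\<close>

definition param_domain :: "(real \<times> real) set" where
  "param_domain = {(a, b). b > 0 \<and> a \<in> {0..1/2} \<and> a\<^sup>2 + b\<^sup>2 \<ge> 1}"

definition lattice_basis :: "real \<Rightarrow> real \<Rightarrow> real^2^2" where
  "lattice_basis a b = vector [vector [1 / sqrt b, a / sqrt b], vector [0, sqrt b]]"

definition lattice :: "real \<Rightarrow> real \<Rightarrow> (real^2) set" where
  "lattice a b = (\<lambda>z. lattice_basis a b *v z) ` {z. \<forall>i. z $ i \<in> \<int>}"

definition lattice_rel :: "real \<Rightarrow> real \<Rightarrow> ((real^2) \<times> (real^2)) set" where
  "lattice_rel a b = {(x, y). x - y \<in> lattice a b}"

text \<open>Points of the torus are cosets of the lattice.\<close>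

definition torus :: "real \<Rightarrow> real \<Rightarrow> (real^2) set set" where
  "torus a b = UNIV // lattice_rel a b"

definition torus_proj :: "real \<Rightarrow> real \<Rightarrow> real^2 \<Rightarrow> (real^2) set" where
  "torus_proj a b x = lattice_rel a b `` {x}"

definition fundamental_cell :: "real \<Rightarrow> real \<Rightarrow> (real^2) set" where
  "fundamental_cell a b = (\<lambda>z. lattice_basis a b *v z) ` {z. \<forall>i. 0 \<le> z $ i \<and> z $ i < 1}"

text \<open>The Riemannian volume measure: the image of Lebesgue measure on a fundamental cell, on the
  quotient Borel sigma-algebra (a set of cosets is measurable iff its preimage in the plane is
  Borel).\<close>

definition torus_measure :: "real \<Rightarrow> real \<Rightarrow> (real^2) set measure" where
  "torus_measure a b =
     distr (restrict_space lborel (fundamental_cell a b))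
       (sigma (torus a b) {S. S \<subseteq> torus a b \<and> torus_proj a b -` S \<in> sets borel})
       (torus_proj a b)"

text \<open>The geodesic distance is the infimum of the lengths of curves on the torus. The projection from
  the plane is a local isometry and a covering, so the curves on the torus are the projections of
  curves in the plane, with the same length; hence the infimum below is over lifts.

  Plain continuously differentiable curves are used on purpose: the derivative of such a curve is
  continuous on the closed interval, so the integral is the true length. The library's piecewise
  notion allows derivatives that are unbounded near a breakpoint, for which the integral may not
  exist and would default to zero.\<close>

definition curve_length :: "(real \<Rightarrow> real^2) \<Rightarrow> real" where
  "curve_length g = integral {0..1} (\<lambda>t. norm (vector_derivative g (at t)))"

definition geodesic_dist :: "(real^2) set \<Rightarrow> (real^2) set \<Rightarrow> real" where
  "geodesic_dist X Y =
     Inf {curve_length g | g. g C1_differentiable_on {0..1} \<and> g 0 \<in> X \<and> g 1 \<in> Y}"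


section \<open>Square-integrable functions and operators on them\<close>

text \<open>Elements of the (complex) Hilbert space are represented by functions, identified when equal
  almost everywhere; all notions below respect this identification.\<close>

definition sq_integrable :: "'x measure \<Rightarrow> ('x \<Rightarrow> complex) \<Rightarrow> bool" where
  "sq_integrable M \<psi> \<longleftrightarrow> \<psi> \<in> borel_measurable M \<and> integrable M (\<lambda>x. (cmod (\<psi> x))\<^sup>2)"

definition l2_norm :: "'x measure \<Rightarrow> ('x \<Rightarrow> complex) \<Rightarrow> real" where
  "l2_norm M \<psi> = sqrt (LINT x|M. (cmod (\<psi> x))\<^sup>2)"

definition l2_inner :: "'x measure \<Rightarrow> ('x \<Rightarrow> complex) \<Rightarrow> ('x \<Rightarrow> complex) \<Rightarrow> complex" where
  "l2_inner M \<psi> \<phi> = (LINT x|M. \<psi> x * cnj (\<phi> x))"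

definition l2_operator_norm :: "'x measure \<Rightarrow> (('x \<Rightarrow> complex) \<Rightarrow> ('x \<Rightarrow> complex)) \<Rightarrow> real" where
  "l2_operator_norm M A = Sup {l2_norm M (A \<psi>) | \<psi>. sq_integrable M \<psi> \<and> l2_norm M \<psi> \<le> 1}"

text \<open>Orthonormal bases are indexed by the natural numbers, as the spaces considered here are
  separable and infinite-dimensional.\<close>

definition orthonormal_basis :: "'x measure \<Rightarrow> (nat \<Rightarrow> 'x \<Rightarrow> complex) \<Rightarrow> bool" where
  "orthonormal_basis M e \<longleftrightarrow>
     (\<forall>i. sq_integrable M (e i)) \<and>
     (\<forall>i j. l2_inner M (e i) (e j) = (if i = j then 1 else 0)) \<and>
     (\<forall>\<psi>. sq_integrable M \<psi> \<longrightarrow>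
        (\<lambda>n. l2_norm M (\<lambda>x. \<psi> x - (\<Sum>i<n. l2_inner M \<psi> (e i) * e i x))) \<longlonglongrightarrow> 0)"

text \<open>The sum of squares does not depend on the basis, so the square of the Hilbert-Schmidt norm is
  the common value for all bases. This is meaningful for Hilbert-Schmidt operators, that is, when
  the sum is finite.\<close>

definition hilbert_schmidt_norm ::
    "'x measure \<Rightarrow> (('x \<Rightarrow> complex) \<Rightarrow> ('x \<Rightarrow> complex)) \<Rightarrow> real" where
  "hilbert_schmidt_norm M A =
     sqrt (THE s. \<forall>e. orthonormal_basis M e \<longrightarrow> (\<lambda>i. (l2_norm M (A (e i)))\<^sup>2) sums s)"

definition dist_operator ::
    "(real \<Rightarrow> real) \<Rightarrow> real \<Rightarrow> real \<Rightarrow> ((real^2) set \<Rightarrow> complex) \<Rightarrow> ((real^2) set \<Rightarrow> complex)" where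
  "dist_operator f a b \<psi> X =
     (LINT Y|torus_measure a b. complex_of_real (f ((geodesic_dist X Y)\<^sup>2)) * \<psi> Y)"

definition operator_norm_at :: "(real \<Rightarrow> real) \<Rightarrow> real \<times> real \<Rightarrow> real" where
  "operator_norm_at f = (\<lambda>(a, b). l2_operator_norm (torus_measure a b) (dist_operator f a b))"

definition hilbert_schmidt_norm_at :: "(real \<Rightarrow> real) \<Rightarrow> real \<times> real \<Rightarrow> real" where
  "hilbert_schmidt_norm_at f =
     (\<lambda>(a, b). hilbert_schmidt_norm (torus_measure a b) (dist_operator f a b))"


section \<open>Maximizers, critical points and saddle points\<close>

definition unique_maximizer_on :: "'p set \<Rightarrow> ('p \<Rightarrow> real) \<Rightarrow> 'p \<Rightarrow> bool" where
  "unique_maximizer_on S Q p \<longleftrightarrow> (\<forall>q. is_arg_max Q (\<lambda>r. r \<in> S) q \<longleftrightarrow> q = p)"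

definition critical_point :: "(real \<times> real \<Rightarrow> real) \<Rightarrow> real \<times> real \<Rightarrow> bool" where
  "critical_point Q p \<longleftrightarrow>
     ((\<lambda>a. Q (a, snd p)) has_real_derivative 0) (at (fst p)) \<and>
     ((\<lambda>b. Q (fst p, b)) has_real_derivative 0) (at (snd p))"

definition local_max_within :: "'p::topological_space set \<Rightarrow> ('p \<Rightarrow> real) \<Rightarrow> 'p \<Rightarrow> bool" where
  "local_max_within S Q p \<longleftrightarrow> (\<forall>\<^sub>F q in at p within S. Q q \<le> Q p)"

definition local_min_within :: "'p::topological_space set \<Rightarrow> ('p \<Rightarrow> real) \<Rightarrow> 'p \<Rightarrow> bool" where
  "local_min_within S Q p \<longleftrightarrow> (\<forall>\<^sub>F q in at p within S. Q q \<ge> Q p)"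

text \<open>The partial derivatives are two-sided, also at a boundary point of the set; local extrema are
  taken among points of the set. Failing to be an extremum among points of a smaller set is the
  stronger condition, so a saddle point within a set is also one within every larger set.\<close>

definition saddle_point_within ::
    "(real \<times> real) set \<Rightarrow> (real \<times> real \<Rightarrow> real) \<Rightarrow> real \<times> real \<Rightarrow> bool" where
  "saddle_point_within S Q p \<longleftrightarrow>
     critical_point Q p \<and> \<not> local_max_within S Q p \<and> \<not> local_min_within S Q p"

end

theory Submission
  imports Defs "HOL-Library.Nat_Bijection"
begin

text \<open>The kernel is translation invariant and positive, so the operator norm is the mean value
  \<open>F\<^sub>f(a, b)\<close> of \<open>f(d\<^sup>2(x, \<cdot>))\<close> (Cauchy-Schwarz; the bound is attained at constants), and by Parseval the
  squared Hilbert-Schmidt norm is \<open>F\<^bsub>f\<^sup>2\<^esub>(a, b)\<close>. Hence everything is about \<open>F\<^sub>g\<close> for positive decreasing \<open>g\<close>,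
  which need not be continuous.

  Sliding the rows of the lattice against each other, that is increasing \<open>a\<close> in \<open>[0, 1/2]\<close>, increases
  \<open>F\<^sub>g\<close>: on each line between two rows this is a rearrangement inequality. At \<open>a = 1/2\<close>, a leg of the
  isosceles triangle \<open>(0,0)\<close>, \<open>(1,0)\<close>, \<open>(1/2,b)\<close> becomes the new row direction, and sliding again leads to
  \<open>(1/2, T b)\<close> with \<open>T b = b / (1/4 + b\<^sup>2)\<close>. Up to a quarter turn, this map at least halves the distance of \<open>b\<close> to
  \<open>\<surd>3 / 2\<close>, and \<open>F\<^sub>g\<close> is upper semicontinuous there, so the equilateral torus is maximal.

  At the square torus, sliding by \<open>a\<close> gains at most \<open>O(a\<^sup>2)\<close>. Passing to a rectangle moves the mass of a strip of
  the Voronoi cell away from the origin, at a cost of \<open>O(\<bar>b - 1\<bar>\<^bsup>3/2\<^esup>)\<close>. So both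
  partial derivatives vanish, while \<open>F\<^sub>g\<close> increases in one direction and decreases in the other.\<close>

section \<open>Periodic integrals and the squared distance\<close>

text \<open>Since \<open>f\<close> may jump, neither differentiation under the integral sign nor
  continuity of the mean in the parameters is at hand. Every step is therefore a comparison of
  integrals of monotone profiles: the derivatives at the square come from two-sided bounds of order
  above 1, and the limit at the equilateral torus uses one-sided semicontinuity. The latter holds
  because a monotone function has countably many jumps, and each level of the distance meets a
  horizontal line in countably many points.

  The leg step cannot be iterated as it stands: a tall triangle is sent to a flat one and leaves the
  range of heights at least 1/2 from which the step starts. The quarter turn brings it back.

  The Hilbert-Schmidt norm is defined by a property of all orthonormal bases, so a basis has to be
  exhibited. Walsh functions serve well: their finite combinations are the dyadic step functions,
  and completeness becomes a matter of approximating intervals.\<close>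

definition circle :: "real measure" where
  "circle = restrict_space lborel {0..<1}"

lemma space_circle [simp]: "space circle = {0..<1}"
  by (simp add: circle_def space_restrict_space)

lemma sets_circle: "sets circle = sets (restrict_space borel {0..<1})"
  unfolding circle_def by (intro sets_restrict_space_cong sets_lborel)

lemma emeasure_space_circle [simp]: "emeasure circle (space circle) = 1"
  unfolding circle_def by (simp add: emeasure_restrict_space space_restrict_space)

interpretation circle: finite_measure circle
  by standard (subst emeasure_space_circle, simp)

lemma borel_measurable_circle:
  "f \<in> borel_measurable borel \<Longrightarrow> f \<in> borel_measurable circle"
  unfolding circle_def by (intro measurable_restrict_space1) simp

lemma circle_ident_measurable: "(\<lambda>x. x) \<in> circle \<rightarrow>\<^sub>M borel"
  by (rule borel_measurable_circle) simp

abbreviation circle_integral :: "(real \<Rightarrow> ennreal) \<Rightarrow> ennreal" where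
  "circle_integral h \<equiv> \<integral>\<^sup>+x. h x \<partial>circle"

abbreviation interval_integral :: "real \<Rightarrow> real \<Rightarrow> (real \<Rightarrow> ennreal) \<Rightarrow> ennreal" where
  "interval_integral u v h \<equiv> \<integral>\<^sup>+x. h x * indicator {u..<v} x \<partial>lborel"

lemma nn_integral_circle:
  "f \<in> borel_measurable borel \<Longrightarrow>
   circle_integral f = interval_integral 0 1 f"
  unfolding circle_def by (subst nn_integral_restrict_space) auto

lemma nn_integral_interval_shift:
  fixes f :: "real \<Rightarrow> ennreal"
  assumes [measurable]: "f \<in> borel_measurable borel"
  shows "interval_integral u v (\<lambda>x. f (x + c)) =
         interval_integral (u+c) (v+c) f"
proof -
  have "interval_integral (u+c) (v+c) f =
        (\<integral>\<^sup>+x. f (c + 1 * x) * indicator {u+c..<v+c} (c + 1 * x) \<partial>lborel)"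
    by (subst nn_integral_real_affine[where c=1 and t=c]) auto
  also have "\<dots> = interval_integral u v (\<lambda>x. f (x + c))"
    by (intro nn_integral_cong) (auto simp: indicator_def add.commute)
  finally show ?thesis ..
qed

lemma nn_integral_interval_split:
  fixes f :: "real \<Rightarrow> ennreal"
  assumes [measurable]: "f \<in> borel_measurable borel" and "u \<le> v" "v \<le> w"
  shows "interval_integral u w f =
         interval_integral u v f + interval_integral v w f"
proof -
  have "interval_integral u w f =
        (\<integral>\<^sup>+x. f x * indicator {u..<v} x + f x * indicator {v..<w} x \<partial>lborel)"
    using assms(2,3) by (intro nn_integral_cong) (auto simp: indicator_def)
  also have "\<dots> = interval_integral u v f + interval_integral v w f"
    by (subst nn_integral_add) auto
  finally show ?thesis .
qed

lemma periodic_add_int: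
  assumes "\<And>x::real. h (x + 1) = h x"
  shows "h (x + of_int k) = h x"
proof (induction k arbitrary: x rule: int_induct[where k=0])
  case base then show ?case by simp
next
  case (step1 i) then show ?case using assms[of "x + of_int i"] by (simp add: add.assoc)
next
  case (step2 i) then show ?case using assms[of "x + of_int i - 1"] by (simp add: algebra_simps)
qed

lemma nn_integral_periodic:
  fixes h :: "real \<Rightarrow> ennreal"
  assumes [measurable]: "h \<in> borel_measurable borel" and per: "\<And>x. h (x + 1) = h x"
  shows "interval_integral c (c+1) h = circle_integral h"
proof -
  define d where "d = frac c"
  have d: "0 \<le> d" "d < 1" and cd: "c = d + of_int \<lfloor>c\<rfloor>"
    by (auto simp: d_def frac_def intro: frac_lt_1) (metis frac_def frac_lt_1)+
  have "interval_integral c (c+1) h =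
        interval_integral d (d+1) (\<lambda>x. h (x + of_int \<lfloor>c\<rfloor>))"
    by (subst nn_integral_interval_shift) (use cd in \<open>auto simp: algebra_simps\<close>)
  also have "\<dots> = interval_integral d (d+1) h"
    by (simp add: periodic_add_int[where h=h, OF per])
  also have "\<dots> = interval_integral d 1 h + interval_integral (0+1) (d+1) h"
    using d by (subst nn_integral_interval_split[where v=1]) auto
  also have "interval_integral (0+1) (d+1) h = interval_integral 0 d h"
    by (subst nn_integral_interval_shift[symmetric]) (auto simp: per)
  also have "interval_integral d 1 h + interval_integral 0 d h =
     interval_integral 0 1 h"
    using d by (subst nn_integral_interval_split[where v=d and u=0 and w=1]) (auto simp: add.commute)
  finally show ?thesis by (simp add: nn_integral_circle)
qed

lemma nn_integral_circle_shift:
  fixes h :: "real \<Rightarrow> ennreal"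
  assumes [measurable]: "h \<in> borel_measurable borel" and per: "\<And>x. h (x + 1) = h x"
  shows "circle_integral (\<lambda>x. h (x + c)) = circle_integral h"
  by (subst nn_integral_circle, simp, subst nn_integral_interval_shift)
     (use nn_integral_periodic[OF assms, of c] in \<open>auto simp: add.commute\<close>)

lemma nn_integral_interval_reflect:
  fixes f :: "real \<Rightarrow> ennreal"
  assumes [measurable]: "f \<in> borel_measurable borel"
  shows "interval_integral u v (\<lambda>x. f (c - x)) =
         interval_integral (c-v) (c-u) f"
proof -
  have "interval_integral (c-v) (c-u) f =
        (\<integral>\<^sup>+x. f (c + (-1) * x) * indicator {c-v..<c-u} (c + (-1) * x) \<partial>lborel)"
    by (subst nn_integral_real_affine[where c="-1" and t=c]) auto
  also have "\<dots> = interval_integral u v (\<lambda>x. f (c - x))"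
  proof (rule nn_integral_cong_AE)
    \<comment> \<open>A reflection exchanges the open and the closed end of an interval; the two
      integrands can differ only at the end points.\<close>
    have "AE x in lborel. x \<noteq> u" "AE x in lborel. x \<noteq> v"
      by (auto intro: AE_lborel_singleton)
    then show "AE x in lborel. f (c + (-1) * x) * indicator {c-v..<c-u} (c + (-1) * x) =
        f (c - x) * indicator {u..<v} x"
      by eventually_elim (auto simp: indicator_def)
  qed
  finally show ?thesis ..
qed

lemma nn_integral_circle_reflect:
  fixes h :: "real \<Rightarrow> ennreal"
  assumes [measurable]: "h \<in> borel_measurable borel" and per: "\<And>x. h (x + 1) = h x"
  shows "circle_integral (\<lambda>x. h (c - x)) = circle_integral h"
  by (subst nn_integral_circle, simp, subst nn_integral_interval_reflect)
     (use nn_integral_periodic[OF assms, of "c-1"] in \<open>auto simp: algebra_simps\<close>)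

text \<open>The reflection of the circle that sends \<open>x\<close> to \<open>s - x\<close> fixes
  \<open>s/2\<close> and \<open>s/2 - 1/2\<close>, and the half circle between them represents the
  pairs of mirror points. The main use is \<open>s = a + a'\<close>, the reflection that exchanges
  \<open>a\<close> and \<open>a'\<close>.\<close>

lemma nn_integral_circle_fold:
  fixes h :: "real \<Rightarrow> ennreal"
  assumes [measurable]: "h \<in> borel_measurable borel" and per: "\<And>x. h (x + 1) = h x"
  shows "circle_integral h =
    interval_integral (s/2-1/2) (s/2) (\<lambda>x. h x + h (s - x))"
proof -
  have "circle_integral h = interval_integral (s/2-1/2) ((s/2-1/2)+1) h"
    by (subst nn_integral_periodic) (auto simp: per)
  also have "\<dots> = interval_integral (s/2-1/2) (s/2) h +
      interval_integral (s - s/2) (s - (s/2-1/2)) h"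
    by (subst nn_integral_interval_split[where v="s/2"]) (auto simp: algebra_simps)
  also have "interval_integral (s - s/2) (s - (s/2-1/2)) h =
      interval_integral (s/2-1/2) (s/2) (\<lambda>x. h (s - x))"
    by (subst nn_integral_interval_reflect) auto
  finally show ?thesis
    by (subst (asm) nn_integral_add[symmetric]) (auto simp: distrib_right)
qed

section \<open>Distance to the nearest integer\<close>

definition int_dist :: "real \<Rightarrow> real" where
  "int_dist x = \<bar>x - of_int (round x)\<bar>"

lemma int_dist_le: "int_dist x \<le> \<bar>x - of_int k\<bar>"
  unfolding int_dist_def by (rule round_diff_minimal)

lemma int_dist_nonneg [simp]: "0 \<le> int_dist x"
  by (simp add: int_dist_def)

lemma int_dist_greatest: "(\<And>k. c \<le> \<bar>x - of_int k\<bar>) \<Longrightarrow> c \<le> int_dist x"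
  by (simp add: int_dist_def)

lemma int_dist_add_1 [simp]: "int_dist (x + 1) = int_dist x"
proof (rule antisym)
  show "int_dist (x + 1) \<le> int_dist x"
    using int_dist_le[of "x+1" "round x + 1"] by (simp add: int_dist_def)
  show "int_dist x \<le> int_dist (x + 1)"
    using int_dist_le[of x "round (x+1) - 1"] by (simp add: int_dist_def)
qed

lemma int_dist_minus [simp]: "int_dist (- x) = int_dist x"
proof (rule antisym)
  have *: "int_dist (- x) \<le> int_dist x" for x
    using int_dist_le[of "-x" "- round x"] by (simp add: int_dist_def)
  show "int_dist (- x) \<le> int_dist x" by (rule *)
  show "int_dist x \<le> int_dist (- x)" using *[of "-x"] by simp
qed

lemma int_dist_commute: "int_dist (x - y) = int_dist (y - x)"
  using int_dist_minus[of "x - y"] by simp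

lemma int_dist_unit:
  assumes "0 \<le> x" "x \<le> 1" shows "int_dist x = min x (1 - x)"
proof (rule antisym)
  show "int_dist x \<le> min x (1 - x)"
    using int_dist_le[of x 0] int_dist_le[of x 1] assms by auto
  show "min x (1 - x) \<le> int_dist x"
  proof (rule int_dist_greatest)
    fix k :: int
    show "min x (1 - x) \<le> \<bar>x - of_int k\<bar>"
    proof (cases "k \<le> 0")
      case True
      then have "of_int k \<le> (0::real)" by simp
      then show ?thesis using assms by auto
    next
      case False
      then have "of_int k \<ge> (1::real)" by simp
      then show ?thesis using assms by auto
    qed
  qed
qed

lemma int_dist_eq_abs: "\<bar>x\<bar> \<le> 1/2 \<Longrightarrow> int_dist x = \<bar>x\<bar>"
  using int_dist_unit[of "\<bar>x\<bar>"] by (cases "x \<ge> 0") auto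

lemma int_dist_le_half: "int_dist x \<le> 1/2"
  unfolding int_dist_def using of_int_round_abs_le[of x] by linarith

lemma int_dist_measurable [measurable]: "int_dist \<in> borel_measurable borel"
proof -
  have "int_dist = (\<lambda>x. \<bar>x - real_of_int \<lfloor>x + 1/2\<rfloor>\<bar>)"
    by (auto simp: int_dist_def round_def)
  also have "\<dots> \<in> borel_measurable borel" by measurable
  finally show ?thesis .
qed

text \<open>The point with lattice coordinates \<open>(s, t)\<close> is represented by \<open>x = s + a t\<close> and \<open>y = t\<close>. Then \<open>x\<close> has
  period \<open>1\<close>, and \<open>a\<close> occurs only in the passage from \<open>y\<close> to \<open>y + 1\<close>.\<close>

definition quad_form :: "real \<Rightarrow> real \<Rightarrow> real \<Rightarrow> real" where
  "quad_form b x y = (x\<^sup>2 + (b * y)\<^sup>2) / b"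

text \<open>The squared distance to the origin of the torus. Its identification with the geodesic
  distance is postponed to \<open>geodesic_dist_torus_point\<close>; all comparisons of tori are
  made with this explicit infimum.\<close>

definition flat_dist2 :: "real \<Rightarrow> real \<Rightarrow> real \<Rightarrow> real \<Rightarrow> real" where
  "flat_dist2 a b x y =
     (INF (m, n). quad_form b (x + of_int m + a * of_int n) (y + of_int n))"

lemma quad_form_nonneg [simp]: "b > 0 \<Longrightarrow> 0 \<le> quad_form b x y"
  by (simp add: quad_form_def)

lemma quad_form_mono:
  "b > 0 \<Longrightarrow> \<bar>x\<bar> \<le> \<bar>x'\<bar> \<Longrightarrow> \<bar>y\<bar> \<le> \<bar>y'\<bar> \<Longrightarrow> quad_form b x y \<le> quad_form b x' y'"
  unfolding quad_form_def
  by (intro divide_right_mono add_mono) (auto simp: abs_le_square_iff[symmetric] abs_mult mult_left_mono)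

lemma quad_form_abs [simp]: "quad_form b \<bar>x\<bar> y = quad_form b x y" "quad_form b x \<bar>y\<bar> = quad_form b x y"
  by (simp_all add: quad_form_def power_mult_distrib)

lemma flat_dist2_le:
  assumes "b > 0"
  shows "flat_dist2 a b x y \<le> quad_form b (x + of_int m + a * of_int n) (y + of_int n)"
  unfolding flat_dist2_def
  by (rule cINF_lower2[where x="(m, n)"]) (use assms in \<open>auto intro!: bdd_belowI[where m=0]\<close>)

lemma flat_dist2_greatest:
  "(\<And>m n. c \<le> quad_form b (x + of_int m + a * of_int n) (y + of_int n)) \<Longrightarrow> c \<le> flat_dist2 a b x y"
  unfolding flat_dist2_def by (rule cINF_greatest) auto

lemma flat_dist2_nonneg: "b > 0 \<Longrightarrow> 0 \<le> flat_dist2 a b x y"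
  by (rule flat_dist2_greatest) auto

lemma flat_dist2_measurable [measurable]:
  assumes "b > 0"
  shows "(\<lambda>(x, y). flat_dist2 a b x y) \<in> borel_measurable (borel \<Otimes>\<^sub>M borel)"
  unfolding flat_dist2_def split_beta quad_form_def
  by (intro borel_measurable_cINF)
     (auto intro!: bdd_belowI[where m=0] simp: assms less_imp_le)

lemma flat_dist2_lattice:
  assumes "b > 0"
  shows "flat_dist2 a b (x + of_int i + a * of_int j) (y + of_int j) = flat_dist2 a b x y"
proof (rule antisym)
  show "flat_dist2 a b (x + of_int i + a * of_int j) (y + of_int j) \<le> flat_dist2 a b x y"
  proof (rule flat_dist2_greatest)
    fix m n
    show "flat_dist2 a b (x + of_int i + a * of_int j) (y + of_int j)
       \<le> quad_form b (x + of_int m + a * of_int n) (y + of_int n)"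
      using flat_dist2_le[OF assms, of a "x + of_int i + a * of_int j" "y + of_int j" "m - i" "n - j"]
      by (simp add: algebra_simps)
  qed
  show "flat_dist2 a b x y \<le> flat_dist2 a b (x + of_int i + a * of_int j) (y + of_int j)"
  proof (rule flat_dist2_greatest)
    fix m n
    show "flat_dist2 a b x y \<le>
      quad_form b (x + of_int i + a * of_int j + of_int m + a * of_int n) (y + of_int j + of_int n)"
      using flat_dist2_le[OF assms, of a x y "m + i" "n + j"]
      by (simp add: algebra_simps)
  qed
qed

lemma flat_dist2_add_1: "b > 0 \<Longrightarrow> flat_dist2 a b (x + 1) y = flat_dist2 a b x y"
  using flat_dist2_lattice[of b a x 1 0 y] by simp

lemma flat_dist2_minus: assumes "b > 0" shows "flat_dist2 a b (- x) (- y) = flat_dist2 a b x y"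
proof -
  have *: "flat_dist2 a b (- x) (- y) \<le> flat_dist2 a b x y" for x y
  proof (rule flat_dist2_greatest)
    fix m n
    have "quad_form b (- x + of_int (- m) + a * of_int (- n)) (- y + of_int (- n)) =
          quad_form b (x + of_int m + a * of_int n) (y + of_int n)"
      by (simp add: quad_form_def power2_eq_square algebra_simps)
    then show "flat_dist2 a b (- x) (- y) \<le> quad_form b (x + of_int m + a * of_int n) (y + of_int n)"
      using flat_dist2_le[OF assms, of a "-x" "-y" "-m" "-n"] by simp
  qed
  show ?thesis using *[of x y] *[of "-x" "-y"] by simp
qed

text \<open>Among the two steps from a lattice point of row \<open>k \<ge> 2\<close> to row \<open>k - 1\<close>, taken with weights
  \<open>1 - a\<close> and \<open>a\<close>, the squared distance to a point of the strip changes on average by at most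
  \<open>a (1 - a) - b\<^sup>2 \<le> 0\<close>. So it suffices to look at the two rows that bound the strip.\<close>

lemma row_descent:
  fixes a b u d :: real
  assumes "0 \<le> a" "a \<le> 1" "a * (1 - a) \<le> b\<^sup>2" "1 \<le> d"
  shows "(u + a)\<^sup>2 + (b * (d - 1))\<^sup>2 \<le> u\<^sup>2 + (b * d)\<^sup>2 \<or>
         (u + a - 1)\<^sup>2 + (b * (d - 1))\<^sup>2 \<le> u\<^sup>2 + (b * d)\<^sup>2"
proof (rule ccontr)
  assume "\<not> ?thesis"
  then have "0 < 2*a*u + a\<^sup>2 - b\<^sup>2 * (2*d - 1)"
     and "0 < - 2*(1-a)*u + (1-a)\<^sup>2 - b\<^sup>2 * (2*d - 1)"
    by (auto simp: power2_eq_square algebra_simps)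
  moreover have "0 < (1 - a) * p + a * q" if "0 < p" "0 < q" for p q :: real
    using assms(1,2) that by (cases "a = 1") (auto intro!: add_pos_nonneg)
  ultimately have "0 < (1-a) * (2*a*u + a\<^sup>2 - b\<^sup>2 * (2*d - 1)) + a * (- 2*(1-a)*u + (1-a)\<^sup>2 - b\<^sup>2 * (2*d - 1))"
    by blast
  also have "\<dots> = a * (1 - a) - b\<^sup>2 * (2*d - 1)"
    by (simp add: power2_eq_square algebra_simps)
  finally have "b\<^sup>2 * (2*d - 1) < a * (1 - a)" by simp
  moreover have "b\<^sup>2 * 1 \<le> b\<^sup>2 * (2*d - 1)"
    using assms(4) by (intro mult_left_mono) auto
  ultimately show False using assms(3) by simp
qed

lemma flat_dist2_le_rows:
  assumes "b > 0"
  shows "flat_dist2 a b x y \<le> quad_form b (int_dist x) y"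
    and "flat_dist2 a b x y \<le> quad_form b (int_dist (x - a)) (1 - y)"
proof -
  show "flat_dist2 a b x y \<le> quad_form b (int_dist x) y"
    using flat_dist2_le[OF assms, of a x y "- round x" 0] by (simp add: int_dist_def)
  show "flat_dist2 a b x y \<le> quad_form b (int_dist (x - a)) (1 - y)"
    using flat_dist2_le[OF assms, of a x y "- round (x - a)" "-1"]
    by (simp add: int_dist_def quad_form_def power2_eq_square algebra_simps)
qed

text \<open>Induction on how far a row is from the strip: \<open>row_descent\<close> replaces a
  lattice point by one of its two neighbours in the next nearer row without increasing the distance.
  In the two rows that bound the strip, rounding finds the nearest point.\<close>

lemma flat_dist2_rows:
  assumes "b > 0" "0 \<le> a" "a \<le> 1" "a * (1 - a) \<le> b\<^sup>2" "0 \<le> y" "y \<le> 1"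
  shows "flat_dist2 a b x y =
    min (quad_form b (int_dist x) y) (quad_form b (int_dist (x - a)) (1 - y))" (is "_ = ?R")
proof (rule antisym)
  show "flat_dist2 a b x y \<le> ?R"
    using flat_dist2_le_rows[OF assms(1)] by simp
  have row0: "?R \<le> quad_form b (x + of_int m) y" for m
    using quad_form_mono[OF assms(1), of "int_dist x" "x + of_int m" y y] int_dist_le[of x "-m"]
    by (intro min.coboundedI1) auto
  have row1: "?R \<le> quad_form b (x + of_int m - a) (y - 1)" for m
    using quad_form_mono[OF assms(1), of "int_dist (x-a)" "x + of_int m - a" "1-y" "y - 1"]
      int_dist_le[of "x - a" "-m"]
    by (intro min.coboundedI2) (auto simp: algebra_simps)
  have up: "?R \<le> quad_form b (x + of_int m - a * (1 + real k)) (y - (1 + real k))" for m k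
  proof (induction k arbitrary: m)
    case 0 then show ?case using row1 by simp
  next
    case (Suc k)
    \<comment> \<open>\<open>row_descent\<close> is applied with \<open>d = 2 + k - y\<close>, which
      is at least 1 because \<open>y \<le> 1\<close>.\<close>
    let ?u = "x + of_int m - a * (2 + real k)"
    have "quad_form b (?u + a) (1 + real k - y) \<le> quad_form b ?u (2 + real k - y) \<or>
          quad_form b (?u + a - 1) (1 + real k - y) \<le> quad_form b ?u (2 + real k - y)"
      using row_descent[OF assms(2-4), of "2 + real k - y" ?u] assms(1,6)
      unfolding quad_form_def divide_le_cancel by (auto simp: add_diff_eq diff_add_eq)
    moreover have "quad_form b (?u + a) (1 + real k - y) =
        quad_form b (x + of_int m - a * (1 + real k)) (y - (1 + real k))"
      "quad_form b (?u + a - 1) (1 + real k - y) =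
        quad_form b (x + of_int (m - 1) - a * (1 + real k)) (y - (1 + real k))"
      "quad_form b ?u (2 + real k - y) =
        quad_form b (x + of_int m - a * (1 + real (Suc k))) (y - (1 + real (Suc k)))"
      by (simp_all add: quad_form_def power2_eq_square algebra_simps)
    ultimately show ?case using Suc[of m] Suc[of "m - 1"] by (auto intro: order_trans)
  qed
  have down: "?R \<le> quad_form b (x + of_int m + a * real k) (y + real k)" for m k
  proof (induction k arbitrary: m)
    case 0 then show ?case using row0 by simp
  next
    case (Suc k)
    \<comment> \<open>On the other side of the strip the vector is reversed, so that the descent
      again adds \<open>a\<close> or \<open>a - 1\<close>. Here \<open>d = y + 1 + k\<close>, which
      is at least 1 because \<open>0 \<le> y\<close>.\<close>
    let ?u = "- (x + of_int m + a * (1 + real k))"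
    have "quad_form b (?u + a) (y + real k) \<le> quad_form b ?u (y + 1 + real k) \<or>
          quad_form b (?u + a - 1) (y + real k) \<le> quad_form b ?u (y + 1 + real k)"
      using row_descent[OF assms(2-4), of "y + 1 + real k" ?u] assms(1,5)
      unfolding quad_form_def divide_le_cancel by (auto simp: add_diff_eq diff_add_eq)
    moreover have "quad_form b (?u + a) (y + real k) = quad_form b (x + of_int m + a * real k) (y + real k)"
      "quad_form b (?u + a - 1) (y + real k) = quad_form b (x + of_int (m + 1) + a * real k) (y + real k)"
      "quad_form b ?u (y + 1 + real k) = quad_form b (x + of_int m + a * real (Suc k)) (y + real (Suc k))"
      by (simp_all add: quad_form_def power2_eq_square algebra_simps)
    ultimately show ?case using Suc[of m] Suc[of "m + 1"] by (auto intro: order_trans)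
  qed
  show "?R \<le> flat_dist2 a b x y"
  proof (rule flat_dist2_greatest)
    fix m n :: int
    show "?R \<le> quad_form b (x + of_int m + a * of_int n) (y + of_int n)"
    proof (cases "n \<ge> 0")
      case True
      then show ?thesis using down[of m "nat n"] by simp
    next
      case False
      then have "of_int n = - (1 + real (nat (- n - 1)))" by simp
      then show ?thesis using up[of m "nat (- n - 1)"] by (simp add: algebra_simps)
    qed
  qed
qed

section \<open>Sliding a row of the lattice\<close>

text \<open>Submodularity of \<open>max\<close>: pairing large with large hides one of the large
  values, pairing crosswise hides less.\<close>

lemma max_rearrange:
  fixes p p' q q' :: real
  assumes "p' \<le> p" "q' \<le> q"
  shows "max p q + max p' q' \<le> max p q' + max p' q"
  using assms by (auto simp: max_def)

text \<open>All unprimed values exceed all primed ones, so the right side is \<open>p + q\<close>,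
  while the left side replaces the smaller of \<open>p\<close> and \<open>q\<close> by a primed
  value.\<close>

lemma max_rearrange_strict:
  fixes p p' q q' :: real
  assumes "p' < p" "q' < q" "p' < q" "q' < p"
  shows "max p q + max p' q' < max p q' + max p' q"
  using assms by (auto simp: max_def)

lemma nn_integral_less_on_interval:
  fixes f h :: "real \<Rightarrow> ennreal"
  assumes [measurable]: "f \<in> borel_measurable borel" "h \<in> borel_measurable borel"
    and fin: "(\<integral>\<^sup>+x. f x \<partial>lborel) \<noteq> \<infinity>" and le: "\<And>x. f x \<le> h x"
    and less: "\<And>x. l < x \<Longrightarrow> x < u \<Longrightarrow> f x < h x" and "l < u"
  shows "(\<integral>\<^sup>+x. f x \<partial>lborel) < (\<integral>\<^sup>+x. h x \<partial>lborel)"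
proof (rule nn_integral_less)
  show "\<not> (AE x in lborel. h x \<le> f x)"
  proof
    assume "AE x in lborel. h x \<le> f x"
    then have "AE x in lborel. x \<notin> {l<..<u}"
      by eventually_elim (use less in force)
    then have "emeasure lborel {l<..<u} = 0"
      by (subst (asm) AE_iff_measurable[where N="{l<..<u}"]) auto
    then show False using \<open>l < u\<close> by simp
  qed
qed (use fin le in auto)

text \<open>The inner integral runs over \<open>x\<close> at fixed \<open>y\<close>, not over a
  lattice coordinate: by periodicity the shear by \<open>a * y\<close> does not change it, and
  \<open>a\<close> enters through the distance alone.\<close>

definition torus_mean :: "(real \<Rightarrow> real) \<Rightarrow> real \<Rightarrow> real \<Rightarrow> ennreal" where
  "torus_mean g a b = circle_integral (\<lambda>y. circle_integral (\<lambda>x. ennreal (g (flat_dist2 a b x y))))"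

text \<open>A reflection moves the points of a half circle away from every centre in that half. Here
  the centres are 0 and \<open>a\<close>, and the mirror image of \<open>a\<close> is
  \<open>a'\<close>.\<close>

lemma int_dist_reflect_le:
  assumes "0 \<le> a" "a \<le> a'" "a' \<le> 1/2" "(a + a')/2 - 1/2 \<le> x" "x < (a + a')/2"
  shows "int_dist x \<le> int_dist (a + a' - x)" "int_dist (x - a) \<le> int_dist (x - a')"
proof -
  have "x \<le> 1/2" "- x \<le> 1/2" "x - a \<le> 1/2" "- (x - a) \<le> 1/2"
    using assms by (auto simp: field_simps)
  then have "\<bar>x\<bar> \<le> 1/2" "\<bar>x - a\<bar> \<le> 1/2"
    by (simp_all only: abs_le_iff)
  then have "int_dist x = \<bar>x\<bar>" "int_dist (x - a) = \<bar>x - a\<bar>"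
    by (simp_all add: int_dist_eq_abs)
  moreover have "int_dist (a + a' - x) = min (a + a' - x) (1 - (a + a' - x))"
    "int_dist (a' - x) = min (a' - x) (1 - (a' - x))"
    using assms by (intro int_dist_unit; auto simp: field_simps)+
  ultimately show "int_dist x \<le> int_dist (a + a' - x)" "int_dist (x - a) \<le> int_dist (x - a')"
    using assms by (auto simp: int_dist_commute[of x a'] abs_le_iff field_simps)
qed

lemma quad_form_measurable [measurable (raw)]:
  assumes [measurable]: "f \<in> borel_measurable M" "h \<in> borel_measurable M"
  shows "(\<lambda>z. quad_form b (f z) (h z)) \<in> borel_measurable M"
  unfolding quad_form_def by measurable

locale radial_profile =
  fixes g :: "real \<Rightarrow> real"
  assumes decreasing: "antimono g" and positive: "g t > 0"
begin

lemma profile_nonneg [simp]: "0 \<le> g t"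
  using positive by (simp add: less_imp_le)

lemma profile_mono: "s \<le> t \<Longrightarrow> g t \<le> g s"
  using decreasing by (simp add: antimono_def)

lemma profile_measurable [measurable]: "g \<in> borel_measurable borel"
proof -
  have "mono (\<lambda>t. - g t)" by (simp add: monoI profile_mono)
  then have "(\<lambda>t. - (- g t)) \<in> borel_measurable borel"
    by (intro borel_measurable_uminus borel_measurable_mono)
  then show ?thesis by simp
qed

lemma profile_min: "g (min s t) = max (g s) (g t)"
  using profile_mono by (auto simp: min_def max_def intro: antisym)

lemma row_mean_measurable:
  "b > 0 \<Longrightarrow> (\<lambda>y. circle_integral (\<lambda>x. ennreal (g (flat_dist2 a b x y)))) \<in> borel_measurable borel"
  by (subst nn_integral_circle, measurable)

lemma row_mean_le: "b > 0 \<Longrightarrow> (circle_integral (\<lambda>x. ennreal (g (flat_dist2 a b x y)))) \<le> ennreal (g 0)"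
proof -
  assume "b > 0"
  then have "circle_integral (\<lambda>x. ennreal (g (flat_dist2 a b x y))) \<le> circle_integral (\<lambda>x. ennreal (g 0))"
    by (intro nn_integral_mono ennreal_leI profile_mono flat_dist2_nonneg)
  then show ?thesis by (simp flip: space_circle)
qed

lemma torus_mean_le: "b > 0 \<Longrightarrow> torus_mean g a b \<le> ennreal (g 0)"
proof -
  assume "b > 0"
  then have "torus_mean g a b \<le> circle_integral (\<lambda>y. ennreal (g 0))"
    unfolding torus_mean_def by (intro nn_integral_mono row_mean_le)
  then show ?thesis by (simp flip: space_circle)
qed

text \<open>Between two adjacent rows the profile is the maximum of two functions on the circle, centred at
  \<open>0\<close> and at \<open>a\<close> and decreasing in the distance to the centre. The reflection that exchanges \<open>a\<close>
  and \<open>a'\<close> maps the half circle of \<open>0\<close> and \<open>a\<close> to that of \<open>a'\<close>; comparing the values at each pair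
  of mirror points shows that moving the second centre from \<open>a\<close> to \<open>a'\<close> increases the integral.\<close>

definition two_row :: "real \<Rightarrow> real \<Rightarrow> real \<Rightarrow> real \<Rightarrow> real" where
  "two_row a b y x = max (g (quad_form b (int_dist x) y)) (g (quad_form b (int_dist (x - a)) (1 - y)))"

lemma two_row_nonneg [simp]: "0 \<le> two_row a b y x"
  by (simp add: two_row_def le_max_iff_disj)

lemma two_row_measurable [measurable (raw)]:
  assumes [measurable]: "f \<in> borel_measurable M" "h \<in> borel_measurable M"
  shows "(\<lambda>z. two_row a b (f z) (h z)) \<in> borel_measurable M"
  unfolding two_row_def by measurable

lemma two_row_periodic: "two_row a b y (x + 1) = two_row a b y x"
  using int_dist_add_1[of "x - a"] by (simp add: two_row_def diff_add_eq)

lemma profile_flat_dist2_ge: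
  "b > 0 \<Longrightarrow> two_row a b y x \<le> g (flat_dist2 a b x y)"
  unfolding two_row_def by (auto intro: profile_mono flat_dist2_le_rows)

lemma profile_flat_dist2:
  assumes "b > 0" "0 \<le> a" "a \<le> 1" "a * (1 - a) \<le> b\<^sup>2" "0 \<le> y" "y \<le> 1"
  shows "g (flat_dist2 a b x y) = two_row a b y x"
  using flat_dist2_rows[OF assms] by (simp add: profile_min two_row_def)

lemma two_row_reflect:
  assumes "b > 0" "0 \<le> a" "a \<le> a'" "a' \<le> 1/2" "(a + a')/2 - 1/2 \<le> x" "x < (a + a')/2"
  shows "two_row a b y x + two_row a b y (a + a' - x) \<le>
         two_row a' b y x + two_row a' b y (a + a' - x)"
proof -
  have "quad_form b (int_dist x) y \<le> quad_form b (int_dist (a + a' - x)) y"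
    "quad_form b (int_dist (x - a)) (1 - y) \<le> quad_form b (int_dist (x - a')) (1 - y)"
    using int_dist_reflect_le[OF assms(2-6)] assms(1) by (auto intro!: quad_form_mono)
  then show ?thesis
    using max_rearrange[OF profile_mono profile_mono] int_dist_commute[of x a] int_dist_commute[of x a']
    by (simp add: two_row_def)
qed

lemma two_row_reflect_ennreal:
  assumes "b > 0" "0 \<le> a" "a \<le> a'" "a' \<le> 1/2"
  shows "(ennreal (two_row a b y x) + ennreal (two_row a b y (a + a' - x))) *
      indicator {(a + a')/2-1/2..<(a + a')/2} x \<le>
    (ennreal (two_row a' b y x) + ennreal (two_row a' b y (a + a' - x))) *
      indicator {(a + a')/2-1/2..<(a + a')/2} x"
  using two_row_reflect[OF assms, of x y]
  by (auto simp: indicator_def simp flip: ennreal_plus intro!: ennreal_leI)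

lemma two_row_integral:
  assumes "b > 0" "0 \<le> a" "a \<le> a'" "a' \<le> 1/2"
  shows "circle_integral (\<lambda>x. ennreal (two_row a b y x)) \<le> circle_integral (\<lambda>x. ennreal (two_row a' b y x))"
proof -
  have "circle_integral (\<lambda>x. ennreal (two_row c b y x)) = interval_integral ((a + a')/2-1/2) ((a + a')/2) (\<lambda>x. ennreal (two_row c b y x) +
     ennreal (two_row c b y (a + a' - x)))" for c
    by (rule nn_integral_circle_fold) (auto simp: two_row_periodic)
  then show ?thesis
    using two_row_reflect_ennreal[OF assms] by (auto intro!: nn_integral_mono)
qed

text \<open>At the end point \<open>a'\<close> of the slide an inequality is enough: rows beyond the
  two adjacent ones can only bring lattice points nearer and raise the profile. This matters for
  \<open>half_step\<close>, where \<open>next_height b\<close> may be below 1/2 and the two rows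
  need not contain the nearest point at shift 1/2.\<close>

lemma steiner_row:
  assumes "b > 0" "0 \<le> a" "a \<le> a'" "a' \<le> 1/2" "a * (1 - a) \<le> b\<^sup>2" "0 \<le> y" "y \<le> 1"
  shows "circle_integral (\<lambda>x. ennreal (g (flat_dist2 a b x y))) \<le> circle_integral (\<lambda>x. ennreal (two_row a' b y x))"
    and "circle_integral (\<lambda>x. ennreal (two_row a' b y x)) \<le> circle_integral (\<lambda>x. ennreal (g (flat_dist2 a' b x y)))"
  using two_row_integral[OF assms(1-4)] assms
  by (auto simp: profile_flat_dist2 intro!: nn_integral_mono ennreal_leI profile_flat_dist2_ge)

lemma steiner:
  assumes "b > 0" "0 \<le> a" "a \<le> a'" "a' \<le> 1/2" "a * (1 - a) \<le> b\<^sup>2"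
  shows "torus_mean g a b \<le> torus_mean g a' b"
  unfolding torus_mean_def
  by (intro nn_integral_mono order_trans[OF steiner_row[OF assms]]) auto

text \<open>The gain is located at \<open>x\<close> near \<open>a/2\<close>, halfway between the
  centres 0 and \<open>a\<close>, and at \<open>y\<close> near 1/2. There both distances within a
  row are about \<open>a/2\<close>, while after the reflection they are at least
  \<open>a/2 + \<gamma>\<close> with \<open>\<gamma> = min (a' - a) (1 - a' - a)\<close>. Within
  \<open>\<gamma>/4\<close> of \<open>a/2\<close> a gap of \<open>\<gamma>/2\<close> remains, hence
  one of \<open>\<gamma>^2 / 4\<close> between the squares, which beats the difference
  \<open>b^2 * \<bar>1 - 2 * y\<bar>\<close> of the vertical parts.\<close>

lemma two_row_integral_strict:
  assumes strict: "strict_antimono_on UNIV g"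
    and "b > 0" "0 \<le> a" "a < a'" "a' \<le> 1/2"
    and y: "b\<^sup>2 * \<bar>1 - 2 * y\<bar> < (min (a' - a) (1 - a' - a))\<^sup>2 / 4"
  shows "circle_integral (\<lambda>x. ennreal (two_row a b y x)) < circle_integral (\<lambda>x. ennreal (two_row a' b y x))"
proof -
  define \<gamma> where "\<gamma> = min (a' - a) (1 - a' - a)"
  have \<gamma>: "\<gamma> > 0" "\<gamma> \<le> a' - a" "\<gamma> \<le> 1 - a' - a" using assms by (auto simp: \<gamma>_def)
  let ?h = "\<lambda>c x. (ennreal (two_row c b y x) +
     ennreal (two_row c b y (a + a' - x))) * indicator {(a + a')/2-1/2..<(a + a')/2} x"
  have eq: "circle_integral (\<lambda>x. ennreal (two_row c b y x)) = (\<integral>\<^sup>+x. ?h c x \<partial>lborel)" for c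
    by (rule nn_integral_circle_fold) (auto simp: two_row_periodic)
  have "(\<integral>\<^sup>+x. ?h a x \<partial>lborel) < (\<integral>\<^sup>+x. ?h a' x \<partial>lborel)"
  proof (rule nn_integral_less_on_interval[where l="a/2 - \<gamma>/4" and u="a/2 + \<gamma>/4"])
    have "circle_integral (\<lambda>x. ennreal (two_row a b y x)) \<le> circle_integral (\<lambda>x. ennreal (g 0))"
      using \<open>b > 0\<close> by (intro nn_integral_mono ennreal_leI) (auto simp: two_row_def intro!: profile_mono)
    then show "(\<integral>\<^sup>+x. ?h a x \<partial>lborel) \<noteq> \<infinity>"
      unfolding eq[symmetric] by (auto simp: top_unique simp flip: space_circle)
    show "?h a x \<le> ?h a' x" for x
      using two_row_reflect_ennreal[of b a a' y x] assms by simp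
    fix x assume x: "a/2 - \<gamma>/4 < x" "x < a/2 + \<gamma>/4"
    have near: "int_dist x \<le> a/2 + \<gamma>/4" "int_dist (x - a) \<le> a/2 + \<gamma>/4"
      using int_dist_le[of x 0] int_dist_le[of "x - a" 0] x \<gamma> assms by auto
    have "int_dist (a + a' - x) = min (a + a' - x) (1 - (a + a' - x))"
      "int_dist (a' - x) = min (a' - x) (1 - (a' - x))"
      using assms x \<gamma> by (intro int_dist_unit; auto simp: field_simps)+
    then have far: "int_dist (a + a' - x) \<ge> (a/2 + \<gamma>/4) + \<gamma>/2" "int_dist (x - a') \<ge> (a/2 + \<gamma>/4) + \<gamma>/2"
      using \<gamma> x assms by (auto simp: int_dist_commute[of x a'])
    have sq: "u\<^sup>2 + \<gamma>\<^sup>2/4 \<le> v\<^sup>2" if "0 \<le> u" "u \<le> (a/2 + \<gamma>/4)" "(a/2 + \<gamma>/4) + \<gamma>/2 \<le> v" for u v :: real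
    proof -
      have "(u + \<gamma>/2)\<^sup>2 \<le> v\<^sup>2" using that \<gamma> by (intro power_mono) auto
      moreover have "0 \<le> u * \<gamma>" using that \<gamma> by simp
      ultimately show ?thesis by (simp add: power2_eq_square algebra_simps)
    qed
    have yy: "\<bar>b\<^sup>2 * (1 - y)\<^sup>2 - b\<^sup>2 * y\<^sup>2\<bar> < \<gamma>\<^sup>2/4"
    proof -
      have "b\<^sup>2 * (1 - y)\<^sup>2 - b\<^sup>2 * y\<^sup>2 = b\<^sup>2 * (1 - 2*y)" by (simp add: power2_eq_square algebra_simps)
      then show ?thesis using y by (simp add: abs_mult \<gamma>_def)
    qed
    have lt: "g (quad_form b u v) < g (quad_form b u' v')" if "u'\<^sup>2 + b\<^sup>2 * v'\<^sup>2 < u\<^sup>2 + b\<^sup>2 * v\<^sup>2" for u v u' v'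
      using strict that \<open>b > 0\<close>
      by (simp add: monotone_on_def quad_form_def power_mult_distrib divide_strict_right_mono)
    have "0 < \<gamma>\<^sup>2" using \<gamma> by simp
    then have "g (quad_form b (int_dist (a + a' - x)) y) < g (quad_form b (int_dist x) y)"
      "g (quad_form b (int_dist (x - a')) (1 - y)) < g (quad_form b (int_dist (x - a)) (1 - y))"
      "g (quad_form b (int_dist (a + a' - x)) y) < g (quad_form b (int_dist (x - a)) (1 - y))"
      "g (quad_form b (int_dist (x - a')) (1 - y)) < g (quad_form b (int_dist x) y)"
      using sq[OF int_dist_nonneg near(1) far(1)] sq[OF int_dist_nonneg near(1) far(2)]
        sq[OF int_dist_nonneg near(2) far(1)] sq[OF int_dist_nonneg near(2) far(2)]
        yy unfolding abs_less_iff
      by - (rule lt; linarith)+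
    from max_rearrange_strict[OF this]
    have "two_row a b y x + two_row a b y (a + a' - x) < two_row a' b y x + two_row a' b y (a + a' - x)"
      using int_dist_commute[of x a] int_dist_commute[of x a'] unfolding two_row_def by simp
    moreover have "x \<in> {(a + a')/2-1/2..<(a + a')/2}" using x \<gamma> assms by (auto simp: field_simps)
    ultimately show "?h a x < ?h a' x" by (simp add: ennreal_less_iff flip: ennreal_plus)
  qed (use \<gamma> in auto)
  then show ?thesis unfolding eq .
qed

lemma steiner_strict:
  assumes strict: "strict_antimono_on UNIV g"
    and "b > 0" "0 \<le> a" "a < a'" "a' \<le> 1/2" "a * (1 - a) \<le> b\<^sup>2"
  shows "torus_mean g a b < torus_mean g a' b"
proof -
  define \<gamma> where "\<gamma> = (min (a' - a) (1 - a' - a))\<^sup>2 / 4"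
  have "min (a' - a) (1 - a' - a) > 0" using assms by auto
  then have \<gamma>: "\<gamma> > 0" unfolding \<gamma>_def by (intro divide_pos_pos zero_less_power) auto
  \<comment> \<open>For \<open>y\<close> within \<open>\<eta>\<close> of 1/2 the vertical difference
    is at most \<open>\<gamma>/2\<close>; the bound 1/4 keeps \<open>y\<close> inside the unit
    interval.\<close>
  define \<eta> where "\<eta> = min (1/4) (\<gamma> / (4 * b\<^sup>2))"
  have \<eta>: "0 < \<eta>" "\<eta> \<le> 1/4" "b\<^sup>2 * (2 * \<eta>) \<le> \<gamma> / 2"
    using \<gamma> \<open>b > 0\<close> by (auto simp: \<eta>_def min_def field_simps)
  let ?I = "\<lambda>c y. circle_integral (\<lambda>x. ennreal (g (flat_dist2 c b x y)))"
  have [measurable]: "?I c \<in> borel_measurable borel" for c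
    using \<open>b > 0\<close> by (rule row_mean_measurable)
  have eq: "torus_mean g c b = interval_integral 0 1 (?I c)" for c
    unfolding torus_mean_def by (rule nn_integral_circle) measurable
  have "interval_integral 0 1 (?I a) < interval_integral 0 1 (?I a')"
  proof (rule nn_integral_less_on_interval[where l="1/2 - \<eta>" and u="1/2 + \<eta>"])
    show "interval_integral 0 1 (?I a) \<noteq> \<infinity>"
      using torus_mean_le[OF \<open>b > 0\<close>, of a] unfolding eq[symmetric] by (auto simp: top_unique)
    show "?I a y * indicator {0..<1} y \<le> ?I a' y * indicator {0..<1} y" for y
      using order_trans[OF steiner_row[of b a a' y]] assms by (auto simp: indicator_def)
    fix y assume y: "1/2 - \<eta> < y" "y < 1/2 + \<eta>"
    have "b\<^sup>2 * \<bar>1 - 2 * y\<bar> \<le> b\<^sup>2 * (2 * \<eta>)"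
      using y by (intro mult_left_mono) auto
    then have "b\<^sup>2 * \<bar>1 - 2 * y\<bar> < \<gamma>" using \<eta> \<gamma> by simp
    then have "circle_integral (\<lambda>x. ennreal (two_row a b y x)) < circle_integral (\<lambda>x. ennreal (two_row a' b y x))"
      using assms unfolding \<gamma>_def by (intro two_row_integral_strict) auto
    also have "\<dots> \<le> ?I a' y"
      using assms y \<eta> by (intro steiner_row[of b a]) auto
    finally show "?I a y * indicator {0..<1} y < ?I a' y * indicator {0..<1} y"
      using assms y \<eta> by (simp add: profile_flat_dist2)
  qed (use \<eta> in auto)
  then show ?thesis unfolding eq .
qed

end

section \<open>Change of lattice basis\<close>

text \<open>With \<tau> = 1/2 + i b this is the imaginary part of -1/\<tau>: the height of the
  lattice once a leg, of squared length \<open>1/4 + b\<^sup>2\<close> relative to the base, has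
  become the base.\<close>

definition next_height :: "real \<Rightarrow> real" where
  "next_height b = b / (1/4 + b\<^sup>2)"

context radial_profile begin

text \<open>In terms of \<tau> = a + i b, this lemma, \<open>torus_mean_add_1\<close> and
  \<open>torus_mean_swap\<close> are the invariance under the negative conjugate of \<tau>, under
  \<tau> + 1 and under the inverse of the conjugate of \<tau>; these generate all changes of the
  lattice basis.\<close>

lemma torus_mean_minus: assumes "b > 0" shows "torus_mean g (- a) b = torus_mean g a b"
proof -
  have eq: "flat_dist2 (- a) b x y = flat_dist2 a b (- x) y" for x y
  proof (rule antisym)
    have *: "flat_dist2 (- a) b x y \<le> flat_dist2 a b (- x) y" for a x
    proof (rule flat_dist2_greatest)
      fix m n
      have "quad_form b (x + of_int (- m) + (- a) * of_int n) (y + of_int n) =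
          quad_form b (- x + of_int m + a * of_int n) (y + of_int n)"
        by (simp add: quad_form_def power2_eq_square algebra_simps)
      then show "flat_dist2 (- a) b x y \<le> quad_form b (- x + of_int m + a * of_int n) (y + of_int n)"
        using flat_dist2_le[OF assms, of "- a" x y "-m" n] by simp
    qed
    show "flat_dist2 (- a) b x y \<le> flat_dist2 a b (- x) y" by (rule *)
    show "flat_dist2 a b (- x) y \<le> flat_dist2 (- a) b x y" using *[of "-a" "-x"] by simp
  qed
  have "circle_integral (\<lambda>x. ennreal (g (flat_dist2 (- a) b x y))) =
        circle_integral (\<lambda>x. ennreal (g (flat_dist2 a b (0 - x) y)))" for y
    by (simp add: eq)
  also have "\<dots>y = circle_integral (\<lambda>x. ennreal (g (flat_dist2 a b x y)))" for y
    using assms by (intro nn_integral_circle_reflect) (auto simp: flat_dist2_add_1)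
  finally show ?thesis by (simp add: torus_mean_def)
qed

lemma torus_mean_add_1: assumes "b > 0" shows "torus_mean g (a + 1) b = torus_mean g a b"
proof -
  have "flat_dist2 (a + 1) b x y = flat_dist2 a b x y" for x y
  proof (rule antisym)
    show "flat_dist2 (a + 1) b x y \<le> flat_dist2 a b x y"
      using flat_dist2_le[OF assms, of "a + 1" x y "m - n" n for m n]
      by (intro flat_dist2_greatest) (simp add: algebra_simps)
    show "flat_dist2 a b x y \<le> flat_dist2 (a + 1) b x y"
      using flat_dist2_le[OF assms, of a x y "m + n" n for m n]
      by (intro flat_dist2_greatest) (simp add: algebra_simps)
  qed
  then show ?thesis by (simp add: torus_mean_def)
qed

lemma pair_circle_measurable:
  assumes "(\<lambda>(x, y). f x y) \<in> borel_measurable (borel \<Otimes>\<^sub>M borel)"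
  shows "(\<lambda>(x, y). f x y) \<in> borel_measurable (circle \<Otimes>\<^sub>M circle)"
proof -
  note circle_ident_measurable [measurable]
  have "(\<lambda>z. (fst z, snd z)) \<in> circle \<Otimes>\<^sub>M circle \<rightarrow>\<^sub>M borel \<Otimes>\<^sub>M (borel :: real measure)"
    by (intro measurable_Pair measurable_compose[OF measurable_fst circle_ident_measurable]
        measurable_compose[OF measurable_snd circle_ident_measurable])
  from measurable_compose[OF this assms] show ?thesis by (simp add: split_beta)
qed

lemma torus_mean_lattice_coords:
  assumes "b > 0"
  shows "torus_mean g a b = circle_integral (\<lambda>y. circle_integral (\<lambda>x. ennreal (g (flat_dist2 a b (x + a * y) y))))"
  unfolding torus_mean_def using assms
  by (intro nn_integral_cong nn_integral_circle_shift[symmetric]) (auto simp: flat_dist2_add_1)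

text \<open>Up to rotation and reflection the new lattice is the old one with its two basis vectors
  exchanged. In lattice coordinates this exchanges \<open>x\<close> and \<open>y\<close> in the
  distance, and Fubini exchanges the integrals.\<close>

lemma torus_mean_swap:
  assumes "b > 0"
  shows "torus_mean g (a / (a\<^sup>2 + b\<^sup>2)) (b / (a\<^sup>2 + b\<^sup>2)) = torus_mean g a b"
proof -
  define r where "r = a\<^sup>2 + b\<^sup>2"
  have r: "r > 0" using assms by (simp add: r_def add_nonneg_pos)
  have q: "quad_form (b / r) (s + (a / r) * t) t = quad_form b (t + a * s) s" for s t
  proof -
    have "r * ((s + (a / r) * t)\<^sup>2 + ((b / r) * t)\<^sup>2) = r * s\<^sup>2 + 2 * a * s * t + ((a\<^sup>2 + b\<^sup>2) / r) * t\<^sup>2"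
      using r by (simp add: power2_eq_square field_simps)
    also have "\<dots> = (t + a * s)\<^sup>2 + (b * s)\<^sup>2"
      using r by (simp add: r_def[symmetric]) (simp add: r_def power2_eq_square algebra_simps)
    finally show ?thesis using r assms by (simp add: quad_form_def field_simps)
  qed
  have q': "quad_form (b / r) ((x + (a / r) * y) + of_int m + (a / r) * of_int n) (y + of_int n) =
       quad_form b ((y + a * x) + of_int n + a * of_int m) (x + of_int m)" for x y m n
    using q[of "x + of_int m" "y + of_int n"] by (simp add: algebra_simps)
  have d: "flat_dist2 (a / r) (b / r) (x + (a / r) * y) y = flat_dist2 a b (y + a * x) x" for x y
  proof (rule antisym)
    show "flat_dist2 (a / r) (b / r) (x + (a / r) * y) y \<le> flat_dist2 a b (y + a * x) x"
      using flat_dist2_le[of "b/r" "a/r" "x + (a / r) * y" y] r assms q'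
      by (intro flat_dist2_greatest) (metis divide_pos_pos)
    show "flat_dist2 a b (y + a * x) x \<le> flat_dist2 (a / r) (b / r) (x + (a / r) * y) y"
      using flat_dist2_le[OF assms, of a "y + a * x" x] q'
      by (intro flat_dist2_greatest) metis
  qed
  interpret pair_sigma_finite circle circle ..
  have "torus_mean g (a / r) (b / r) = circle_integral (\<lambda>y. circle_integral (\<lambda>x. ennreal (g (flat_dist2 a b (y + a * x) x))))"
    using r assms by (subst torus_mean_lattice_coords) (simp_all only: d divide_pos_pos)
  also have "\<dots> = circle_integral (\<lambda>x. circle_integral (\<lambda>y. ennreal (g (flat_dist2 a b (y + a * x) x))))"
    using assms by (intro Fubini' pair_circle_measurable) measurable
  also have "\<dots> = torus_mean g a b"
    using assms by (subst torus_mean_lattice_coords) auto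
  finally show ?thesis by (simp add: r_def)
qed

text \<open>The centred rectangular lattice \<open>(1/2, b)\<close>, turned by a right angle, is \<open>(1/2, 1/(4b))\<close>.\<close>

lemma torus_mean_half_rotate:
  assumes "b > 0"
  shows "torus_mean g (1/2) (1/(4*b)) = torus_mean g (1/2) b"
proof -
  define r where "r = 1 + 4*b\<^sup>2"
  have r: "r > 0" by (simp add: r_def add_pos_nonneg)
  \<comment> \<open>Swapping the basis takes both lattices to the height \<open>d\<close>, one with
    shift \<open>c + 1\<close> and the other with shift \<open>1 - c\<close>; these differ by an
    integer shift and a reflection.\<close>
  define c where "c = (1 - 4*b\<^sup>2) / r"
  define d where "d = 4*b / r"
  have d: "d > 0" using r assms by (simp add: d_def)
  have 1: "torus_mean g (1/2) b = torus_mean g c d"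
  proof -
    have "torus_mean g (1/2) b = torus_mean g (2/r) d"
      using torus_mean_swap[OF assms, of "1/2"] r
      by (simp add: d_def r_def power2_eq_square field_simps)
    also have "2/r = c + 1" using r by (simp add: c_def field_simps) (simp add: r_def)
    finally show ?thesis using torus_mean_add_1[OF d] by simp
  qed
  have 2: "torus_mean g (1/2) (1/(4*b)) = torus_mean g (-c) d"
  proof -
    have e: "(1/2) / ((1/2)\<^sup>2 + (1/(4*b))\<^sup>2) = - c + 1" "(1/(4*b)) / ((1/2)\<^sup>2 + (1/(4*b))\<^sup>2) = d"
      using assms r unfolding c_def d_def r_def
      by (auto simp: power2_eq_square divide_simps algebra_simps)
    have "torus_mean g (1/2) (1/(4*b)) = torus_mean g (- c + 1) d"
      using torus_mean_swap[of "1/(4*b)" "1/2"] assms unfolding e by simp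
    then show ?thesis using torus_mean_add_1[OF d, of "-c"] by simp
  qed
  show ?thesis using 1 2 torus_mean_minus[OF d] by simp
qed

text \<open>Take a leg of the isosceles triangle \<open>(0,0)\<close>, \<open>(1,0)\<close>, \<open>(1/2,b)\<close> as the new base, and move the
  opposite vertex parallel to it until the triangle is isosceles again.\<close>

lemma leg_base:
  assumes "b \<ge> 1/2"
  obtains a where "0 \<le> a" "a \<le> 1/2" "a * (1 - a) \<le> (next_height b)\<^sup>2"
    "torus_mean g (1/2) b = torus_mean g a (next_height b)" "b > sqrt 3 / 2 \<Longrightarrow> a < 1/2"
proof -
  define r where "r = 1/4 + b\<^sup>2"
  have "(1/2)\<^sup>2 \<le> b\<^sup>2" using assms by (intro power_mono) auto
  then have r: "r \<ge> 1/2" by (simp add: r_def power2_eq_square)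
  define c where "c = (1/2)/r"
  have c: "0 < c" "c \<le> 1" using r by (auto simp: c_def field_simps)
  have nh: "next_height b = b/r" by (simp add: next_height_def r_def)
  have pos: "next_height b > 0" using r assms by (simp add: nh)
  have eq: "torus_mean g (1/2) b = torus_mean g c (next_height b)"
    using torus_mean_swap[of b "1/2"] assms by (simp add: c_def nh r_def power2_eq_square)
  have "c * (1 - c) = (1/2) * (r - 1/2) / r\<^sup>2"
    using r by (simp add: c_def power2_eq_square field_simps)
  also have "\<dots> \<le> b\<^sup>2 / r\<^sup>2"
    by (intro divide_right_mono) (auto simp: r_def intro: order_trans[of _ 0])
  finally have obt: "c * (1 - c) \<le> (next_height b)\<^sup>2" by (simp add: nh power_divide)
  \<comment> \<open>The shift \<open>c\<close> is at most 1/2 exactly if the leg is no shorter than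
    the base, that is for \<open>b \<ge> sqrt 3 / 2\<close>. Otherwise the reflected shift
    \<open>1 - c\<close> is taken, which leaves \<open>c * (1 - c)\<close> unchanged.\<close>
  show ?thesis
  proof (cases "c \<le> 1/2")
    case True
    have "c < 1/2" if "b > sqrt 3 / 2"
    proof -
      have "(sqrt 3 / 2)\<^sup>2 < b\<^sup>2" using that by (intro power_strict_mono) auto
      then have "r > 1" by (simp add: r_def power_divide)
      then show ?thesis by (simp add: c_def)
    qed
    then show ?thesis using True c obt eq by (intro that[of c]) auto
  next
    case False
    have "torus_mean g c (next_height b) = torus_mean g (1 - c) (next_height b)"
      using torus_mean_add_1[OF pos, of "-c"] torus_mean_minus[OF pos, of c] by simp
    then show ?thesis using False c obt eq by (intro that[of "1-c"]) (auto simp: mult.commute)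
  qed
qed

end

section \<open>Maximality of the equilateral torus\<close>

lemma quad_form_rescale:
  assumes "0 < b" "0 < h"
  shows "min (h / b) (b / h) * quad_form h x y \<le> quad_form b x y"
proof -
  have "min (h / b) (b / h) * (x\<^sup>2 / h) \<le> (h / b) * (x\<^sup>2 / h)"
    "min (h / b) (b / h) * (h * y\<^sup>2) \<le> (b / h) * (h * y\<^sup>2)"
    using assms by (intro mult_right_mono; simp)+
  then show ?thesis
    using assms by (simp add: quad_form_def power_mult_distrib add_divide_distrib distrib_left
      power2_eq_square[of b] power2_eq_square[of h] mult.assoc)
qed

text \<open>The factor tends to 1 as \<open>b\<close> tends to \<open>h\<close>. For a decreasing
  profile this bounds the mean at height \<open>b\<close> by an integral over the fixed lattice of
  height \<open>h\<close> in which only the argument of the profile is scaled.\<close>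

lemma flat_dist2_rescale:
  assumes "0 < b" "0 < h"
  shows "min (h / b) (b / h) * flat_dist2 a h x y \<le> flat_dist2 a b x y"
proof (rule flat_dist2_greatest)
  fix m n :: int
  have "min (h / b) (b / h) * flat_dist2 a h x y \<le>
      min (h / b) (b / h) * quad_form h (x + of_int m + a * of_int n) (y + of_int n)"
    using assms by (intro mult_left_mono flat_dist2_le) auto
  also have "\<dots> \<le> quad_form b (x + of_int m + a * of_int n) (y + of_int n)"
    by (rule quad_form_rescale[OF assms])
  finally show "min (h / b) (b / h) * flat_dist2 a h x y \<le>
    quad_form b (x + of_int m + a * of_int n) (y + of_int n)" .
qed

text \<open>On a horizontal line the distance equals the distance to one of countably many lattice
  points, and each of them turns the level into a quadratic equation for \<open>x\<close>. It is
  applied to the set of discontinuities of the profile.\<close>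

lemma countable_flat_dist2_level:
  assumes "b > 0" "0 \<le> a" "a \<le> 1" "a * (1 - a) \<le> b\<^sup>2" "0 \<le> y" "y \<le> 1" "countable N"
  shows "countable {x. flat_dist2 a b x y \<in> N}"
proof -
  have sq: "x = s + sqrt (b * quad_form b (x - s) v - (b * v)\<^sup>2) \<or>
      x = s - sqrt (b * quad_form b (x - s) v - (b * v)\<^sup>2)" for x s v :: real
    using \<open>b > 0\<close> by (auto simp: quad_form_def abs_if)
  let ?r = "\<lambda>t v. sqrt (b * t - (b * v)\<^sup>2)"
  have "{x. flat_dist2 a b x y \<in> N} \<subseteq> (\<Union>t\<in>N. \<Union>k::int.
     {of_int k + ?r t y, of_int k - ?r t y, (a + of_int k) + ?r t (1 - y), (a + of_int k) - ?r t (1 - y)})"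
  proof
    fix x assume "x \<in> {x. flat_dist2 a b x y \<in> N}"
    then have N: "flat_dist2 a b x y \<in> N" by simp
    have "flat_dist2 a b x y = quad_form b (x - of_int (round x)) y \<or>
      flat_dist2 a b x y = quad_form b (x - (a + of_int (round (x - a)))) (1 - y)"
      using flat_dist2_rows[OF assms(1-6), of x] by (auto simp: min_def int_dist_def algebra_simps)
    then show "x \<in> (\<Union>t\<in>N. \<Union>k::int.
     {of_int k + ?r t y, of_int k - ?r t y, (a + of_int k) + ?r t (1 - y), (a + of_int k) - ?r t (1 - y)})"
    proof
      assume "flat_dist2 a b x y = quad_form b (x - of_int (round x)) y"
      then show ?thesis using N sq[of x "of_int (round x)" y] by auto
    next
      assume "flat_dist2 a b x y = quad_form b (x - (a + of_int (round (x - a)))) (1 - y)"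
      then show ?thesis using N sq[of x "a + of_int (round (x - a))" "1 - y"] by auto
    qed
  qed
  moreover have "countable (\<Union>t\<in>N. \<Union>k::int.
     {of_int k + ?r t y, of_int k - ?r t y, (a + of_int k) + ?r t (1 - y), (a + of_int k) - ?r t (1 - y)})"
    using assms(7) by (intro countable_UN) auto
  ultimately show ?thesis by (rule countable_subset)
qed

lemma AE_circle_not_countable:
  assumes "countable A" shows "AE x in circle. x \<notin> A"
proof -
  have "AE x in lborel. x \<notin> A"
    using countable_imp_null_set_lborel[OF assms] by (rule AE_not_in)
  then show ?thesis unfolding circle_def by (subst AE_restrict_space_iff) auto
qed

lemma next_height_pos: "b \<ge> 1/2 \<Longrightarrow> next_height b > 0"
  by (auto simp: next_height_def intro!: divide_pos_pos add_pos_nonneg)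

text \<open>A height and its quarter turn have the product 1/4, so the larger of them is at least
  1/2 and \<open>leg_base\<close> applies again.\<close>

definition folded_height :: "real \<Rightarrow> real" where
  "folded_height b = max (next_height b) (1 / (4 * next_height b))"

lemma domain_height: "(a, b) \<in> param_domain \<Longrightarrow> b \<ge> sqrt 3 / 2"
proof -
  assume "(a, b) \<in> param_domain"
  then have *: "b > 0" "0 \<le> a" "a \<le> 1/2" "a\<^sup>2 + b\<^sup>2 \<ge> 1" by (auto simp: param_domain_def)
  have "a\<^sup>2 \<le> (1/2)\<^sup>2" using * by (intro power_mono) auto
  then have "(sqrt 3 / 2)\<^sup>2 \<le> b\<^sup>2" using * by (simp add: power_divide)
  then show ?thesis using * by (simp add: power2_le_iff_abs_le)
qed

lemma half_sqrt3_ge: "1/2 \<le> sqrt 3 / 2"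
  by simp

lemma shift_bound: "1/2 \<le> b \<Longrightarrow> a * (1 - a) \<le> b\<^sup>2" for a b :: real
proof -
  assume "1/2 \<le> b"
  then have "(1/2)\<^sup>2 \<le> b\<^sup>2" by (intro power_mono) auto
  moreover have "0 \<le> (a - 1/2)\<^sup>2" by simp
  ultimately show ?thesis by (simp add: power2_eq_square algebra_simps)
qed

context radial_profile begin

lemma countable_discontinuities: "countable {t. \<not> isCont g t}"
proof -
  have "mono (\<lambda>t. - g t)" by (simp add: monoI profile_mono)
  then have "countable {t. \<not> isCont (\<lambda>t. - g t) t}" by (rule mono_ctble_discont)
  moreover have "isCont (\<lambda>t. - g t) t \<longleftrightarrow> isCont g t" for t
    using isCont_minus[of t g] isCont_minus[of t "\<lambda>t. - g t"] by auto
  ultimately show ?thesis by simp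
qed

text \<open>Dominated convergence, first in \<open>x\<close> and then in \<open>y\<close>, with the
  bound \<open>g 0\<close>. On each row pointwise convergence can fail only where the distance is a
  jump of \<open>g\<close>, a countable set of points.\<close>

lemma torus_mean_rescale_tendsto:
  assumes "b > 0" "0 \<le> a" "a \<le> 1" "a * (1 - a) \<le> b\<^sup>2" and \<kappa>: "\<kappa> \<longlonglongrightarrow> 1" "\<And>n. \<kappa> n > 0"
  shows "(\<lambda>n. circle_integral (\<lambda>y. circle_integral (\<lambda>x. ennreal (g (\<kappa> n * flat_dist2 a b x y))))) \<longlonglongrightarrow> torus_mean g a b"
  unfolding torus_mean_def
proof (rule nn_integral_dominated_convergence[where w="\<lambda>_. ennreal (g 0)"])
  have bound: "g (\<kappa> n * flat_dist2 a b x y) \<le> g 0" for n x y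
    using flat_dist2_nonneg[OF assms(1)] \<kappa>(2)[of n] by (intro profile_mono) (simp add: less_imp_le)
  show "(\<lambda>y. circle_integral (\<lambda>x. ennreal (g (\<kappa> n * flat_dist2 a b x y)))) \<in> borel_measurable circle" for n
    using assms(1) by (intro borel_measurable_circle) (subst nn_integral_circle, measurable)
  show "(\<lambda>y. circle_integral (\<lambda>x. ennreal (g (flat_dist2 a b x y)))) \<in> borel_measurable circle"
    using assms(1) by (intro borel_measurable_circle row_mean_measurable)
  have "circle_integral (\<lambda>x. ennreal (g (\<kappa> n * flat_dist2 a b x y))) \<le> circle_integral (\<lambda>x. ennreal (g 0))" for n y
    by (intro nn_integral_mono ennreal_leI bound)
  then show "AE y in circle. (circle_integral (\<lambda>x. ennreal (g (\<kappa> n * flat_dist2 a b x y)))) \<le> ennreal (g 0)" for n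
    by (simp flip: space_circle)
  show "circle_integral (\<lambda>y. ennreal (g 0)) < \<infinity>" by (simp flip: space_circle)
  show "AE y in circle. (\<lambda>n. circle_integral (\<lambda>x. ennreal (g (\<kappa> n * flat_dist2 a b x y))))
      \<longlonglongrightarrow> (circle_integral (\<lambda>x. ennreal (g (flat_dist2 a b x y))))"
  proof (rule AE_I2, rule nn_integral_dominated_convergence[where w="\<lambda>_. ennreal (g 0)"])
    fix y assume "y \<in> space circle"
    then have "countable {x. flat_dist2 a b x y \<in> {t. \<not> isCont g t}}"
      using countable_flat_dist2_level[OF assms(1-4) _ _ countable_discontinuities, of y] by simp
    from AE_circle_not_countable[OF this]
    show "AE x in circle. (\<lambda>n. ennreal (g (\<kappa> n * flat_dist2 a b x y))) \<longlonglongrightarrow> ennreal (g (flat_dist2 a b x y))"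
    proof eventually_elim
      case (elim x)
      have "(\<lambda>n. \<kappa> n * flat_dist2 a b x y) \<longlonglongrightarrow> 1 * flat_dist2 a b x y"
        by (intro tendsto_intros \<kappa>)
      with elim show ?case
        by (intro tendsto_ennrealI) (auto intro: isCont_tendsto_compose)
    qed
    show "(\<lambda>x. ennreal (g (\<kappa> n * flat_dist2 a b x y))) \<in> borel_measurable circle" for n
      using assms(1) by (intro borel_measurable_circle) measurable
    show "(\<lambda>x. ennreal (g (flat_dist2 a b x y))) \<in> borel_measurable circle"
      using assms(1) by (intro borel_measurable_circle) measurable
    show "circle_integral (\<lambda>x. ennreal (g 0)) < \<infinity>" by (simp flip: space_circle)
  qed (use bound in \<open>auto intro!: ennreal_leI\<close>)
qed auto

text \<open>Upper semicontinuity in the height: the factor \<open>\<kappa> n \<le> 1\<close>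
  enlarges the profile on the limit lattice beyond the mean at \<open>b n\<close>, and the enlarged
  means converge.\<close>

lemma torus_mean_limit_le:
  assumes "h > 0" "0 \<le> a" "a \<le> 1" "a * (1 - a) \<le> h\<^sup>2"
    and "b \<longlonglongrightarrow> h" "\<And>n. b n > 0" "\<And>n. c \<le> torus_mean g a (b n)"
  shows "c \<le> torus_mean g a h"
proof -
  define \<kappa> where "\<kappa> n = min (h / b n) (b n / h)" for n
  have "\<kappa> \<longlonglongrightarrow> min (h / h) (h / h)"
    unfolding \<kappa>_def using assms by (intro tendsto_intros) auto
  then have \<kappa>: "\<kappa> \<longlonglongrightarrow> 1" "\<And>n. \<kappa> n > 0" using assms by (auto simp: \<kappa>_def)
  show ?thesis
  proof (rule LIMSEQ_le_const[OF torus_mean_rescale_tendsto[OF assms(1-4) \<kappa>]], intro exI allI impI)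
    fix n
    have "torus_mean g a (b n) \<le> circle_integral (\<lambda>y. circle_integral (\<lambda>x. ennreal (g (\<kappa> n * flat_dist2 a h x y))))"
      unfolding torus_mean_def \<kappa>_def using assms
      by (intro nn_integral_mono ennreal_leI profile_mono flat_dist2_rescale) auto
    then show "c \<le> circle_integral (\<lambda>y. circle_integral (\<lambda>x. ennreal (g (\<kappa> n * flat_dist2 a h x y))))"
      using assms(7)[of n] by (rule order_trans[rotated])
  qed
qed

lemma half_step:
  assumes "b \<ge> 1/2" shows "torus_mean g (1/2) b \<le> torus_mean g (1/2) (next_height b)"
proof -
  obtain a where "0 \<le> a" "a \<le> 1/2" "a * (1 - a) \<le> (next_height b)\<^sup>2"
    "torus_mean g (1/2) b = torus_mean g a (next_height b)" by (rule leg_base[OF assms])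
  then show ?thesis using steiner[of "next_height b" a "1/2"] next_height_pos[OF assms] by simp
qed

lemma half_step_strict:
  assumes "strict_antimono_on UNIV g" "b > sqrt 3 / 2"
  shows "torus_mean g (1/2) b < torus_mean g (1/2) (next_height b)"
proof -
  have "1 \<le> sqrt 3" by simp
  then have b: "b \<ge> 1/2" using assms(2) by linarith
  obtain a where "0 \<le> a" "a < 1/2" "a * (1 - a) \<le> (next_height b)\<^sup>2"
    "torus_mean g (1/2) b = torus_mean g a (next_height b)" by (rule leg_base[OF b]) (use assms in blast)
  then show ?thesis using steiner_strict[OF assms(1), of "next_height b" a "1/2"] next_height_pos[OF b] by simp
qed

lemma folded_height:
  assumes "b \<ge> 1/2"
  shows "folded_height b \<ge> 1/2"
    and "torus_mean g (1/2) (folded_height b) = torus_mean g (1/2) (next_height b)"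
    and "\<bar>folded_height b - sqrt 3 / 2\<bar> \<le> \<bar>b - sqrt 3 / 2\<bar> / 2"
proof -
  define s where "s = next_height b"
  have s: "s > 0" using next_height_pos[OF assms] by (simp add: s_def)
  have fh: "folded_height b = (if s \<ge> 1/2 then s else 1 / (4 * s))"
  proof -
    have "(1/2) * (1/2) \<le> s * s" if "s \<ge> 1/2" using that by (intro mult_mono) auto
    moreover have "s * s \<le> (1/2) * (1/2)" if "s < 1/2" using that s by (intro mult_mono) auto
    ultimately show ?thesis using s by (auto simp: folded_height_def s_def[symmetric] max_def field_simps)
  qed
  show "folded_height b \<ge> 1/2" using s by (simp add: fh field_simps)
  show "torus_mean g (1/2) (folded_height b) = torus_mean g (1/2) (next_height b)"
    using torus_mean_half_rotate[OF s] by (auto simp: fh s_def)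
  define h where "h = sqrt 3 / 2"
  have h: "h * h = 3/4" "1/2 \<le> h" "h \<le> 1"
    by (auto simp: h_def real_le_lsqrt)
  have d: "1/4 + b\<^sup>2 > 0" by (simp add: add_pos_nonneg)
  show "\<bar>folded_height b - sqrt 3 / 2\<bar> \<le> \<bar>b - sqrt 3 / 2\<bar> / 2"
  proof (cases "s \<ge> 1/2")
    case True
    have "(s - h) * (1/4 + b\<^sup>2) = b - h * (1/4 + b\<^sup>2)"
      using d by (simp add: s_def next_height_def left_diff_distrib)
    \<comment> \<open>A polynomial identity in \<open>b\<close> and \<open>h\<close> in which
      \<open>h * h\<close> is kept; inserting 3/4 for it makes the last two summands vanish and
      exhibits \<open>h\<close> as a fixed point of \<open>next_height\<close>.\<close>
    also have "\<dots> = - ((b - h) * (h * b - (h * h) / 3)) + (1 - 4/3 * (h * h)) * b + h * ((h * h) / 3 - 1/4)"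
      by (simp add: power2_eq_square field_simps)
    also have "\<dots> = - ((b - h) * (h * b - 1/4))" by (simp add: h(1))
    finally have "\<bar>(s - h) * (1/4 + b\<^sup>2)\<bar> = \<bar>- ((b - h) * (h * b - 1/4))\<bar>" by (rule arg_cong)
    then have "\<bar>s - h\<bar> * (1/4 + b\<^sup>2) = \<bar>b - h\<bar> * \<bar>h * b - 1/4\<bar>"
      unfolding abs_minus_cancel abs_mult abs_of_pos[OF d] .
    \<comment> \<open>The contraction factor 1/2 is the inequality of arithmetic and geometric
      means, \<open>2 * (h * b) \<le> b\<^sup>2 + h\<^sup>2\<close>, with
      \<open>h\<^sup>2 = 3/4\<close>.\<close>
    also have "\<dots> \<le> \<bar>b - h\<bar> * ((1/4 + b\<^sup>2) / 2)"
    proof (rule mult_left_mono)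
      have "(1/2) * (1/2) \<le> h * b" using h assms by (intro mult_mono) auto
      moreover have "0 \<le> (b - h)\<^sup>2" by simp
      then have "2 * (h * b) \<le> b\<^sup>2 + 3/4" by (simp add: power2_eq_square h(1) algebra_simps)
      ultimately show "\<bar>h * b - 1/4\<bar> \<le> (1/4 + b\<^sup>2) / 2" by simp
    qed simp
    finally have "\<bar>s - h\<bar> * (1/4 + b\<^sup>2) \<le> (\<bar>b - h\<bar> / 2) * (1/4 + b\<^sup>2)" by simp
    then show ?thesis using d True by (simp add: fh h_def)
  next
    case False
    have b: "b > 0" using assms by simp
    have f: "folded_height b = (1/4 + b\<^sup>2) / (4 * b)"
      using False d b by (simp add: fh s_def next_height_def)
    \<comment> \<open>A next height below 1/2 forces \<open>\<bar>b - 1\<bar> > h\<close>. As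
      \<open>b \<ge> 1/2\<close>, this means \<open>b > 1 + h\<close>, hence
      \<open>b \<ge> 2 * h\<close>, and the folded height is then about a quarter of
      \<open>b\<close>.\<close>
    have "2 * b < 1/4 + b\<^sup>2"
      using False d by (simp add: s_def next_height_def field_simps)
    then have "h * h < (b - 1) * (b - 1)" by (simp add: h(1) power2_eq_square algebra_simps)
    then have "h\<^sup>2 < \<bar>b - 1\<bar>\<^sup>2" by (simp add: power2_eq_square)
    then have "h < \<bar>b - 1\<bar>" by (rule power_less_imp_less_base) simp
    then have bh: "b \<ge> 2 * h" using h assms by auto
    have "(1/4 + b\<^sup>2) / (4 * b) - h \<le> (b - h) / 2"
    proof -
      have "0 \<le> b * h" "1/4 \<le> b\<^sup>2" using b h power_mono[OF assms, of 2] by (auto simp: power_divide)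
      then show ?thesis using b by (simp add: field_simps power2_eq_square)
    qed
    moreover have "h - (1/4 + b\<^sup>2) / (4 * b) \<le> (b - h) / 2"
    proof -
      have "b * (h * 48) \<le> b * (b * 24)" using bh b by (intro mult_left_mono) auto
      then have "b * (h * 48) \<le> 2 + b * (b * 24)" by linarith
      then show ?thesis using b by (simp add: field_simps power2_eq_square)
    qed
    moreover have "\<bar>b - h\<bar> = b - h" using bh h by simp
    ultimately show ?thesis unfolding f h_def[symmetric] by (simp only: abs_le_iff minus_diff_eq)
  qed
qed

lemma half_le_hex:
  assumes "b \<ge> 1/2" shows "torus_mean g (1/2) b \<le> torus_mean g (1/2) (sqrt 3 / 2)"
proof -
  define s where "s n = (folded_height ^^ n) b" for n
  have s: "s n \<ge> 1/2 \<and> torus_mean g (1/2) b \<le> torus_mean g (1/2) (s n) \<and>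
     \<bar>s n - sqrt 3 / 2\<bar> \<le> \<bar>b - sqrt 3 / 2\<bar> * (1/2)^n" for n
  proof (induction n)
    case 0 then show ?case using assms by (simp add: s_def)
  next
    case (Suc n)
    have eq: "s (Suc n) = folded_height (s n)" by (simp add: s_def)
    show ?case unfolding eq
      using Suc folded_height[of "s n"] half_step[of "s n"] by (auto simp: mult.commute)
  qed
  have "(\<lambda>n. \<bar>b - sqrt 3 / 2\<bar> * (1/2)^n) \<longlonglongrightarrow> \<bar>b - sqrt 3 / 2\<bar> * 0"
    by (intro tendsto_mult tendsto_const LIMSEQ_power_zero) simp
  then have lim: "(\<lambda>n. \<bar>b - sqrt 3 / 2\<bar> * (1/2)^n) \<longlonglongrightarrow> 0" by (simp only: mult_zero_right)
  have "\<forall>n. norm (s n - sqrt 3 / 2) \<le> \<bar>b - sqrt 3 / 2\<bar> * (1/2)^n"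
    using s by (simp only: real_norm_def simp_thms)
  then have "(\<lambda>n. s n - sqrt 3 / 2) \<longlonglongrightarrow> 0"
    by (rule Lim_null_comparison[OF always_eventually lim])
  then have "s \<longlonglongrightarrow> sqrt 3 / 2" by (simp add: LIM_zero_iff)
  moreover have "s n > 0" "torus_mean g (1/2) b \<le> torus_mean g (1/2) (s n)" for n
    using s[of n] by linarith+
  moreover have "1/2 * (1 - 1/2) \<le> (sqrt 3 / 2)\<^sup>2" by (simp add: power_divide)
  ultimately show ?thesis
    by - (rule torus_mean_limit_le[where b=s]; simp)
qed

lemma hex_maximal:
  assumes "(a, b) \<in> param_domain"
  shows "torus_mean g a b \<le> torus_mean g (1/2) (sqrt 3 / 2)"
proof -
  have *: "b > 0" "0 \<le> a" "a \<le> 1/2" using assms by (auto simp: param_domain_def)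
  have b: "b \<ge> 1/2" using domain_height[OF assms] half_sqrt3_ge by linarith
  have "torus_mean g a b \<le> torus_mean g (1/2) b"
    using * b by (intro steiner shift_bound) auto
  then show ?thesis using half_le_hex[OF b] by simp
qed

text \<open>Passing to the limit loses strictness, so one strict step is made before it: a slide if
  \<open>a < 1/2\<close>, and otherwise a leg step, whose slide is proper because
  \<open>b > sqrt 3 / 2\<close>.\<close>

lemma hex_maximal_strict:
  assumes "strict_antimono_on UNIV g" "(a, b) \<in> param_domain" "(a, b) \<noteq> (1/2, sqrt 3 / 2)"
  shows "torus_mean g a b < torus_mean g (1/2) (sqrt 3 / 2)"
proof -
  have *: "b > 0" "0 \<le> a" "a \<le> 1/2" using assms by (auto simp: param_domain_def)
  have b: "b \<ge> 1/2" using domain_height[OF assms(2)] half_sqrt3_ge by linarith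
  show ?thesis
  proof (cases "a < 1/2")
    case True
    then have "torus_mean g a b < torus_mean g (1/2) b"
      using * b by (intro steiner_strict assms shift_bound) auto
    then show ?thesis using half_le_hex[OF b] by simp
  next
    case False
    then have a: "a = 1/2" and "b > sqrt 3 / 2" using * assms(3) domain_height[OF assms(2)] by auto
    then have "torus_mean g a b < torus_mean g (1/2) (next_height b)"
      using half_step_strict[OF assms(1)] unfolding a by blast
    also have "\<dots> = torus_mean g (1/2) (folded_height b)" using folded_height(2)[OF b] by simp
    also have "\<dots> \<le> torus_mean g (1/2) (sqrt 3 / 2)"
      by (rule half_le_hex[OF folded_height(1)[OF b]])
    finally show ?thesis .
  qed
qed

end

section \<open>The square torus\<close>

lemma int_dist_triangle: "int_dist x \<le> int_dist (x - a) + \<bar>a\<bar>"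
  using int_dist_le[of x "round (x - a)"] unfolding int_dist_def[of "x - a"] by linarith

lemma nn_integral_interval_scale:
  fixes f :: "real \<Rightarrow> ennreal"
  assumes [measurable]: "f \<in> borel_measurable borel" and "c > 0"
  shows "interval_integral u v f =
         ennreal c * interval_integral (u/c) (v/c) (\<lambda>x. f (c * x))"
proof -
  have "interval_integral u v f =
        ennreal \<bar>c\<bar> * (\<integral>\<^sup>+x. f (0 + c * x) * indicator {u..<v} (0 + c * x) \<partial>lborel)"
    using assms by (intro nn_integral_real_affine) auto
  also have "(\<lambda>x. f (0 + c * x) * indicator {u..<v} (0 + c * x)) = (\<lambda>x. f (c * x) * indicator {u/c..<v/c} x)"
    using assms by (auto simp: indicator_def fun_eq_iff field_simps)
  finally show ?thesis using assms by simp
qed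

lemma borel_measurable_nn_integral_circle:
  fixes f :: "real \<Rightarrow> real \<Rightarrow> ennreal"
  assumes [measurable]: "(\<lambda>(y, x). f y x) \<in> borel_measurable (borel \<Otimes>\<^sub>M borel)"
  shows "(\<lambda>y. circle_integral (f y)) \<in> borel_measurable borel"
proof -
  have "(\<lambda>y. circle_integral (f y)) = (\<lambda>y. interval_integral 0 1 (f y))"
    by (intro ext nn_integral_circle) measurable
  also have "\<dots> \<in> borel_measurable borel" by measurable
  finally show ?thesis .
qed

lemma nn_integral_circle_even:
  fixes h :: "real \<Rightarrow> ennreal"
  assumes [measurable]: "h \<in> borel_measurable borel" and "\<And>x. h (x + 1) = h x" and "\<And>x. h (- x) = h x"
  shows "circle_integral h = 2 * interval_integral 0 (1/2) h"
proof -
  have "circle_integral h = (\<integral>\<^sup>+x. 2 * (h x * indicator {-1/2..<0} x) \<partial>lborel)"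
    by (subst nn_integral_circle_fold[where s=0]) (auto simp: assms mult_2 distrib_left distrib_right intro!: nn_integral_cong)
  also have "\<dots> = 2 * interval_integral (-1/2) 0 (\<lambda>x. h (0 - x))"
    by (subst nn_integral_cmult) (auto simp: assms)
  also have "\<dots> = 2 * interval_integral 0 (1/2) h"
    by (subst nn_integral_interval_reflect) auto
  finally show ?thesis .
qed

context radial_profile begin

text \<open>For \<open>y\<close> at most \<open>1/2 - a/2\<close> the lower row is the nearer one
  everywhere, and the slide has no effect. In the remaining strip the gain is bounded by that of two
  copies of the lower row, displaced by \<open>a\<close>. Since the strip has width of order
  \<open>a\<close> and the gain per row is at most \<open>a * g 0\<close>, the total is
  quadratic.\<close>

lemma two_row_shift_le:
  assumes "0 \<le> a" "a \<le> 1/2" "0 \<le> y" "y \<le> 1/2"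
  shows "circle_integral (\<lambda>x. ennreal (two_row a 1 y x)) \<le>
    circle_integral (\<lambda>x. ennreal (two_row 0 1 y x)) + ennreal (a * g 0) * indicator {1/2-a/2<..1/2} y"
proof -
  define u where "u x = ennreal (g (quad_form 1 (int_dist x) y))" for x
  have [measurable]: "u \<in> borel_measurable borel" unfolding u_def by measurable
  have per: "u (x + 1) = u x" for x by (simp add: u_def)
  have sym: "u (- x) = u x" for x by (simp add: u_def)
  have u0: "u x \<le> ennreal (g 0)" for x unfolding u_def by (intro ennreal_leI profile_mono) auto
  have "quad_form 1 (int_dist x) y \<le> quad_form 1 (int_dist x) (1 - y)" for x
    using assms by (intro quad_form_mono) auto
  then have row0: "ennreal (two_row 0 1 y x) = u x" for x
    by (simp add: two_row_def u_def max_absorb1[OF profile_mono])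
  show ?thesis
  proof (cases "y \<le> 1/2 - a/2")
    case True
    have "quad_form 1 (int_dist x) y \<le> quad_form 1 (int_dist (x - a)) (1 - y)" for x
    proof -
      define p where "p = int_dist x"
      define q where "q = int_dist (x - a)"
      have pq: "0 \<le> p" "0 \<le> q" "p + q \<le> 1" "p \<le> q + a"
        using int_dist_le_half[of x] int_dist_le_half[of "x - a"] int_dist_triangle[of x a] assms
        by (auto simp: p_def q_def)
      have "p\<^sup>2 - q\<^sup>2 \<le> a"
      proof (cases "p \<le> q")
        case True
        then have "p\<^sup>2 \<le> q\<^sup>2" using pq by (intro power_mono)
        then show ?thesis using assms by simp
      next
        case False
        then have "(p - q) * (p + q) \<le> a * 1" using pq assms by (intro mult_mono) auto
        then show ?thesis by (simp add: power2_eq_square algebra_simps)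
      qed
      then show ?thesis using True
        by (simp add: quad_form_def p_def q_def power2_eq_square algebra_simps)
    qed
    then have "ennreal (two_row a 1 y x) = u x" for x
      by (simp add: two_row_def u_def max_absorb1[OF profile_mono])
    then show ?thesis by (simp add: row0)
  next
    case False
    have le: "ennreal (two_row a 1 y x) \<le> max (u x) (u (x - a))" for x
    proof -
      have "quad_form 1 (int_dist (x - a)) y \<le> quad_form 1 (int_dist (x - a)) (1 - y)"
        using assms by (intro quad_form_mono) auto
      then have "two_row a 1 y x \<le> max (g (quad_form 1 (int_dist x) y)) (g (quad_form 1 (int_dist (x - a)) y))"
        unfolding two_row_def by (intro max.mono profile_mono) auto
      moreover have "max (u x) (u (x - a)) =
          ennreal (max (g (quad_form 1 (int_dist x) y)) (g (quad_form 1 (int_dist (x - a)) y)))"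
        unfolding u_def by (subst max_of_mono[of ennreal]) (auto intro: monoI ennreal_leI)
      ultimately show ?thesis by (simp only: ennreal_leI)
    qed
    have "circle_integral (\<lambda>x. ennreal (two_row a 1 y x)) \<le> circle_integral (\<lambda>x. max (u x) (u (x - a)))"
      using le by (intro nn_integral_mono)
    also have "\<dots> = interval_integral (a/2-1/2) (a/2) (\<lambda>x. max (u x) (u (x - a)) + max (u (a - x)) (u (a - x - a)))"
      using per[of "x - a" for x] by (intro nn_integral_circle_fold) (auto simp: per diff_add_eq)
    also have "\<dots> = interval_integral (a/2-1/2) (a/2) (\<lambda>x. u x + u x)"
    proof (intro nn_integral_cong)
      fix x
      have "u (a - x) \<le> u x" if "a/2-1/2 \<le> x" "x < a/2"
        using int_dist_reflect_le[of 0 a x] assms that unfolding u_def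
        by (intro ennreal_leI profile_mono quad_form_mono) auto
      moreover have "u (x - a) = u (a - x)" "u (a - x - a) = u x"
        using sym[of "a - x"] sym[of x] by simp_all
      ultimately show "(max (u x) (u (x - a)) + max (u (a - x)) (u (a - x - a))) * indicator {a/2-1/2..<a/2} x
         = (u x + u x) * indicator {a/2-1/2..<a/2} x"
        by (auto simp: indicator_def max_def)
    qed
    \<comment> \<open>Folding at \<open>s = a\<close> gives the half circle that ends at
      \<open>a/2\<close>; folding the single row at 0 gives the one that ends at 0. The surplus is
      the segment from 0 to \<open>a/2\<close>, where the integrand is at most
      \<open>2 * g 0\<close>.\<close>
    also have "\<dots> \<le> (\<integral>\<^sup>+x. (u x + u (0 - x)) * indicator {0/2-1/2..<0/2} x +
        ennreal (2 * g 0) * indicator {0..<a/2} x \<partial>lborel)"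
      using add_mono[OF u0 u0] assms
      by (intro nn_integral_mono) (auto simp: indicator_def sym simp flip: ennreal_plus)
    also have "\<dots> = circle_integral u + ennreal (2 * g 0) * ennreal (a/2)"
      using nn_integral_circle_fold[of u 0] assms
      by (subst nn_integral_add) (auto simp: per nn_integral_cmult)
    also have "ennreal (2 * g 0) * ennreal (a/2) = ennreal (a * g 0)"
      using assms by (simp flip: ennreal_mult)
    finally show ?thesis using False assms by (simp add: row0)
  qed
qed

text \<open>The point reflection of the strip that exchanges its two bounding rows; it reduces
  \<open>y > 1/2\<close> to \<open>y \<le> 1/2\<close>.\<close>

lemma two_row_mirror:
  "circle_integral (\<lambda>x. ennreal (two_row a b (1 - y) x)) = circle_integral (\<lambda>x. ennreal (two_row a b y x))"
proof -
  have "two_row a b (1 - y) x = two_row a b y (a - x)" for x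
    using int_dist_commute[of a x] by (simp add: two_row_def max.commute)
  then show ?thesis
    by (simp add: nn_integral_circle_reflect[of "\<lambda>x. ennreal (two_row a b y x)"] two_row_periodic)
qed

lemma torus_mean_square_shift_le:
  assumes "0 \<le> a" "a \<le> 1/2"
  shows "torus_mean g a 1 \<le> torus_mean g 0 1 + ennreal (g 0 * a\<^sup>2)"
proof -
  let ?I = "\<lambda>a y. circle_integral (\<lambda>x. ennreal (two_row a 1 y x))"
  have I: "?I a \<in> borel_measurable borel" for a
    by (subst nn_integral_circle, measurable)
  have eq: "torus_mean g c 1 = circle_integral (?I c)" if "0 \<le> c" "c \<le> 1/2" for c
    unfolding torus_mean_def using that
    by (intro nn_integral_cong) (auto intro!: profile_flat_dist2 shift_bound)
  have le: "?I a y \<le> ?I 0 y + ennreal (a * g 0) * indicator {1/2-a/2..1/2+a/2} y" if "y \<in> {0..<1}" for y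
  proof (cases "y \<le> 1/2")
    case True
    then show ?thesis using two_row_shift_le[OF assms, of y] that
      by (auto elim!: order_trans intro!: add_left_mono mult_left_mono simp: indicator_def)
  next
    case False
    then show ?thesis using two_row_shift_le[OF assms, of "1-y"] that two_row_mirror[of a 1 y] two_row_mirror[of 0 1 y]
      by (auto elim!: order_trans intro!: add_left_mono mult_left_mono simp: indicator_def)
  qed
  have "torus_mean g a 1 \<le> circle_integral (\<lambda>y. ?I 0 y + ennreal (a * g 0) * indicator {1/2-a/2..1/2+a/2} y)"
    unfolding eq[OF assms] using le by (intro nn_integral_mono) auto
  also have "\<dots> = torus_mean g 0 1 + circle_integral (\<lambda>y. ennreal (a * g 0) * indicator {1/2-a/2..1/2+a/2} y)"
    by (subst nn_integral_add) (auto intro!: borel_measurable_circle I simp: eq)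
  also have "circle_integral (\<lambda>y. ennreal (a * g 0) * indicator {1/2-a/2..1/2+a/2} y) \<le>
     (\<integral>\<^sup>+y. ennreal (a * g 0) * indicator {1/2-a/2..1/2+a/2} y \<partial>lborel)"
    by (subst nn_integral_circle) (auto intro!: nn_integral_mono simp: indicator_def)
  also have "\<dots> = ennreal (g 0 * a\<^sup>2)"
    using assms by (simp add: nn_integral_cmult power2_eq_square ac_simps flip: ennreal_mult)
  finally show ?thesis by (simp add: add_left_mono)
qed

section \<open>Rectangular tori\<close>

definition box_integral :: "real \<Rightarrow> real \<Rightarrow> real \<Rightarrow> real \<Rightarrow> ennreal" where
  "box_integral u v u' v' =
    interval_integral u' v' (\<lambda>y. interval_integral u v (\<lambda>x. ennreal (g (x\<^sup>2 + y\<^sup>2))))"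

lemma box_integral_swap: "box_integral u v u' v' = box_integral u' v' u v"
proof -
  have "box_integral u v u' v' =
    (\<integral>\<^sup>+y. \<integral>\<^sup>+x. ennreal (g (x\<^sup>2 + y\<^sup>2)) * indicator {u..<v} x * indicator {u'..<v'} y \<partial>lborel \<partial>lborel)"
    unfolding box_integral_def by (subst nn_integral_multc) auto
  also have "\<dots> =
    (\<integral>\<^sup>+x. interval_integral u' v' (\<lambda>y. ennreal (g (x\<^sup>2 + y\<^sup>2)) * indicator {u..<v} x) \<partial>lborel)"
    by (intro lborel_pair.Fubini') measurable
  also have "\<dots> =
    (\<integral>\<^sup>+x. \<integral>\<^sup>+y. ennreal (g (y\<^sup>2 + x\<^sup>2)) * indicator {u'..<v'} y * indicator {u..<v} x \<partial>lborel \<partial>lborel)"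
    by (intro nn_integral_cong) (simp add: ac_simps)
  also have "\<dots> = box_integral u' v' u v"
    unfolding box_integral_def by (subst nn_integral_multc) auto
  finally show ?thesis .
qed

lemma box_integral_split:
  assumes "u' \<le> w" "w \<le> v'"
  shows "box_integral u v u' v' = box_integral u v u' w + box_integral u v w v'"
  unfolding box_integral_def using assms by (intro nn_integral_interval_split) auto

text \<open>The Voronoi cell of a rectangular lattice is a rectangle centred at the origin; one
  quadrant is kept. Scaling \<open>x\<close> by \<open>sqrt b\<close> and \<open>y\<close> by its
  inverse makes the quadratic form Euclidean and preserves area.\<close>

lemma torus_mean_rectangle:
  assumes "b > 0"
  shows "torus_mean g 0 b = 4 * box_integral 0 (1 / (2 * sqrt b)) 0 (sqrt b / 2)"
proof -
  define c where "c = sqrt b"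
  have c: "c > 0" "b = c * c" using assms by (auto simp: c_def)
  define I where "I y = circle_integral (\<lambda>x. ennreal (g (quad_form b (int_dist x) (int_dist y))))" for y
  have [measurable]: "I \<in> borel_measurable borel"
  proof -
    have "(\<lambda>(y, x). ennreal (g (quad_form b (int_dist x) (int_dist y)))) \<in> borel_measurable (borel \<Otimes>\<^sub>M borel)"
      by measurable
    from borel_measurable_nn_integral_circle[OF this] show ?thesis by (simp only: I_def[abs_def])
  qed
  have "flat_dist2 0 b x y = quad_form b (int_dist x) (int_dist y)" if "0 \<le> y" "y < 1" for x y
  proof -
    have "min (quad_form b (int_dist x) y) (quad_form b (int_dist x) (1 - y)) = quad_form b (int_dist x) (min y (1 - y))"
      using quad_form_mono[OF assms, of "int_dist x" "int_dist x"] that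
      by (cases "y \<le> 1 - y") (auto simp: min_def intro!: antisym)
    then show ?thesis using flat_dist2_rows[OF assms, of 0 y x] int_dist_unit[of y] that by simp
  qed
  then have "torus_mean g 0 b = circle_integral I"
    unfolding torus_mean_def I_def by (intro nn_integral_cong) auto
  also have "\<dots> = 2 * interval_integral 0 (1/2) I"
  proof (rule nn_integral_circle_even)
    show "I (y + 1) = I y" "I (- y) = I y" for y by (simp_all add: I_def)
  qed measurable
  also have "interval_integral 0 (1/2) I =
     interval_integral 0 (1/2) (\<lambda>y. 2 * interval_integral 0 (1/2) (\<lambda>x. ennreal (g (quad_form b x y))))"
  proof (intro nn_integral_cong)
    fix y
    have "I y = 2 * interval_integral 0 (1/2) (\<lambda>x. ennreal (g (quad_form b (int_dist x) (int_dist y))))"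
      unfolding I_def by (rule nn_integral_circle_even) auto
    also have "interval_integral 0 (1/2) (\<lambda>x. ennreal (g (quad_form b (int_dist x) (int_dist y)))) =
      interval_integral 0 (1/2) (\<lambda>x. ennreal (g (quad_form b x y)))" if "0 \<le> y" "y < 1/2"
      using that by (intro nn_integral_cong) (auto simp: indicator_def int_dist_eq_abs)
    finally show "I y * indicator {0..<1/2} y =
      (2 * interval_integral 0 (1/2) (\<lambda>x. ennreal (g (quad_form b x y)))) * indicator {0..<1/2} y"
      by (auto simp: indicator_def)
  qed
  also have "\<dots> = 2 * interval_integral 0 (1/2) (\<lambda>y. interval_integral 0 (1/2) (\<lambda>x. ennreal (g (quad_form b x y))))"
    by (simp add: nn_integral_cmult mult.assoc)
  also have "interval_integral 0 (1/2) (\<lambda>y. interval_integral 0 (1/2) (\<lambda>x. ennreal (g (quad_form b x y)))) =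
    ennreal (1/c) * interval_integral (0/(1/c)) ((1/2)/(1/c)) (\<lambda>y. interval_integral 0 (1/2) (\<lambda>x. ennreal (g (quad_form b x (1/c * y)))))"
    using c by (intro nn_integral_interval_scale) auto
  also have "interval_integral (0/(1/c)) ((1/2)/(1/c)) (\<lambda>y. interval_integral 0 (1/2) (\<lambda>x. ennreal (g (quad_form b x (1/c * y))))) =
    interval_integral (0/(1/c)) ((1/2)/(1/c)) (\<lambda>y. ennreal c * interval_integral (0/c) ((1/2)/c) (\<lambda>x. ennreal (g (quad_form b (c * x) (1/c * y)))))"
    using c by (subst nn_integral_interval_scale[of _ c 0 "1/2"]) auto
  also have "\<dots> = ennreal c * box_integral 0 ((1/2)/c) 0 (c/2)"
  proof -
    have "quad_form b (c * x) (1/c * y) = x\<^sup>2 + y\<^sup>2" for x y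
      using c by (simp add: quad_form_def power2_eq_square field_simps)
    then show ?thesis by (simp add: box_integral_def nn_integral_cmult mult.assoc)
  qed
  also have "ennreal (1/c) * (ennreal c * box_integral 0 ((1/2)/c) 0 (c/2)) = box_integral 0 ((1/2)/c) 0 (c/2)"
    using c by (simp add: mult.assoc[symmetric] flip: ennreal_mult)
  finally show ?thesis by (simp add: c_def mult.assoc[symmetric])
qed

end

text \<open>Serves both directions at the square torus: order 3/2 is what passing to a rectangle
  costs, and it also dominates the quadratic bound for the slide. An order above 1 yields the
  derivative 0 without regularity of the profile.\<close>

lemma has_real_derivative_0I:
  fixes \<phi> :: "real \<Rightarrow> real"
  assumes "\<delta> > 0" and bound: "\<And>x. \<bar>x - c\<bar> < \<delta> \<Longrightarrow> \<bar>\<phi> x - \<phi> c\<bar> \<le> K * (\<bar>x - c\<bar> * sqrt \<bar>x - c\<bar>)"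
  shows "(\<phi> has_real_derivative 0) (at c)"
proof -
  have "((\<lambda>h. K * sqrt \<bar>h\<bar>) \<longlongrightarrow> K * sqrt \<bar>0\<bar>) (at 0)"
    by (intro tendsto_intros)
  then have lim: "((\<lambda>h. K * sqrt \<bar>h\<bar>) \<longlongrightarrow> 0) (at 0)" by simp
  have "eventually (\<lambda>h. norm ((\<phi> (c + h) - \<phi> c) / h) \<le> K * sqrt \<bar>h\<bar>) (at 0)"
    unfolding eventually_at
  proof (intro exI[of _ \<delta>] conjI ballI impI)
    fix h :: real assume "h \<noteq> 0 \<and> dist h 0 < \<delta>"
    then show "norm ((\<phi> (c + h) - \<phi> c) / h) \<le> K * sqrt \<bar>h\<bar>"
      using bound[of "c + h"] by (simp add: field_simps)
  qed fact
  then have "((\<lambda>h. (\<phi> (c + h) - \<phi> c) / h) \<longlongrightarrow> 0) (at 0)"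
    by (rule Lim_null_comparison[OF _ lim])
  then show ?thesis by (simp add: DERIV_def)
qed

text \<open>Multiplied by \<open>c\<^sup>2\<close>, the difference of the two sides factors as
  \<open>(1 - c\<^sup>2) * (y\<^sup>2 - (c * x)\<^sup>2)\<close>, and
  \<open>c * x < c / 2 \<le> y\<close>.\<close>

lemma excess_farther:
  fixes c x y :: real
  assumes "0 < c" "c < 1" "0 \<le> x" "x < 1/2" "c/2 \<le> y"
  shows "x\<^sup>2 + y\<^sup>2 < (c * x)\<^sup>2 + (y / c)\<^sup>2"
proof -
  have "c * x < c * (1/2)" using assms by (intro mult_strict_left_mono)
  then have "c * x < y" using assms by linarith
  then have "(c * x)\<^sup>2 < y\<^sup>2" using assms by (intro power_strict_mono) auto
  then have "0 < (1 - c\<^sup>2) * (y\<^sup>2 - (c * x)\<^sup>2)"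
    using assms by (intro mult_pos_pos) (auto simp: power_less_one_iff)
  also have "\<dots> = c\<^sup>2 * ((c * x)\<^sup>2 + (y / c)\<^sup>2 - (x\<^sup>2 + y\<^sup>2))"
    using assms by (simp add: power2_eq_square field_simps)
  finally show ?thesis using assms by (simp add: zero_less_mult_iff)
qed

lemma nn_integral_interval_le:
  fixes f :: "real \<Rightarrow> ennreal"
  assumes "u \<le> v" "\<And>x. u \<le> x \<Longrightarrow> x < v \<Longrightarrow> f x \<le> k"
  shows "interval_integral u v f \<le> k * ennreal (v - u)"
proof -
  have "interval_integral u v f \<le> interval_integral u v (\<lambda>x. k)"
    using assms by (intro nn_integral_mono) (auto simp: indicator_def)
  then show ?thesis using assms by (simp add: nn_integral_cmult)
qed

lemma nn_integral_interval_ge: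
  fixes f :: "real \<Rightarrow> ennreal"
  assumes "u \<le> v" "\<And>x. u \<le> x \<Longrightarrow> x < v \<Longrightarrow> k \<le> f x"
  shows "k * ennreal (v - u) \<le> interval_integral u v f"
proof -
  have "interval_integral u v (\<lambda>x. k) \<le> interval_integral u v f"
    using assms by (intro nn_integral_mono) (auto simp: indicator_def)
  then show ?thesis using assms by (simp add: nn_integral_cmult)
qed

section \<open>Partial derivatives of the mean value at the square torus\<close>

context radial_profile begin

definition mean_val :: "real \<Rightarrow> real \<Rightarrow> real" where
  "mean_val a b = enn2real (torus_mean g a b)"

lemma ennreal_mean_val: "b > 0 \<Longrightarrow> ennreal (mean_val a b) = torus_mean g a b"
  using torus_mean_le[of b a] unfolding mean_val_def
  by (intro ennreal_enn2real) (auto simp: less_top[symmetric] top_unique)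

lemma mean_val_nonneg [simp]: "0 \<le> mean_val a b"
  by (simp add: mean_val_def)

lemma mean_val_le_iff:
  "b > 0 \<Longrightarrow> b' > 0 \<Longrightarrow> mean_val a b \<le> mean_val a' b' \<longleftrightarrow> torus_mean g a b \<le> torus_mean g a' b'"
  by (simp flip: ennreal_mean_val)

lemma mean_val_less_iff:
  "b > 0 \<Longrightarrow> b' > 0 \<Longrightarrow> mean_val a b < mean_val a' b' \<longleftrightarrow> torus_mean g a b < torus_mean g a' b'"
  by (simp add: ennreal_less_iff flip: ennreal_mean_val)

lemma mean_val_square_shift:
  assumes "\<bar>a\<bar> \<le> 1/2"
  shows "mean_val 0 1 \<le> mean_val a 1" "mean_val a 1 \<le> mean_val 0 1 + g 0 * a\<^sup>2"
proof -
  have eq: "torus_mean g a 1 = torus_mean g \<bar>a\<bar> 1"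
    using torus_mean_minus[of 1 a] by (cases "a \<ge> 0") auto
  show "mean_val 0 1 \<le> mean_val a 1"
    using assms by (simp add: mean_val_le_iff eq steiner)
  have "torus_mean g a 1 \<le> torus_mean g 0 1 + ennreal (g 0 * \<bar>a\<bar>\<^sup>2)"
    unfolding eq using assms by (intro torus_mean_square_shift_le) auto
  then have "ennreal (mean_val a 1) \<le> ennreal (mean_val 0 1 + g 0 * a\<^sup>2)"
    by (simp add: ennreal_mean_val)
  then show "mean_val a 1 \<le> mean_val 0 1 + g 0 * a\<^sup>2"
    by (subst (asm) ennreal_le_iff) auto
qed

lemma mean_val_deriv_shift: "((\<lambda>a. mean_val a 1) has_real_derivative 0) (at 0)"
proof (rule has_real_derivative_0I[where \<delta>="1/2" and K="g 0"])
  fix a :: real assume a: "\<bar>a - 0\<bar> < 1/2"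
  have "a\<^sup>2 \<le> \<bar>a\<bar> * sqrt \<bar>a\<bar>"
  proof -
    have "\<bar>a\<bar> * \<bar>a\<bar> \<le> \<bar>a\<bar> * 1" using a by (intro mult_left_mono) auto
    then have "\<bar>a\<bar>\<^sup>2 \<le> \<bar>a\<bar>" by (simp only: power2_eq_square mult_1_right)
    then have "\<bar>a\<bar> \<le> sqrt \<bar>a\<bar>" by (rule real_le_rsqrt)
    then have "\<bar>a\<bar> * \<bar>a\<bar> \<le> \<bar>a\<bar> * sqrt \<bar>a\<bar>" by (rule mult_left_mono) simp
    then show ?thesis by (simp add: power2_eq_square)
  qed
  then have "g 0 * a\<^sup>2 \<le> g 0 * (\<bar>a\<bar> * sqrt \<bar>a\<bar>)" by (rule mult_left_mono) simp
  then show "\<bar>mean_val a 1 - mean_val 0 1\<bar> \<le> g 0 * (\<bar>a - 0\<bar> * sqrt \<bar>a - 0\<bar>)"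
    using mean_val_square_shift[of a] a by simp
qed simp

text \<open>The rectangle \<open>[0, c/2] \<times> [0, 1/(2c)]\<close> exceeds the square \<open>[0, 1/2]\<^sup>2\<close> by
  \<open>[0, c/2] \<times> [1/2, 1/(2c)]\<close> and lacks \<open>[c/2, 1/2] \<times> [0, 1/2]\<close>; up to exchanging the coordinates,
  \<open>(x, y) \<mapsto> (c x, y / c)\<close> maps the lacking part to the excess and moves each point away from the
  origin.\<close>

lemma excess_rescaled:
  assumes "0 < c"
  shows "box_integral 0 (c/2) (1/2) (1/(2*c)) =
    interval_integral (c/2) (1/2) (\<lambda>y. interval_integral 0 (1/2) (\<lambda>x. ennreal (g ((c * x)\<^sup>2 + (y / c)\<^sup>2))))"
proof -
  have "box_integral 0 (c/2) (1/2) (1/(2*c)) =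
    interval_integral (1/2) (1/(2*c)) (\<lambda>y. ennreal c * interval_integral (0/c) ((c/2)/c) (\<lambda>x. ennreal (g ((c * x)\<^sup>2 + y\<^sup>2))))"
    unfolding box_integral_def using assms by (subst nn_integral_interval_scale[of _ c 0 "c/2"]) auto
  also have "\<dots> = ennreal (1/c) * interval_integral ((1/2)/(1/c)) ((1/(2*c))/(1/c)) (\<lambda>y. ennreal c * interval_integral (0/c) ((c/2)/c) (\<lambda>x. ennreal (g ((c * x)\<^sup>2 + (1/c * y)\<^sup>2))))"
    using assms by (intro nn_integral_interval_scale) auto
  also have "\<dots> = ennreal (1/c) * (ennreal c * interval_integral (c/2) (1/2) (\<lambda>y. interval_integral 0 (1/2) (\<lambda>x. ennreal (g ((c * x)\<^sup>2 + (y / c)\<^sup>2)))))"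
    using assms by (simp add: nn_integral_cmult mult.assoc)
  finally show ?thesis using assms by (simp add: mult.assoc[symmetric] flip: ennreal_mult)
qed

lemma excess_le:
  assumes "0 < c" "c < 1"
  shows "box_integral 0 (c/2) (1/2) (1/(2*c)) \<le> box_integral 0 (1/2) (c/2) (1/2)"
  unfolding excess_rescaled[OF assms(1)] unfolding box_integral_def
  using less_imp_le[OF excess_farther[OF assms]]
  by (intro nn_integral_mono) (auto simp: indicator_def intro!: nn_integral_mono ennreal_leI profile_mono)

lemma box_integral_fin: "u \<le> v \<Longrightarrow> u' \<le> v' \<Longrightarrow> box_integral u v u' v' < \<infinity>"
proof -
  assume *: "u \<le> v" "u' \<le> v'"
  have row: "interval_integral u v (\<lambda>x. ennreal (g (x\<^sup>2 + y\<^sup>2))) \<le> ennreal (g 0) * ennreal (v - u)" for y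
    using * by (intro nn_integral_interval_le ennreal_leI profile_mono) auto
  have "box_integral u v u' v' \<le> ennreal (g 0) * ennreal (v - u) * ennreal (v' - u')"
    unfolding box_integral_def using nn_integral_interval_le[OF *(2) row] .
  also have "\<dots> < \<infinity>" by (simp add: ennreal_mult_less_top)
  finally show ?thesis .
qed

lemma excess_less:
  assumes strict: "strict_antimono_on UNIV g" and "0 < c" "c < 1"
  shows "box_integral 0 (c/2) (1/2) (1/(2*c)) < box_integral 0 (1/2) (c/2) (1/2)"
  unfolding excess_rescaled[OF assms(2)] unfolding box_integral_def
proof (rule nn_integral_less_on_interval[where l="c/2" and u="1/2"])
  let ?L = "\<lambda>y x. ennreal (g ((c * x)\<^sup>2 + (y / c)\<^sup>2)) * indicator {0..<1/2} x"
  let ?R = "\<lambda>y x. ennreal (g (x\<^sup>2 + y\<^sup>2)) * indicator {0..<1/2} x"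
  have lt: "g ((c * x)\<^sup>2 + (y / c)\<^sup>2) < g (x\<^sup>2 + y\<^sup>2)" if "0 \<le> x" "x < 1/2" "c/2 \<le> y" for x y
    using strict excess_farther[OF assms(2,3) that] by (simp add: monotone_on_def)
  show "interval_integral (c/2) (1/2) (\<lambda>y. \<integral>\<^sup>+x. ?L y x \<partial>lborel) \<noteq> \<infinity>"
    unfolding excess_rescaled[OF assms(2), symmetric]
    using box_integral_fin[of 0 "c/2" "1/2" "1/(2*c)"] assms by (auto simp: field_simps)
  show "(\<integral>\<^sup>+x. ?L y x \<partial>lborel) * indicator {c/2..<1/2} y \<le> (\<integral>\<^sup>+x. ?R y x \<partial>lborel) * indicator {c/2..<1/2} y" for y
    using less_imp_le[OF lt] by (auto simp: indicator_def intro!: nn_integral_mono ennreal_leI)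
  fix y assume y: "c/2 < y" "y < 1/2"
  have "(\<integral>\<^sup>+x. ?L y x \<partial>lborel) < (\<integral>\<^sup>+x. ?R y x \<partial>lborel)"
  proof (rule nn_integral_less_on_interval[where l=0 and u="1/2"])
    have "(\<integral>\<^sup>+x. ?L y x \<partial>lborel) \<le> ennreal (g 0) * ennreal (1/2 - 0)"
      by (intro nn_integral_interval_le ennreal_leI profile_mono) auto
    also have "\<dots> = ennreal (g 0 * (1/2 - 0))" by (rule ennreal_mult[symmetric]) auto
    also have "\<dots> < \<infinity>" unfolding infinity_ennreal_def by (rule ennreal_less_top)
    finally show "(\<integral>\<^sup>+x. ?L y x \<partial>lborel) \<noteq> \<infinity>" by simp
    show "?L y x \<le> ?R y x" for x
      using lt[of x y] y by (auto simp: indicator_def intro!: ennreal_leI less_imp_le)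
    show "?L y x < ?R y x" if "0 < x" "x < 1/2" for x
      using lt[of x y] y that by (auto simp: indicator_def ennreal_less_iff)
  qed auto
  then show "(\<integral>\<^sup>+x. ?L y x \<partial>lborel) * indicator {c/2..<1/2} y < (\<integral>\<^sup>+x. ?R y x \<partial>lborel) * indicator {c/2..<1/2} y"
    using y by simp
qed (use assms in auto)

text \<open>The lacking strip is bounded above by its lowest row, at height \<open>p = c/2\<close>,
  and the excess below by its highest row, at \<open>q = 1/(2*c)\<close>. If
  \<open>z^2 = q^2 - p^2\<close>, then \<open>(x - z)^2 + q^2 \<le> x^2 + p^2\<close> for
  \<open>x \<ge> z\<close>; so a shift by \<open>z\<close> compares the two rows up to an error of
  \<open>z * g 0\<close>. Multiplied by the width \<open>1/2 - c/2\<close>, this is the error term.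
  For \<open>c = 1 / sqrt b\<close> its factors are of order \<open>b - 1\<close> and
  \<open>sqrt (b - 1)\<close>, whence the exponent 3/2.\<close>

lemma excess_ge:
  assumes "0 < c" "c \<le> 1"
  shows "box_integral 0 (1/2) (c/2) (1/2) \<le> box_integral 0 (c/2) (1/2) (1/(2*c)) +
     ennreal ((1/2 - c/2) * (sqrt ((1/c\<^sup>2 - c\<^sup>2)/4) * g 0))"
proof -
  define p where "p = c/2"
  define q where "q = 1/(2*c)"
  define z where "z = sqrt ((1/c\<^sup>2 - c\<^sup>2)/4)"
  have c2: "c\<^sup>2 \<le> 1" using assms by (simp add: power_le_one)
  have p: "0 < p" "p \<le> 1/2" using assms by (auto simp: p_def)
  have q: "1/2 \<le> q" using assms by (simp add: q_def field_simps)
  have c4: "0 \<le> 1/c\<^sup>2 - c\<^sup>2"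
  proof -
    have "c\<^sup>2 * c\<^sup>2 \<le> 1 * 1" using c2 by (intro mult_mono) auto
    then show ?thesis using assms by (simp add: field_simps)
  qed
  have z2: "z\<^sup>2 = q\<^sup>2 - p\<^sup>2"
    using c4 by (simp add: z_def p_def q_def power_divide power_mult_distrib diff_divide_distrib)
  have z0: "0 \<le> z" using c4 by (simp add: z_def)
  \<comment> \<open>The aim is \<open>1/2 \<le> p + z\<close>: the part of the lower row beyond
    \<open>z\<close>, moved back by \<open>z\<close>, then fits into the interval from 0 to
    \<open>p\<close> of the higher row.\<close>
  have "(1/2)\<^sup>2 \<le> q\<^sup>2" using q by (intro power_mono) auto
  moreover have "0 \<le> p * (1/2 - p)" using p by simp
  ultimately have "(1/2 - p)\<^sup>2 \<le> z\<^sup>2" unfolding z2 by (simp add: power2_eq_square algebra_simps)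
  then have zp: "1/2 - z \<le> p" using z0 p by (auto dest: power2_le_imp_le)
  \<comment> \<open>The excess is at least as wide in \<open>y\<close> as the lacking strip, so the
    row comparison may be integrated over the smaller width.\<close>
  have pq: "1/2 - p \<le> q - 1/2"
  proof -
    have "0 \<le> (1 - c)\<^sup>2" by simp
    then have "2 * c \<le> 1 + c * c" by (simp add: power2_eq_square algebra_simps)
    then show ?thesis using assms by (simp add: p_def q_def field_simps)
  qed
  define J where "J = interval_integral 0 p (\<lambda>x. ennreal (g (x\<^sup>2 + q\<^sup>2)))"
  have J1: "interval_integral 0 (1/2) (\<lambda>x. ennreal (g (x\<^sup>2 + p\<^sup>2))) \<le> ennreal (g 0) * ennreal z + J"
  proof -
    have "interval_integral 0 (1/2) (\<lambda>x. ennreal (g (x\<^sup>2 + p\<^sup>2))) \<le>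
      (\<integral>\<^sup>+x. ennreal (g 0) * indicator {0..<z} x + ennreal (g ((x - z)\<^sup>2 + q\<^sup>2)) * indicator {z..<p+z} x \<partial>lborel)"
    proof (intro nn_integral_mono)
      fix x
      have "g (x\<^sup>2 + p\<^sup>2) \<le> g ((x - z)\<^sup>2 + q\<^sup>2)" if "z \<le> x"
      proof (rule profile_mono)
        have "z * z \<le> z * x" using that z0 by (intro mult_left_mono)
        then show "(x - z)\<^sup>2 + q\<^sup>2 \<le> x\<^sup>2 + p\<^sup>2" using z2 by (simp add: power2_eq_square algebra_simps)
      qed
      then show "ennreal (g (x\<^sup>2 + p\<^sup>2)) * indicator {0..<1/2} x \<le>
         ennreal (g 0) * indicator {0..<z} x + ennreal (g ((x - z)\<^sup>2 + q\<^sup>2)) * indicator {z..<p+z} x"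
        using zp by (cases "x < z") (auto simp: indicator_def intro!: ennreal_leI profile_mono)
    qed
    also have "\<dots> = ennreal (g 0) * ennreal z + interval_integral z (p+z) (\<lambda>x. ennreal (g ((x - z)\<^sup>2 + q\<^sup>2)))"
      using z0 by (subst nn_integral_add) (auto simp: nn_integral_cmult)
    also have "interval_integral z (p+z) (\<lambda>x. ennreal (g ((x - z)\<^sup>2 + q\<^sup>2))) = J"
      using nn_integral_interval_shift[of "\<lambda>x. ennreal (g ((x - z)\<^sup>2 + q\<^sup>2))" z 0 p]
      unfolding J_def by simp
    finally show ?thesis .
  qed
  have "box_integral 0 (1/2) p (1/2) \<le> (ennreal (g 0) * ennreal z + J) * ennreal (1/2 - p)"
    unfolding box_integral_def
  proof (rule nn_integral_interval_le)
    fix y assume "p \<le> y" "y < 1/2"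
    then have "p\<^sup>2 \<le> y\<^sup>2" using p by (intro power_mono) auto
    then have "interval_integral 0 (1/2) (\<lambda>x. ennreal (g (x\<^sup>2 + y\<^sup>2))) \<le>
      interval_integral 0 (1/2) (\<lambda>x. ennreal (g (x\<^sup>2 + p\<^sup>2)))"
      by (intro nn_integral_mono mult_right_mono ennreal_leI profile_mono) auto
    then show "interval_integral 0 (1/2) (\<lambda>x. ennreal (g (x\<^sup>2 + y\<^sup>2))) \<le> ennreal (g 0) * ennreal z + J"
      using J1 by (rule order_trans)
  qed (use p in simp)
  also have "\<dots> = ennreal ((1/2 - p) * (z * g 0)) + J * ennreal (1/2 - p)"
    using p z0 by (simp add: distrib_right distrib_left ennreal_mult ac_simps)
  also have "J * ennreal (1/2 - p) \<le> J * ennreal (q - 1/2)"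
    using pq by (intro mult_left_mono ennreal_leI) auto
  also have "\<dots> \<le> box_integral 0 p (1/2) q"
    unfolding box_integral_def J_def
  proof (rule nn_integral_interval_ge)
    fix y assume "1/2 \<le> y" "y < q"
    then have "y\<^sup>2 \<le> q\<^sup>2" by (intro power_mono) auto
    then show "interval_integral 0 p (\<lambda>x. ennreal (g (x\<^sup>2 + q\<^sup>2))) \<le>
      interval_integral 0 p (\<lambda>x. ennreal (g (x\<^sup>2 + y\<^sup>2)))"
      by (intro nn_integral_mono mult_right_mono ennreal_leI profile_mono) auto
  qed (use q in simp)
  finally show ?thesis
    by (simp add: p_def q_def z_def add_left_mono add.commute)
qed

lemma box_decompose:
  assumes "0 < c" "c \<le> 1"
  shows "box_integral 0 (1/2) 0 (1/2) = box_integral 0 (c/2) 0 (1/2) + box_integral 0 (1/2) (c/2) (1/2)"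
    and "box_integral 0 (c/2) 0 (1/(2*c)) = box_integral 0 (c/2) 0 (1/2) + box_integral 0 (c/2) (1/2) (1/(2*c))"
  using box_integral_split[of 0 "c/2" "1/2" 0 "1/2"] box_integral_split[of 0 "1/2" "1/(2*c)" 0 "c/2"] assms
    box_integral_swap[of 0 "1/2" 0 "c/2"]
  by (auto simp: field_simps)

lemma torus_mean_square: "torus_mean g 0 1 = 4 * box_integral 0 (1/2) 0 (1/2)"
  by (simp add: torus_mean_rectangle)

lemma torus_mean_rectangle':
  assumes "b > 0" shows "torus_mean g 0 b = 4 * box_integral 0 ((1/sqrt b)/2) 0 (1/(2*(1/sqrt b)))"
  using assms by (simp add: torus_mean_rectangle field_simps)

lemma torus_mean_rectangle_less:
  assumes "strict_antimono_on UNIV g" "b > 1"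
  shows "torus_mean g 0 b < torus_mean g 0 1"
proof -
  define c where "c = 1 / sqrt b"
  have c: "0 < c" "c \<le> 1" "c < 1" using assms by (auto simp: c_def)
  have "torus_mean g 0 b = 4 * (box_integral 0 (c/2) 0 (1/2) + box_integral 0 (c/2) (1/2) (1/(2*c)))"
    using torus_mean_rectangle'[of b] assms box_decompose(2)[OF c(1,2)] by (simp add: c_def[symmetric])
  also have "\<dots> < 4 * (box_integral 0 (c/2) 0 (1/2) + box_integral 0 (1/2) (c/2) (1/2))"
    using excess_less[OF assms(1) c(1,3)] box_integral_fin[of 0 "c/2" 0 "1/2"] c
    by (intro ennreal_mult_strict_left_mono ennreal_add_left_cancel_less[THEN iffD2]) (auto simp: less_top)
  also have "\<dots> = torus_mean g 0 1"
    using box_decompose(1)[OF c(1,2)] by (simp add: torus_mean_square)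
  finally show ?thesis .
qed

lemma torus_mean_rectangle_le:
  assumes "b \<ge> 1"
  shows "torus_mean g 0 b \<le> torus_mean g 0 1"
proof (cases "b = 1")
  case False
  define c where "c = 1 / sqrt b"
  have c: "0 < c" "c \<le> 1" "c < 1" using assms False by (auto simp: c_def)
  have "torus_mean g 0 b = 4 * (box_integral 0 (c/2) 0 (1/2) + box_integral 0 (c/2) (1/2) (1/(2*c)))"
    using torus_mean_rectangle'[of b] assms box_decompose(2)[OF c(1,2)] by (simp add: c_def[symmetric])
  also have "\<dots> \<le> 4 * (box_integral 0 (c/2) 0 (1/2) + box_integral 0 (1/2) (c/2) (1/2))"
    by (intro mult_left_mono add_left_mono excess_le c) auto
  also have "\<dots> = torus_mean g 0 1"
    using box_decompose(1)[OF c(1,2)] by (simp add: torus_mean_square)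
  finally show ?thesis .
qed simp

lemma torus_mean_rectangle_ge:
  assumes "b \<ge> 1"
  shows "torus_mean g 0 1 \<le> torus_mean g 0 b + ennreal (2 * g 0 * ((b - 1) * sqrt (b - 1)))"
proof -
  define c where "c = 1 / sqrt b"
  have c: "0 < c" "c \<le> 1" using assms by (auto simp: c_def)
  have c2: "c\<^sup>2 = 1/b" using assms by (simp add: c_def power_divide)
  define k where "k = (1/2 - c/2) * (sqrt ((1/c\<^sup>2 - c\<^sup>2)/4) * g 0)"
  \<comment> \<open>The tangent bound \<open>1/b \<ge> 2 - b\<close> gives both
    \<open>1 - c \<le> 1 - c\<^sup>2 \<le> b - 1\<close> and
    \<open>b - 1/b \<le> 2 * (b - 1)\<close>, which control the two factors of
    \<open>k\<close>.\<close>
  have bb: "1/b \<le> 1" "1/b \<ge> 2 - b"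
  proof -
    have "0 \<le> (b - 1)\<^sup>2" by simp
    then have "(2 - b) * b \<le> 1" by (simp add: power2_eq_square algebra_simps)
    then show "1/b \<ge> 2 - b" using assms by (simp add: field_simps)
  qed (use assms in simp)
  have "1/b \<le> b" using bb(1) assms by linarith
  then have c4: "0 \<le> 1/c\<^sup>2 - c\<^sup>2" by (simp add: c2)
  have "1 - c \<le> b - 1"
  proof -
    have "c * c \<le> c * 1" using c by (intro mult_left_mono) auto
    then show ?thesis using bb c2 by (simp add: power2_eq_square)
  qed
  moreover have "sqrt ((1/c\<^sup>2 - c\<^sup>2)/4) \<le> sqrt (b - 1)"
    using bb c2 assms by (intro real_sqrt_le_mono) simp
  ultimately have "(1 - c) * sqrt ((1/c\<^sup>2 - c\<^sup>2)/4) \<le> (b - 1) * sqrt (b - 1)"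
    using c c4 assms by (intro mult_mono) auto
  then have "g 0 * ((1 - c) * sqrt ((1/c\<^sup>2 - c\<^sup>2)/4)) \<le> g 0 * ((b - 1) * sqrt (b - 1))"
    by (rule mult_left_mono) simp
  then have k: "4 * k \<le> 2 * g 0 * ((b - 1) * sqrt (b - 1))" by (simp add: k_def algebra_simps)
  have k0: "0 \<le> k" using c c4 by (auto simp: k_def)
  have "torus_mean g 0 1 = 4 * (box_integral 0 (c/2) 0 (1/2) + box_integral 0 (1/2) (c/2) (1/2))"
    using box_decompose(1)[OF c] by (simp add: torus_mean_square)
  also have "\<dots> \<le> 4 * (box_integral 0 (c/2) 0 (1/2) + (box_integral 0 (c/2) (1/2) (1/(2*c)) + ennreal k))"
    unfolding k_def by (intro mult_left_mono add_left_mono excess_ge c) auto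
  also have "\<dots> = torus_mean g 0 b + ennreal (4 * k)"
    using torus_mean_rectangle'[of b] assms box_decompose(2)[OF c] k0
    by (simp add: c_def[symmetric] distrib_left add.assoc ennreal_mult)
  also have "\<dots> \<le> torus_mean g 0 b + ennreal (2 * g 0 * ((b - 1) * sqrt (b - 1)))"
    using k by (intro add_left_mono ennreal_leI)
  finally show ?thesis .
qed

lemma mean_val_rectangle:
  assumes "b \<ge> 1"
  shows "\<bar>mean_val 0 b - mean_val 0 1\<bar> \<le> 2 * g 0 * ((b - 1) * sqrt (b - 1))"
proof -
  have "mean_val 0 b \<le> mean_val 0 1"
    using torus_mean_rectangle_le[OF assms] assms by (simp add: mean_val_le_iff)
  moreover have "ennreal (mean_val 0 1) \<le> ennreal (mean_val 0 b + 2 * g 0 * ((b - 1) * sqrt (b - 1)))"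
    using torus_mean_rectangle_ge[OF assms] assms by (simp add: ennreal_mean_val)
  then have "mean_val 0 1 \<le> mean_val 0 b + 2 * g 0 * ((b - 1) * sqrt (b - 1))"
    using assms by (subst (asm) ennreal_le_iff) auto
  ultimately show ?thesis by simp
qed

lemma mean_val_deriv_rectangle: "((\<lambda>b. mean_val 0 b) has_real_derivative 0) (at 1)"
proof (rule has_real_derivative_0I[where \<delta>="1/2" and K="8 * g 0"])
  fix b :: real assume b: "\<bar>b - 1\<bar> < 1/2"
  define t where "t = \<bar>b - 1\<bar>"
  have t: "0 \<le> t" by (simp add: t_def)
  \<comment> \<open>For \<open>b < 1\<close> the swap leads to \<open>1/b\<close>, whose distance to
    1 is at most doubled because \<open>b > 1/2\<close>. Bounding \<open>sqrt (2 * t)\<close> by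
    \<open>2 * sqrt t\<close> turns the constant 2 into 8.\<close>
  have le: "2 * g 0 * (s * sqrt s) \<le> 8 * g 0 * (t * sqrt t)" if "0 \<le> s" "s \<le> 2 * t" for s
  proof -
    have "sqrt s \<le> sqrt (4 * t)" using that t by (intro real_sqrt_le_mono) auto
    then have "s * sqrt s \<le> (2 * t) * (2 * sqrt t)"
      using that t by (intro mult_mono) (auto simp: real_sqrt_mult)
    then have "2 * g 0 * (s * sqrt s) \<le> 2 * g 0 * ((2 * t) * (2 * sqrt t))"
      by (rule mult_left_mono) simp
    then show ?thesis by (simp add: algebra_simps)
  qed
  have "\<bar>mean_val 0 b - mean_val 0 1\<bar> \<le> 8 * g 0 * (t * sqrt t)"
  proof (cases "b \<ge> 1")
    case True
    then show ?thesis using mean_val_rectangle[of b] le[of "b - 1"] by (simp add: t_def)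
  next
    case False
    have "b > 0" using b unfolding abs_less_iff by linarith
    then have "mean_val 0 b = mean_val 0 (1/b)"
      using torus_mean_swap[of b 0] b by (simp add: mean_val_def power2_eq_square)
    moreover have "1/b \<ge> 1" "1/b - 1 \<le> 2 * t"
    proof -
      have "0 \<le> (b - 1/2) * (1 - b)" using b False by (intro mult_nonneg_nonneg) auto
      then show "1/b - 1 \<le> 2 * t" using b False by (simp add: t_def field_simps)
      show "1/b \<ge> 1" using b False by simp
    qed
    ultimately show ?thesis
      using order_trans[OF mean_val_rectangle[of "1/b"] le[of "1/b - 1"]] by simp
  qed
  then show "\<bar>mean_val 0 b - mean_val 0 1\<bar> \<le> 8 * g 0 * (\<bar>b - 1\<bar> * sqrt \<bar>b - 1\<bar>)"
    by (simp add: t_def)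
qed simp

text \<open>All distances are at most \<open>d\<close>, so the mean is at least \<open>g d\<close>.
  Positivity permits the division in \<open>kernel_op_pointwise\<close> and the differentiation of
  the square root at the mean.\<close>

lemma mean_val_pos: assumes "b > 0" shows "mean_val a b > 0"
proof -
  define d where "d = quad_form b (1/2) 1"
  have le: "flat_dist2 a b x y \<le> d" if "y \<in> {0..<1}" for x y
  proof -
    have "flat_dist2 a b x y \<le> quad_form b (int_dist x) y" by (rule flat_dist2_le_rows[OF assms])
    also have "\<dots> \<le> d" unfolding d_def
      using int_dist_le_half[of x] that by (intro quad_form_mono assms) auto
    finally show ?thesis .
  qed
  have "circle_integral (\<lambda>y. circle_integral (\<lambda>x. ennreal (g d))) \<le> torus_mean g a b"
    unfolding torus_mean_def using le by (intro nn_integral_mono ennreal_leI profile_mono) auto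
  then have "ennreal (g d) \<le> ennreal (mean_val a b)"
    using assms by (simp add: ennreal_mean_val flip: space_circle)
  then have "g d \<le> mean_val a b" by (subst (asm) ennreal_le_iff) auto
  then show ?thesis using positive[of d] by simp
qed

end

section \<open>Operators with a kernel of constant row integral\<close>

lemma cmod_diff_sq: "(cmod (z - w))\<^sup>2 = (cmod z)\<^sup>2 - 2 * Re (cnj w * z) + (cmod w)\<^sup>2"
  by (simp only: cmod_power2) (simp add: power2_eq_square algebra_simps)

lemma cmod_add_sq_le: "(cmod (z + w))\<^sup>2 \<le> 2 * (cmod z)\<^sup>2 + 2 * (cmod w)\<^sup>2"
proof -
  have "(cmod (z + w))\<^sup>2 \<le> (cmod z + cmod w)\<^sup>2"
    by (intro power_mono norm_triangle_ineq) simp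
  moreover have "0 \<le> (cmod z - cmod w)\<^sup>2" by simp
  ultimately show ?thesis by (simp add: power2_eq_square algebra_simps)
qed

lemma sq_integrableI_bound:
  assumes "\<psi> \<in> borel_measurable M" "integrable M h" "\<And>x. (cmod (\<psi> x))\<^sup>2 \<le> h x"
  shows "sq_integrable M \<psi>"
proof -
  have "integrable M (\<lambda>x. (cmod (\<psi> x))\<^sup>2)"
    using assms(1,3) by (intro Bochner_Integration.integrable_bound[OF assms(2)])
      (auto intro!: AE_I2 order_trans[OF assms(3) abs_ge_self])
  then show ?thesis using assms(1) by (simp add: sq_integrable_def)
qed

lemma sq_integrable_measurable: "sq_integrable M \<psi> \<Longrightarrow> \<psi> \<in> borel_measurable M"
  by (simp add: sq_integrable_def)

lemma sq_integrable_integrable: "sq_integrable M \<psi> \<Longrightarrow> integrable M (\<lambda>x. (cmod (\<psi> x))\<^sup>2)"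
  by (simp add: sq_integrable_def)

lemma sq_integrable_add:
  assumes "sq_integrable M \<psi>" "sq_integrable M \<phi>"
  shows "sq_integrable M (\<lambda>x. \<psi> x + \<phi> x)"
  using assms cmod_add_sq_le
  by (intro sq_integrableI_bound[where h="\<lambda>x. 2 * (cmod (\<psi> x))\<^sup>2 + 2 * (cmod (\<phi> x))\<^sup>2"])
     (auto simp: sq_integrable_def)

lemma sq_integrable_scale:
  "sq_integrable M \<psi> \<Longrightarrow> sq_integrable M (\<lambda>x. c * \<psi> x)"
  by (auto simp: sq_integrable_def norm_mult power_mult_distrib)

lemma sq_integrable_zero: "sq_integrable M (\<lambda>x. 0)"
  by (simp add: sq_integrable_def)

lemma sq_integrable_sum:
  "(\<And>i. i \<in> I \<Longrightarrow> sq_integrable M (\<psi> i)) \<Longrightarrow> sq_integrable M (\<lambda>x. \<Sum>i\<in>I. \<psi> i x)"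
  by (induction I rule: infinite_finite_induct) (auto simp: sq_integrable_zero sq_integrable_add)

lemma sq_integrable_diff:
  "sq_integrable M \<psi> \<Longrightarrow> sq_integrable M \<phi> \<Longrightarrow> sq_integrable M (\<lambda>x. \<psi> x - \<phi> x)"
  using sq_integrable_add[of M \<psi> "\<lambda>x. (-1) * \<phi> x"] sq_integrable_scale[of M \<phi> "-1"] by simp

lemma cnj_measurable [measurable]: "cnj \<in> borel_measurable borel"
  by (intro borel_measurable_continuous_onI continuous_on_cnj continuous_on_id)

lemma integrable_mult_cnj:
  assumes "sq_integrable M \<psi>" "sq_integrable M \<phi>"
  shows "integrable M (\<lambda>x. \<psi> x * cnj (\<phi> x))"
proof (rule Bochner_Integration.integrable_bound)
  show "integrable M (\<lambda>x. (cmod (\<psi> x))\<^sup>2 + (cmod (\<phi> x))\<^sup>2)"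
    using assms by (simp add: sq_integrable_def)
  show "AE x in M. norm (\<psi> x * cnj (\<phi> x)) \<le> norm ((cmod (\<psi> x))\<^sup>2 + (cmod (\<phi> x))\<^sup>2)"
  proof (rule AE_I2)
    fix x
    have "0 \<le> (cmod (\<psi> x) - cmod (\<phi> x))\<^sup>2" "0 \<le> cmod (\<psi> x) * cmod (\<phi> x)" by simp_all
    then have "cmod (\<psi> x) * cmod (\<phi> x) \<le> (cmod (\<psi> x))\<^sup>2 + (cmod (\<phi> x))\<^sup>2"
      unfolding power2_diff by linarith
    then show "norm (\<psi> x * cnj (\<phi> x)) \<le> norm ((cmod (\<psi> x))\<^sup>2 + (cmod (\<phi> x))\<^sup>2)"
      by (simp add: norm_mult)
  qed
qed (use assms in \<open>auto simp: sq_integrable_def\<close>)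

lemma l2_norm_sq: "(l2_norm M \<psi>)\<^sup>2 = (LINT x|M. (cmod (\<psi> x))\<^sup>2)"
  by (simp add: l2_norm_def)

lemma l2_norm_nonneg [simp]: "0 \<le> l2_norm M \<psi>"
  by (simp add: l2_norm_def)

lemma l2_inner_diff_scaled:
  assumes "sq_integrable M \<psi>" "sq_integrable M \<phi>" "sq_integrable M \<eta>"
  shows "l2_inner M (\<lambda>x. \<psi> x - c * \<phi> x) \<eta> = l2_inner M \<psi> \<eta> - c * l2_inner M \<phi> \<eta>"
proof -
  have "l2_inner M (\<lambda>x. \<psi> x - c * \<phi> x) \<eta> = (LINT x|M. \<psi> x * cnj (\<eta> x) - c * (\<phi> x * cnj (\<eta> x)))"
    unfolding l2_inner_def by (simp add: algebra_simps)
  then show ?thesis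
    using integrable_mult_cnj[OF assms(1,3)] integrable_mult_cnj[OF assms(2,3)]
    by (simp add: l2_inner_def)
qed

lemma l2_norm_diff_scaled:
  assumes "sq_integrable M \<psi>" "sq_integrable M \<phi>" "l2_inner M \<phi> \<phi> = 1"
  shows "(l2_norm M (\<lambda>x. \<psi> x - d * \<phi> x))\<^sup>2 =
    (l2_norm M \<psi>)\<^sup>2 + ((cmod (l2_inner M \<psi> \<phi> - d))\<^sup>2 - (cmod (l2_inner M \<psi> \<phi>))\<^sup>2)"
proof -
  have int: "integrable M (\<lambda>x. \<psi> x * cnj (\<phi> x))" by (rule integrable_mult_cnj[OF assms(1,2)])
  have one: "(LINT x|M. (cmod (\<phi> x))\<^sup>2) = 1"
  proof -
    have "l2_inner M \<phi> \<phi> = (LINT x|M. complex_of_real ((cmod (\<phi> x))\<^sup>2))"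
      unfolding l2_inner_def by (intro Bochner_Integration.integral_cong) (simp_all only: complex_norm_square)
    then show ?thesis using assms(3) by (simp del: of_real_power)
  qed
  have "(cmod (\<psi> x - d * \<phi> x))\<^sup>2 =
     (cmod (\<psi> x))\<^sup>2 - 2 * Re (cnj d * (\<psi> x * cnj (\<phi> x))) + (cmod d)\<^sup>2 * (cmod (\<phi> x))\<^sup>2" for x
    by (subst cmod_diff_sq) (simp add: norm_mult power_mult_distrib mult_ac)
  then have "(l2_norm M (\<lambda>x. \<psi> x - d * \<phi> x))\<^sup>2 =
     (LINT x|M. (cmod (\<psi> x))\<^sup>2 - 2 * Re (cnj d * (\<psi> x * cnj (\<phi> x))) + (cmod d)\<^sup>2 * (cmod (\<phi> x))\<^sup>2)"
    by (simp add: l2_norm_sq)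
  also have "\<dots> = (LINT x|M. (cmod (\<psi> x))\<^sup>2) - 2 * (LINT x|M. Re (cnj d * (\<psi> x * cnj (\<phi> x)))) +
      (cmod d)\<^sup>2 * (LINT x|M. (cmod (\<phi> x))\<^sup>2)"
  proof -
    have "integrable M (\<lambda>x. Re (cnj d * (\<psi> x * cnj (\<phi> x))))"
      using int by (intro integrable_Re integrable_mult_right) auto
    then show ?thesis using assms(1,2) by (simp add: sq_integrable_def del: times_complex.sel)
  qed
  also have "(LINT x|M. Re (cnj d * (\<psi> x * cnj (\<phi> x)))) = Re (LINT x|M. cnj d * (\<psi> x * cnj (\<phi> x)))"
    using int by (intro integral_Re integrable_mult_right) auto
  also have "(LINT x|M. cnj d * (\<psi> x * cnj (\<phi> x))) = cnj d * l2_inner M \<psi> \<phi>"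
    unfolding l2_inner_def by simp
  finally show ?thesis
    by (simp add: one l2_norm_sq cmod_diff_sq)
qed

definition orthonormal_seq :: "'x measure \<Rightarrow> (nat \<Rightarrow> 'x \<Rightarrow> complex) \<Rightarrow> bool" where
  "orthonormal_seq M e \<longleftrightarrow> (\<forall>i. sq_integrable M (e i)) \<and>
     (\<forall>i j. l2_inner M (e i) (e j) = (if i = j then 1 else 0))"

text \<open>The coefficients \<open>d\<close> are arbitrary on purpose: Fourier coefficients give
  Parseval's identity, and the comparison with other choices shows that they approximate best. The
  induction works because subtracting the first \<open>n\<close> components does not change the
  later coefficients.\<close>

lemma orthonormal_seq_combination:
  assumes e: "orthonormal_seq M e" and \<psi>: "sq_integrable M \<psi>"
  shows "(l2_norm M (\<lambda>x. \<psi> x - (\<Sum>i<n. d i * e i x)))\<^sup>2 = (l2_norm M \<psi>)\<^sup>2 +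
      (\<Sum>i<n. (cmod (l2_inner M \<psi> (e i) - d i))\<^sup>2 - (cmod (l2_inner M \<psi> (e i)))\<^sup>2)"
proof -
  have sq: "sq_integrable M (e i)" for i using e by (simp add: orthonormal_seq_def)
  have part: "sq_integrable M (\<lambda>x. \<psi> x - (\<Sum>i<n. d i * e i x))" for n
    by (intro sq_integrable_diff \<psi> sq_integrable_sum sq_integrable_scale sq)
  have inner: "l2_inner M (\<lambda>x. \<psi> x - (\<Sum>i<n. d i * e i x)) (e k) = l2_inner M \<psi> (e k)" if "n \<le> k" for n k
    using that
  proof (induction n)
    case (Suc n)
    have "l2_inner M (\<lambda>x. \<psi> x - (\<Sum>i<Suc n. d i * e i x)) (e k) =
      l2_inner M (\<lambda>x. (\<psi> x - (\<Sum>i<n. d i * e i x)) - d n * e n x) (e k)"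
      by (simp add: algebra_simps)
    then show ?case using Suc e by (simp add: l2_inner_diff_scaled part sq orthonormal_seq_def)
  qed simp
  show "(l2_norm M (\<lambda>x. \<psi> x - (\<Sum>i<n. d i * e i x)))\<^sup>2 = (l2_norm M \<psi>)\<^sup>2 +
      (\<Sum>i<n. (cmod (l2_inner M \<psi> (e i) - d i))\<^sup>2 - (cmod (l2_inner M \<psi> (e i)))\<^sup>2)"
  proof (induction n)
    case (Suc n)
    have "(l2_norm M (\<lambda>x. \<psi> x - (\<Sum>i<Suc n. d i * e i x)))\<^sup>2 =
      (l2_norm M (\<lambda>x. (\<psi> x - (\<Sum>i<n. d i * e i x)) - d n * e n x))\<^sup>2"
      by (simp add: algebra_simps)
    also have "l2_inner M (e n) (e n) = 1" using e by (simp add: orthonormal_seq_def)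
    then have "(l2_norm M (\<lambda>x. (\<psi> x - (\<Sum>i<n. d i * e i x)) - d n * e n x))\<^sup>2 =
      (l2_norm M (\<lambda>x. \<psi> x - (\<Sum>i<n. d i * e i x)))\<^sup>2 +
      ((cmod (l2_inner M \<psi> (e n) - d n))\<^sup>2 - (cmod (l2_inner M \<psi> (e n)))\<^sup>2)"
      by (subst l2_norm_diff_scaled[OF part sq]) (auto simp: inner)
    finally show ?case using Suc by simp
  qed simp
qed

lemma parseval:
  assumes "orthonormal_basis M e" "sq_integrable M \<psi>"
  shows "(\<lambda>i. (cmod (l2_inner M \<psi> (e i)))\<^sup>2) sums (l2_norm M \<psi>)\<^sup>2"
proof -
  let ?r = "\<lambda>n. l2_norm M (\<lambda>x. \<psi> x - (\<Sum>i<n. l2_inner M \<psi> (e i) * e i x))"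
  have e: "orthonormal_seq M e" using assms by (simp add: orthonormal_basis_def orthonormal_seq_def)
  have "(?r n)\<^sup>2 = (l2_norm M \<psi>)\<^sup>2 - (\<Sum>i<n. (cmod (l2_inner M \<psi> (e i)))\<^sup>2)" for n
    using orthonormal_seq_combination[OF e assms(2), of "\<lambda>i. l2_inner M \<psi> (e i)" n]
    by (simp add: sum_negf)
  then have eq: "(\<Sum>i<n. (cmod (l2_inner M \<psi> (e i)))\<^sup>2) = (l2_norm M \<psi>)\<^sup>2 - (?r n)\<^sup>2" for n by simp
  have "?r \<longlonglongrightarrow> 0" using assms by (simp add: orthonormal_basis_def)
  then have "(\<lambda>n. (l2_norm M \<psi>)\<^sup>2 - (?r n)\<^sup>2) \<longlonglongrightarrow> (l2_norm M \<psi>)\<^sup>2 - 0\<^sup>2"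
    by (intro tendsto_intros)
  then show ?thesis unfolding sums_def eq by simp
qed

text \<open>Fourier coefficients approximate best and the error decreases with the number of terms,
  so one good combination with any coefficients controls all later partial sums.\<close>

lemma orthonormal_basisI_dense:
  assumes e: "orthonormal_seq M e"
    and dense: "\<And>\<psi> \<epsilon>. sq_integrable M \<psi> \<Longrightarrow> \<epsilon> > 0 \<Longrightarrow>
      \<exists>n d. (l2_norm M (\<lambda>x. \<psi> x - (\<Sum>i<n. d i * e i x)))\<^sup>2 < \<epsilon>"
  shows "orthonormal_basis M e"
  unfolding orthonormal_basis_def
proof (intro conjI allI impI)
  fix \<psi> assume \<psi>: "sq_integrable M \<psi>"
  let ?c = "\<lambda>i. l2_inner M \<psi> (e i)"
  let ?r = "\<lambda>n. l2_norm M (\<lambda>x. \<psi> x - (\<Sum>i<n. ?c i * e i x))"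
  show "?r \<longlonglongrightarrow> 0"
  proof (rule LIMSEQ_I)
    fix r :: real assume "r > 0"
    then obtain n d where n: "(l2_norm M (\<lambda>x. \<psi> x - (\<Sum>i<n. d i * e i x)))\<^sup>2 < r\<^sup>2"
      using dense[OF \<psi>, of "r\<^sup>2"] by auto
    have "norm (?r m - 0) < r" if "n \<le> m" for m
    proof -
      have "(\<Sum>i<m. - (cmod (?c i))\<^sup>2) \<le> (\<Sum>i<n. - (cmod (?c i))\<^sup>2)"
        unfolding sum_negf using that by (intro le_imp_neg_le sum_mono2) auto
      also have "\<dots> \<le> (\<Sum>i<n. (cmod (?c i - d i))\<^sup>2 - (cmod (?c i))\<^sup>2)"
        by (intro sum_mono) simp
      finally have "(?r m)\<^sup>2 \<le> (l2_norm M (\<lambda>x. \<psi> x - (\<Sum>i<n. d i * e i x)))\<^sup>2"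
        unfolding orthonormal_seq_combination[OF e \<psi>] by simp
      then have "(?r m)\<^sup>2 < r\<^sup>2" using n by (rule le_less_trans)
      then have "?r m < r" by (rule power2_less_imp_less) (use \<open>r > 0\<close> in simp)
      then show ?thesis by simp
    qed
    then show "\<exists>no. \<forall>m\<ge>no. norm (?r m - 0) < r" by blast
  qed
qed (use e in \<open>auto simp: orthonormal_seq_def\<close>)

text \<open>Constancy of the row integrals is left to the individual results: the operator norm
  concerns the integral of \<open>k\<close>, the Hilbert-Schmidt norm that of its square.\<close>

locale homogeneous_kernel = finite_measure M for M :: "'x measure" +
  fixes k :: "'x \<Rightarrow> 'x \<Rightarrow> real" and K :: real
  assumes emeasure_space: "emeasure M (space M) = 1"
    and kernel_measurable: "(\<lambda>(x, y). k x y) \<in> borel_measurable (M \<Otimes>\<^sub>M M)"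
    and kernel_pos: "0 < k x y" and kernel_le: "k x y \<le> K"
    and kernel_commute: "x \<in> space M \<Longrightarrow> y \<in> space M \<Longrightarrow> k x y = k y x"
begin

definition kernel_op :: "('x \<Rightarrow> complex) \<Rightarrow> 'x \<Rightarrow> complex" where
  "kernel_op \<psi> x = (LINT y|M. complex_of_real (k x y) * \<psi> y)"

lemma kernel_section: "x \<in> space M \<Longrightarrow> k x \<in> borel_measurable M"
  using measurable_compose[OF measurable_Pair1' kernel_measurable] by simp

lemma kernel_op_measurable:
  assumes [measurable]: "\<psi> \<in> borel_measurable M"
  shows "kernel_op \<psi> \<in> borel_measurable M"
proof -
  have [measurable]: "(\<lambda>z. k (fst z) (snd z)) \<in> borel_measurable (M \<Otimes>\<^sub>M M)"
    using kernel_measurable by (simp add: split_beta)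
  have "(\<lambda>(x, y). complex_of_real (k x y) * \<psi> y) \<in> borel_measurable (M \<Otimes>\<^sub>M M)"
    unfolding split_beta by measurable
  from borel_measurable_lebesgue_integral[OF this] show ?thesis
    by (simp add: kernel_op_def[abs_def])
qed

lemma integrable_bounded_mult:
  fixes h :: "'x \<Rightarrow> real"
  assumes "x \<in> space M" "integrable M h"
  shows "integrable M (\<lambda>y. k x y * h y)"
proof (rule Bochner_Integration.integrable_bound)
  show "integrable M (\<lambda>y. K * h y)" using assms by simp
  show "(\<lambda>y. k x y * h y) \<in> borel_measurable M" using kernel_section[OF assms(1)] assms(2) by measurable
  show "AE y in M. norm (k x y * h y) \<le> norm (K * h y)"
    using kernel_pos kernel_le
    by (intro AE_I2) (auto simp: abs_mult abs_of_pos intro!: mult_right_mono order_trans[OF kernel_le])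
qed

lemma sq_integrable_imp_integrable:
  assumes "sq_integrable M \<psi>" shows "integrable M (\<lambda>y. cmod (\<psi> y))"
proof (rule Bochner_Integration.integrable_bound)
  show "integrable M (\<lambda>x. 1 + (cmod (\<psi> x))\<^sup>2)" using assms by (simp add: sq_integrable_def)
  show "AE x in M. norm (cmod (\<psi> x)) \<le> norm (1 + (cmod (\<psi> x))\<^sup>2)"
  proof (rule AE_I2)
    fix x
    have "0 \<le> (cmod (\<psi> x) - 1/2)\<^sup>2" by simp
    then show "norm (cmod (\<psi> x)) \<le> norm (1 + (cmod (\<psi> x))\<^sup>2)"
      by (simp add: power2_eq_square algebra_simps)
  qed
qed (use assms in \<open>auto simp: sq_integrable_def\<close>)

lemma integrable_const_one: "integrable M (\<lambda>_. 1 :: real)" by simp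

context
  fixes c :: real
  assumes row: "x \<in> space M \<Longrightarrow> (LINT y|M. k x y) = c"
begin

text \<open>Cauchy-Schwarz for the measure with density \<open>k x\<close>: the integral of the square of the deviation of
  \<open>\<bar>\<psi>\<bar>\<close> from its mean \<open>m\<close> is nonnegative.\<close>

lemma kernel_op_pointwise:
  assumes "x \<in> space M" "sq_integrable M \<psi>" "c > 0"
  shows "(cmod (kernel_op \<psi> x))\<^sup>2 \<le> c * (LINT y|M. k x y * (cmod (\<psi> y))\<^sup>2)"
proof -
  let ?s = "LINT y|M. k x y * cmod (\<psi> y)"
  let ?t = "LINT y|M. k x y * (cmod (\<psi> y))\<^sup>2"
  have int: "integrable M (\<lambda>y. k x y * cmod (\<psi> y))" "integrable M (\<lambda>y. k x y * (cmod (\<psi> y))\<^sup>2)"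
    "integrable M (k x)"
    using integrable_bounded_mult[OF assms(1) sq_integrable_imp_integrable[OF assms(2)]]
      integrable_bounded_mult[OF assms(1) sq_integrable_integrable[OF assms(2)]]
      integrable_bounded_mult[OF assms(1) integrable_const_one] by auto
  have "cmod (kernel_op \<psi> x) \<le> (LINT y|M. cmod (complex_of_real (k x y) * \<psi> y))"
    unfolding kernel_op_def by (rule integral_norm_bound)
  also have "\<dots> = ?s" using kernel_pos by (simp add: norm_mult abs_of_pos)
  finally have s: "(cmod (kernel_op \<psi> x))\<^sup>2 \<le> ?s\<^sup>2" by (intro power_mono) auto
  define m where "m = ?s / c"
  have "0 \<le> (LINT y|M. k x y * (cmod (\<psi> y) - m)\<^sup>2)"
    using kernel_pos by (intro Bochner_Integration.integral_nonneg) (simp add: less_imp_le)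
  also have "\<dots> = (LINT y|M. k x y * (cmod (\<psi> y))\<^sup>2 - 2 * m * (k x y * cmod (\<psi> y)) + m\<^sup>2 * k x y)"
    by (simp add: power2_eq_square algebra_simps)
  also have "\<dots> = ?t - 2 * m * ?s + m\<^sup>2 * c"
    using int row[OF assms(1)] by simp
  finally have "0 \<le> c * (?t - 2 * m * ?s + m\<^sup>2 * c)" using \<open>c > 0\<close> by simp
  also have "\<dots> = c * ?t - ?s\<^sup>2"
    using \<open>c > 0\<close> by (simp add: m_def power2_eq_square field_simps)
  finally show ?thesis using s by simp
qed

text \<open>Schur's test: the pointwise bound is integrated and the integrals are exchanged; by
  symmetry the column integrals equal \<open>c\<close> as well. Extended nonnegative integrals are
  used because integrability of the image is not yet known.\<close>

lemma kernel_op_bound: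
  assumes "sq_integrable M \<psi>" "c > 0"
  shows "(l2_norm M (kernel_op \<psi>))\<^sup>2 \<le> c\<^sup>2 * (l2_norm M \<psi>)\<^sup>2"
proof -
  interpret pair_sigma_finite M M ..
  note [measurable] = sq_integrable_measurable[OF assms(1)]
  have kk [measurable]: "(\<lambda>z. k (fst z) (snd z)) \<in> borel_measurable (M \<Otimes>\<^sub>M M)"
    using kernel_measurable by (simp add: split_beta)
  have rown: "(\<integral>\<^sup>+y. ennreal (k x y) \<partial>M) = ennreal c" if "x \<in> space M" for x
    using row[OF that] integrable_bounded_mult[OF that integrable_const_one] kernel_pos
    by (subst nn_integral_eq_integral) (auto simp: less_imp_le)
  have "(\<integral>\<^sup>+x. ennreal ((cmod (kernel_op \<psi> x))\<^sup>2) \<partial>M) \<le>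
      (\<integral>\<^sup>+x. ennreal c * (\<integral>\<^sup>+y. ennreal (k x y * (cmod (\<psi> y))\<^sup>2) \<partial>M) \<partial>M)"
  proof (intro nn_integral_mono)
    fix x assume x: "x \<in> space M"
    have "ennreal ((cmod (kernel_op \<psi> x))\<^sup>2) \<le> ennreal (c * (LINT y|M. k x y * (cmod (\<psi> y))\<^sup>2))"
      by (intro ennreal_leI kernel_op_pointwise x assms)
    also have "\<dots> = ennreal c * (\<integral>\<^sup>+y. ennreal (k x y * (cmod (\<psi> y))\<^sup>2) \<partial>M)"
      using integrable_bounded_mult[OF x sq_integrable_integrable[OF assms(1)]] kernel_pos \<open>c > 0\<close>
      by (subst nn_integral_eq_integral) (auto simp: less_imp_le ennreal_mult Bochner_Integration.integral_nonneg)
    finally show "ennreal ((cmod (kernel_op \<psi> x))\<^sup>2) \<le> ennreal c * (\<integral>\<^sup>+y. ennreal (k x y * (cmod (\<psi> y))\<^sup>2) \<partial>M)" .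
  qed
  also have "\<dots> = ennreal c * (\<integral>\<^sup>+x. \<integral>\<^sup>+y. ennreal (k x y * (cmod (\<psi> y))\<^sup>2) \<partial>M \<partial>M)"
    by (intro nn_integral_cmult) measurable
  also have "(\<integral>\<^sup>+x. \<integral>\<^sup>+y. ennreal (k x y * (cmod (\<psi> y))\<^sup>2) \<partial>M \<partial>M) =
      (\<integral>\<^sup>+y. \<integral>\<^sup>+x. ennreal (k x y * (cmod (\<psi> y))\<^sup>2) \<partial>M \<partial>M)"
    by (intro Fubini'[symmetric]) (simp add: split_beta)
  also have "\<dots> = (\<integral>\<^sup>+y. ennreal ((cmod (\<psi> y))\<^sup>2) * ennreal c \<partial>M)"
  proof (intro nn_integral_cong)
    fix y assume y: "y \<in> space M"
    have "(\<integral>\<^sup>+x. ennreal (k x y * (cmod (\<psi> y))\<^sup>2) \<partial>M) = (\<integral>\<^sup>+x. ennreal ((cmod (\<psi> y))\<^sup>2) * ennreal (k y x) \<partial>M)"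
      using kernel_commute[OF y] kernel_pos
      by (intro nn_integral_cong) (simp add: ennreal_mult[symmetric] less_imp_le mult.commute)
    also have "\<dots> = ennreal ((cmod (\<psi> y))\<^sup>2) * ennreal c"
      using kernel_section[OF y] rown[OF y] by (subst nn_integral_cmult) auto
    finally show "(\<integral>\<^sup>+x. ennreal (k x y * (cmod (\<psi> y))\<^sup>2) \<partial>M) = ennreal ((cmod (\<psi> y))\<^sup>2) * ennreal c" .
  qed
  also have "\<dots> = ennreal ((l2_norm M \<psi>)\<^sup>2) * ennreal c"
    using sq_integrable_integrable[OF assms(1)]
    by (simp add: nn_integral_multc nn_integral_eq_integral l2_norm_sq)
  also have "ennreal c * (ennreal ((l2_norm M \<psi>)\<^sup>2) * ennreal c) = ennreal (c\<^sup>2 * (l2_norm M \<psi>)\<^sup>2)"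
    using \<open>c > 0\<close> by (simp add: power2_eq_square ac_simps flip: ennreal_mult)
  finally show ?thesis
    unfolding l2_norm_sq[of M "kernel_op \<psi>"] by (intro integral_real_bounded) auto
qed

lemma operator_norm_kernel_op:
  assumes "c > 0" shows "l2_operator_norm M kernel_op = c"
  unfolding l2_operator_norm_def
proof (rule cSup_eq_maximum)
  have one: "(LINT x|M. (1::real)) = 1" using emeasure_space by (simp add: measure_def)
  have "(l2_norm M (kernel_op (\<lambda>_. 1)))\<^sup>2 = (LINT x|M. c\<^sup>2)"
    unfolding l2_norm_sq
  proof (intro Bochner_Integration.integral_cong refl)
    fix x assume "x \<in> space M"
    then show "(cmod (kernel_op (\<lambda>_. 1) x))\<^sup>2 = c\<^sup>2" using row[of x] by (simp add: kernel_op_def)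
  qed
  also have "\<dots> = c\<^sup>2" using one by simp
  finally have "l2_norm M (kernel_op (\<lambda>_. 1)) = c" using assms by (simp add: power2_eq_iff_nonneg)
  moreover have "sq_integrable M (\<lambda>_. 1)" by (simp add: sq_integrable_def)
  moreover have "l2_norm M (\<lambda>_. 1) \<le> 1" using one by (simp add: l2_norm_def)
  ultimately show "c \<in> {l2_norm M (kernel_op \<psi>) |\<psi>. sq_integrable M \<psi> \<and> l2_norm M \<psi> \<le> 1}"
    by (auto intro!: exI[of _ "\<lambda>_. 1"])
next
  fix r assume "r \<in> {l2_norm M (kernel_op \<psi>) |\<psi>. sq_integrable M \<psi> \<and> l2_norm M \<psi> \<le> 1}"
  then obtain \<psi> where \<psi>: "r = l2_norm M (kernel_op \<psi>)" "sq_integrable M \<psi>" "l2_norm M \<psi> \<le> 1" by auto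
  have "(l2_norm M \<psi>)\<^sup>2 \<le> 1" using \<psi>(3) by (intro power_le_one) auto
  then have "c\<^sup>2 * (l2_norm M \<psi>)\<^sup>2 \<le> c\<^sup>2 * 1" by (intro mult_left_mono) auto
  then have "r\<^sup>2 \<le> c\<^sup>2" using kernel_op_bound[OF \<psi>(2) assms] \<psi>(1) by simp
  then show "r \<le> c" by (rule power2_le_imp_le) (rule less_imp_le[OF assms])
qed

end

text \<open>The coefficients of \<open>k x\<close> are the conjugates of
  \<open>kernel_op (e i) x\<close>, so Parseval gives the sum at every \<open>x\<close>, and
  monotone convergence integrates it. The basis \<open>e0\<close> makes the definite description
  meaningful: with no basis at all, every number would satisfy its condition.\<close>

lemma hilbert_schmidt_kernel_op:
  assumes row2: "\<And>x. x \<in> space M \<Longrightarrow> (LINT y|M. (k x y)\<^sup>2) = c"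
    and basis: "orthonormal_basis M e0"
  shows "hilbert_schmidt_norm M kernel_op = sqrt c"
proof -
  obtain x0 where x0: "x0 \<in> space M" using emeasure_space by (metis all_not_in_conv emeasure_empty zero_neq_one)
  have "0 \<le> c" using row2[OF x0] Bochner_Integration.integral_nonneg[of M "\<lambda>y. (k x0 y)\<^sup>2"] by simp
  have sums: "(\<lambda>i. (l2_norm M (kernel_op (e i)))\<^sup>2) sums c" if e: "orthonormal_basis M e" for e
  proof -
    have sq: "sq_integrable M (e i)" for i using e by (simp add: orthonormal_basis_def)
    have K0: "0 \<le> K" using kernel_pos kernel_le by (metis less_le_trans less_imp_le)
    have pt: "(\<lambda>i. (cmod (kernel_op (e i) x))\<^sup>2) sums c" if x: "x \<in> space M" for x
    proof -
      have kx: "sq_integrable M (\<lambda>y. complex_of_real (k x y))"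
        using kernel_section[OF x] kernel_pos kernel_le
        by (intro sq_integrableI_bound[where h="\<lambda>_. K\<^sup>2"]) (auto intro!: power_mono simp: less_imp_le)
      have "l2_inner M (\<lambda>y. complex_of_real (k x y)) (e i) = cnj (kernel_op (e i) x)" for i
        unfolding l2_inner_def kernel_op_def by (simp flip: Bochner_Integration.integral_cnj)
      then show ?thesis
        using parseval[OF e kx] row2[OF x] by (simp add: l2_norm_sq)
    qed
    have meas: "(\<lambda>x. ennreal ((cmod (kernel_op (e i) x))\<^sup>2)) \<in> borel_measurable M" for i
      using kernel_op_measurable[OF sq_integrable_measurable[OF sq[of i]]] by measurable
    have "(\<Sum>i. \<integral>\<^sup>+x. ennreal ((cmod (kernel_op (e i) x))\<^sup>2) \<partial>M) =
       (\<integral>\<^sup>+x. (\<Sum>i. ennreal ((cmod (kernel_op (e i) x))\<^sup>2)) \<partial>M)"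
      by (rule nn_integral_suminf[symmetric]) (rule meas)
    also have "\<dots> = (\<integral>\<^sup>+x. ennreal c \<partial>M)"
      using pt \<open>0 \<le> c\<close> by (intro nn_integral_cong sums_unique[symmetric]) (simp add: sums_ennreal)
    also have "\<dots> = ennreal c" using emeasure_space by simp
    finally have sum: "(\<Sum>i. \<integral>\<^sup>+x. ennreal ((cmod (kernel_op (e i) x))\<^sup>2) \<partial>M) = ennreal c" .
    \<comment> \<open>Each term is bounded by the finite sum. Hence the integral inside
      \<open>l2_norm\<close> exists and is not the default 0 of a function that is not
      integrable.\<close>
    have fin: "(\<integral>\<^sup>+x. ennreal ((cmod (kernel_op (e i) x))\<^sup>2) \<partial>M) = ennreal ((l2_norm M (kernel_op (e i)))\<^sup>2)" for i
    proof -
      have "(\<integral>\<^sup>+x. ennreal ((cmod (kernel_op (e i) x))\<^sup>2) \<partial>M) \<le> ennreal c"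
        unfolding sum[symmetric] using sum_le_suminf[of "\<lambda>i. \<integral>\<^sup>+x. ennreal ((cmod (kernel_op (e i) x))\<^sup>2) \<partial>M" "{i}"]
        by simp
      then have "integrable M (\<lambda>x. (cmod (kernel_op (e i) x))\<^sup>2)"
        using kernel_op_measurable[OF sq_integrable_measurable[OF sq[of i]]]
        by (intro integrableI_bounded) (auto simp: le_less_trans[OF _ ennreal_less_top])
      then show ?thesis by (simp add: nn_integral_eq_integral l2_norm_sq)
    qed
    have "(\<lambda>i. ennreal ((l2_norm M (kernel_op (e i)))\<^sup>2)) sums ennreal c"
      using summable_sums[OF summableI, of "\<lambda>i. ennreal ((l2_norm M (kernel_op (e i)))\<^sup>2)"] sum
      unfolding fin by simp
    then show ?thesis using \<open>0 \<le> c\<close> by (simp add: sums_ennreal)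
  qed
  have "(THE s. \<forall>e. orthonormal_basis M e \<longrightarrow> (\<lambda>i. (l2_norm M (kernel_op (e i)))\<^sup>2) sums s) = c"
    using sums basis by (intro the_equality) (blast, metis sums_unique2)
  then show ?thesis by (simp add: hilbert_schmidt_norm_def)
qed

end

section \<open>Orthonormal bases\<close>

definition finite_span :: "(nat \<Rightarrow> 'x \<Rightarrow> complex) \<Rightarrow> ('x \<Rightarrow> complex) set" where
  "finite_span e = {\<phi>. \<exists>n d. \<phi> = (\<lambda>x. \<Sum>i<n. d i * e i x)}"

lemma finite_span_zero: "(\<lambda>_. 0) \<in> finite_span e"
  by (auto simp: finite_span_def intro!: exI[of _ "0::nat"])

lemma finite_span_scale: "\<phi> \<in> finite_span e \<Longrightarrow> (\<lambda>x. c * \<phi> x) \<in> finite_span e"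
  unfolding finite_span_def
  by clarsimp (rule_tac x=n in exI, rule_tac x="\<lambda>i. c * d i" in exI, simp add: sum_distrib_left mult.assoc)

lemma finite_span_add:
  assumes "\<phi> \<in> finite_span e" "\<psi> \<in> finite_span e"
  shows "(\<lambda>x. \<phi> x + \<psi> x) \<in> finite_span e"
proof -
  obtain n d m c where eq: "\<phi> = (\<lambda>x. \<Sum>i<n. d i * e i x)" "\<psi> = (\<lambda>x. \<Sum>i<m. c i * e i x)"
    using assms by (auto simp: finite_span_def)
  have pad: "(\<Sum>i<n. d i * e i x) = (\<Sum>i<max n m. (if i < n then d i else 0) * e i x)" for n m d x
    by (rule sum.mono_neutral_cong_left) auto
  have "(\<lambda>x. \<phi> x + \<psi> x) =
    (\<lambda>x. \<Sum>i<max n m. ((if i < n then d i else 0) + (if i < m then c i else 0)) * e i x)"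
    unfolding eq using pad[of d _ n m] pad[of c _ m n]
    by (simp add: max.commute distrib_right sum.distrib)
  then show ?thesis unfolding finite_span_def by (intro CollectI exI)
qed

lemma finite_span_sum:
  "(\<And>i. i \<in> I \<Longrightarrow> \<phi> i \<in> finite_span e) \<Longrightarrow> (\<lambda>x. \<Sum>i\<in>I. \<phi> i x) \<in> finite_span e"
  by (induction I rule: infinite_finite_induct) (auto simp: finite_span_zero finite_span_add)

lemma finite_span_base: "e i \<in> finite_span e"
proof -
  have "e i = (\<lambda>x. \<Sum>j<Suc i. (if j = i then 1 else 0) * e j x)"
    by (auto simp: sum.delta if_distrib[where f="\<lambda>c. c * _"] cong: if_cong)
  then show ?thesis unfolding finite_span_def by (intro CollectI exI)
qed

lemma sq_integrable_finite_span:
  "orthonormal_seq M e \<Longrightarrow> \<phi> \<in> finite_span e \<Longrightarrow> sq_integrable M \<phi>"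
  by (auto simp: finite_span_def orthonormal_seq_def intro!: sq_integrable_sum sq_integrable_scale)

definition closed_span :: "'x measure \<Rightarrow> (nat \<Rightarrow> 'x \<Rightarrow> complex) \<Rightarrow> ('x \<Rightarrow> complex) set" where
  "closed_span M e = {\<psi>. sq_integrable M \<psi> \<and>
     (\<forall>\<epsilon>>0. \<exists>\<phi>\<in>finite_span e. (l2_norm M (\<lambda>x. \<psi> x - \<phi> x))\<^sup>2 < \<epsilon>)}"

text \<open>Stands in for the triangle inequality, so that approximation can be measured by squared
  norms throughout; the factor 2 is why tolerances are split into quarters below.\<close>

lemma l2_norm_add_sq_le:
  assumes "sq_integrable M \<psi>" "sq_integrable M \<phi>"
  shows "(l2_norm M (\<lambda>x. \<psi> x + \<phi> x))\<^sup>2 \<le> 2 * (l2_norm M \<psi>)\<^sup>2 + 2 * (l2_norm M \<phi>)\<^sup>2"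
proof -
  have "(l2_norm M (\<lambda>x. \<psi> x + \<phi> x))\<^sup>2 \<le> (LINT x|M. 2 * (cmod (\<psi> x))\<^sup>2 + 2 * (cmod (\<phi> x))\<^sup>2)"
    unfolding l2_norm_sq using sq_integrable_integrable[OF sq_integrable_add[OF assms]]
      sq_integrable_integrable[OF assms(1)] sq_integrable_integrable[OF assms(2)]
    by (intro integral_mono cmod_add_sq_le) auto
  also have "\<dots> = 2 * (l2_norm M \<psi>)\<^sup>2 + 2 * (l2_norm M \<phi>)\<^sup>2"
    unfolding l2_norm_sq using sq_integrable_integrable[OF assms(1)] sq_integrable_integrable[OF assms(2)]
    by simp
  finally show ?thesis .
qed

lemma l2_norm_scale: "(l2_norm M (\<lambda>x. c * \<psi> x))\<^sup>2 = (cmod c)\<^sup>2 * (l2_norm M \<psi>)\<^sup>2"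
  by (simp add: l2_norm_sq norm_mult power_mult_distrib)

lemma l2_norm_cong: "(\<And>x. x \<in> space M \<Longrightarrow> \<psi> x = \<phi> x) \<Longrightarrow> l2_norm M \<psi> = l2_norm M \<phi>"
  unfolding l2_norm_def by (intro arg_cong[where f=sqrt] Bochner_Integration.integral_cong) auto

lemma sq_integrable_cong:
  "(\<And>x. x \<in> space M \<Longrightarrow> \<psi> x = \<phi> x) \<Longrightarrow> sq_integrable M \<psi> \<longleftrightarrow> sq_integrable M \<phi>"
  unfolding sq_integrable_def by (intro conj_cong measurable_cong Bochner_Integration.integrable_cong) auto

lemma closed_span_cong:
  assumes "\<And>x. x \<in> space M \<Longrightarrow> \<psi> x = \<phi> x" "\<psi> \<in> closed_span M e"
  shows "\<phi> \<in> closed_span M e"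
proof -
  have "l2_norm M (\<lambda>x. \<phi> x - \<eta>' x) = l2_norm M (\<lambda>x. \<psi> x - \<eta>' x)" for \<eta>'
    using assms(1) by (intro l2_norm_cong) simp
  moreover have "sq_integrable M \<psi> \<longleftrightarrow> sq_integrable M \<phi>"
    using assms(1) by (rule sq_integrable_cong)
  ultimately show ?thesis using assms(2) by (simp add: closed_span_def)
qed

context
  fixes M :: "'x measure" and e
  assumes e: "orthonormal_seq M e"
begin

lemma closed_span_finite_span: "\<phi> \<in> finite_span e \<Longrightarrow> \<phi> \<in> closed_span M e"
  using sq_integrable_finite_span[OF e] by (auto simp: closed_span_def l2_norm_def intro!: bexI[of _ \<phi>])

lemma closed_span_limit:
  assumes "sq_integrable M \<psi>"
    and "\<And>\<epsilon>. \<epsilon> > 0 \<Longrightarrow> \<exists>\<phi>\<in>closed_span M e. (l2_norm M (\<lambda>x. \<psi> x - \<phi> x))\<^sup>2 < \<epsilon>"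
  shows "\<psi> \<in> closed_span M e"
  unfolding closed_span_def
proof (intro CollectI conjI allI impI assms(1))
  fix \<epsilon> :: real assume "\<epsilon> > 0"
  then obtain \<phi> where \<phi>: "\<phi> \<in> closed_span M e" "(l2_norm M (\<lambda>x. \<psi> x - \<phi> x))\<^sup>2 < \<epsilon>/4"
    using assms(2)[of "\<epsilon>/4"] by auto
  then obtain \<eta> where \<eta>: "\<eta> \<in> finite_span e" "(l2_norm M (\<lambda>x. \<phi> x - \<eta> x))\<^sup>2 < \<epsilon>/4" and "sq_integrable M \<phi>"
    using \<open>\<epsilon> > 0\<close> unfolding closed_span_def by (auto elim!: allE[of _ "\<epsilon>/4"])
  then have "(l2_norm M (\<lambda>x. (\<psi> x - \<phi> x) + (\<phi> x - \<eta> x)))\<^sup>2 \<le>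
      2 * (l2_norm M (\<lambda>x. \<psi> x - \<phi> x))\<^sup>2 + 2 * (l2_norm M (\<lambda>x. \<phi> x - \<eta> x))\<^sup>2"
    using sq_integrable_finite_span[OF e \<eta>(1)] by (intro l2_norm_add_sq_le sq_integrable_diff assms(1))
  also have "\<dots> < \<epsilon>" using \<phi>(2) \<eta>(2) by simp
  finally show "\<exists>\<phi>\<in>finite_span e. (l2_norm M (\<lambda>x. \<psi> x - \<phi> x))\<^sup>2 < \<epsilon>" using \<eta>(1) by auto
qed

lemma closed_span_add:
  assumes "\<psi> \<in> closed_span M e" "\<phi> \<in> closed_span M e"
  shows "(\<lambda>x. \<psi> x + \<phi> x) \<in> closed_span M e"
  unfolding closed_span_def
proof (intro CollectI conjI allI impI)
  have sq: "sq_integrable M \<psi>" "sq_integrable M \<phi>" using assms by (auto simp: closed_span_def)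
  then show "sq_integrable M (\<lambda>x. \<psi> x + \<phi> x)" by (rule sq_integrable_add)
  fix \<epsilon> :: real assume "\<epsilon> > 0"
  then obtain \<psi>' \<phi>' where *: "\<psi>' \<in> finite_span e" "(l2_norm M (\<lambda>x. \<psi> x - \<psi>' x))\<^sup>2 < \<epsilon>/4"
    "\<phi>' \<in> finite_span e" "(l2_norm M (\<lambda>x. \<phi> x - \<phi>' x))\<^sup>2 < \<epsilon>/4"
    using assms unfolding closed_span_def by (auto elim!: allE[of _ "\<epsilon>/4"])
  then have "(l2_norm M (\<lambda>x. (\<psi> x - \<psi>' x) + (\<phi> x - \<phi>' x)))\<^sup>2 \<le>
      2 * (l2_norm M (\<lambda>x. \<psi> x - \<psi>' x))\<^sup>2 + 2 * (l2_norm M (\<lambda>x. \<phi> x - \<phi>' x))\<^sup>2"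
    by (intro l2_norm_add_sq_le sq_integrable_diff sq sq_integrable_finite_span[OF e])
  also have "\<dots> < \<epsilon>" using * by simp
  finally show "\<exists>\<eta>'\<in>finite_span e. (l2_norm M (\<lambda>x. \<psi> x + \<phi> x - \<eta>' x))\<^sup>2 < \<epsilon>"
    using finite_span_add[OF *(1,3)] by (intro bexI[of _ "\<lambda>x. \<psi>' x + \<phi>' x"]) (auto simp: algebra_simps)
qed

lemma closed_span_scale:
  assumes "\<psi> \<in> closed_span M e"
  shows "(\<lambda>x. c * \<psi> x) \<in> closed_span M e"
  unfolding closed_span_def
proof (intro CollectI conjI allI impI)
  show "sq_integrable M (\<lambda>x. c * \<psi> x)"
    using assms by (auto simp: closed_span_def intro: sq_integrable_scale)
  fix \<epsilon> :: real assume \<epsilon>: "\<epsilon> > 0"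
  define k where "k = (cmod c)\<^sup>2 + 1"
  have k: "k > 0" by (simp add: k_def add_nonneg_pos)
  obtain \<phi> where \<phi>: "\<phi> \<in> finite_span e" "(l2_norm M (\<lambda>x. \<psi> x - \<phi> x))\<^sup>2 < \<epsilon>/k"
    using assms \<epsilon> k unfolding closed_span_def by (auto elim!: allE[of _ "\<epsilon>/k"])
  have "(l2_norm M (\<lambda>x. c * \<psi> x - c * \<phi> x))\<^sup>2 = (cmod c)\<^sup>2 * (l2_norm M (\<lambda>x. \<psi> x - \<phi> x))\<^sup>2"
    using l2_norm_scale[of M c "\<lambda>x. \<psi> x - \<phi> x"] by (simp add: algebra_simps)
  also have "\<dots> \<le> k * (l2_norm M (\<lambda>x. \<psi> x - \<phi> x))\<^sup>2" by (intro mult_right_mono) (auto simp: k_def)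
  also have "\<dots> < \<epsilon>" using \<phi>(2) k by (simp add: field_simps)
  finally show "\<exists>\<phi>\<in>finite_span e. (l2_norm M (\<lambda>x. c * \<psi> x - \<phi> x))\<^sup>2 < \<epsilon>"
    by (intro bexI[of _ "\<lambda>x. c * \<phi> x"] finite_span_scale \<phi>(1))
qed

lemma closed_span_sum:
  "(\<And>i. i \<in> I \<Longrightarrow> \<phi> i \<in> closed_span M e) \<Longrightarrow> (\<lambda>x. \<Sum>i\<in>I. \<phi> i x) \<in> closed_span M e"
  by (induction I rule: infinite_finite_induct)
     (auto simp: closed_span_finite_span finite_span_zero closed_span_add)

lemma orthonormal_basisI_closed_span:
  assumes "\<And>\<psi>. sq_integrable M \<psi> \<Longrightarrow> \<psi> \<in> closed_span M e"
  shows "orthonormal_basis M e"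
proof (rule orthonormal_basisI_dense[OF e])
  fix \<psi> and \<epsilon> :: real assume "sq_integrable M \<psi>" "\<epsilon> > 0"
  then show "\<exists>n d. (l2_norm M (\<lambda>x. \<psi> x - (\<Sum>i<n. d i * e i x)))\<^sup>2 < \<epsilon>"
    using assms[of \<psi>] unfolding closed_span_def finite_span_def by blast
qed

lemma closed_span_of_basis:
  assumes "orthonormal_basis M e" "sq_integrable M \<psi>" shows "\<psi> \<in> closed_span M e"
  unfolding closed_span_def
proof (intro CollectI conjI allI impI assms(2))
  fix \<epsilon> :: real assume "\<epsilon> > 0"
  let ?\<phi> = "\<lambda>n x. \<Sum>i<n. l2_inner M \<psi> (e i) * e i x"
  have "(\<lambda>n. (l2_norm M (\<lambda>x. \<psi> x - ?\<phi> n x))\<^sup>2) \<longlonglongrightarrow> 0\<^sup>2"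
    using assms by (intro tendsto_power) (simp add: orthonormal_basis_def)
  then have "eventually (\<lambda>n. (l2_norm M (\<lambda>x. \<psi> x - ?\<phi> n x))\<^sup>2 < \<epsilon>) sequentially"
    using \<open>\<epsilon> > 0\<close> by (intro order_tendstoD(2)) auto
  then obtain n where "(l2_norm M (\<lambda>x. \<psi> x - ?\<phi> n x))\<^sup>2 < \<epsilon>"
    by (auto simp: eventually_sequentially)
  moreover have "?\<phi> n \<in> finite_span e"
    unfolding finite_span_def by (intro CollectI exI[of _ n] exI[of _ "\<lambda>i. l2_inner M \<psi> (e i)"] refl)
  ultimately show "\<exists>\<phi>\<in>finite_span e. (l2_norm M (\<lambda>x. \<psi> x - \<phi> x))\<^sup>2 < \<epsilon>" by (rule bexI)
qed

end

lemma (in finite_measure) sq_integrable_indicator: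
  "A \<in> sets M \<Longrightarrow> sq_integrable M (\<lambda>x. indicator A x)"
  by (intro sq_integrableI_bound[where h="\<lambda>_. 1"]) (auto simp: indicator_def)

text \<open>The error of a partial sum is the indicator of the remaining sets. It equals its own
  square, so its squared norm is the tail of a convergent series of measures.\<close>

lemma (in finite_measure) closed_span_indicator_UN:
  assumes e: "orthonormal_seq M e" and A: "range A \<subseteq> sets M" "disjoint_family A"
    and mem: "\<And>i::nat. (\<lambda>x. indicator (A i) x) \<in> closed_span M e"
  shows "(\<lambda>x. indicator (\<Union>i. A i) x) \<in> closed_span M e"
proof (rule closed_span_limit[OF e])
  have Am [measurable]: "A i \<in> sets M" for i using A(1) by auto
  show "sq_integrable M (\<lambda>x. indicator (\<Union>i. A i) x)" by (intro sq_integrable_indicator) auto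
  let ?r = "\<lambda>n. (l2_norm M (\<lambda>x. indicator (\<Union>i. A i) x - (\<Sum>i<n. indicator (A i) x)))\<^sup>2"
  have "?r n = measure M (\<Union>i. A i) - (\<Sum>i<n. measure M (A i))" for n
  proof -
    have pt: "(cmod (indicator (\<Union>i. A i) x - (\<Sum>i<n. indicator (A i) x)))\<^sup>2 =
       indicator (\<Union>i. A i) x - (\<Sum>i<n. indicator (A i) x)" for x
    proof (cases "\<exists>i. x \<in> A i")
      case True
      then obtain j where j: "x \<in> A j" by auto
      then have iff: "x \<in> A i \<longleftrightarrow> i = j" for i
        using A(2) by (auto simp: disjoint_family_on_def)
      have "indicator (A i) x = (if i = j then 1 else 0 :: complex)"
        "indicator (A i) x = (if i = j then 1 else 0 :: real)" for i
        by (simp_all add: indicator_def iff)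
      moreover have "x \<in> (\<Union>i. A i)" using j by blast
      then have "indicator (\<Union>i. A i) x = (1 :: complex)" "indicator (\<Union>i. A i) x = (1 :: real)"
        by (simp_all add: indicator_def)
      ultimately show ?thesis by simp
    qed (auto simp: indicator_def)
    show ?thesis unfolding l2_norm_sq pt
      by (subst Bochner_Integration.integral_diff)
         (auto simp: Bochner_Integration.integral_sum less_top[symmetric])
  qed
  moreover have "(\<lambda>n. measure M (\<Union>i. A i) - (\<Sum>i<n. measure M (A i))) \<longlonglongrightarrow>
      measure M (\<Union>i. A i) - measure M (\<Union>i. A i)"
    using finite_measure_UNION[OF A] by (intro tendsto_intros) (simp add: sums_def)
  ultimately have lim: "?r \<longlonglongrightarrow> 0" by simp
  fix \<epsilon> :: real assume "\<epsilon> > 0"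
  then obtain n where "?r n < \<epsilon>" using order_tendstoD(2)[OF lim] by (auto simp: eventually_sequentially)
  moreover have "(\<lambda>x. \<Sum>i<n. indicator (A i) x) \<in> closed_span M e"
    by (intro closed_span_sum[OF e] mem)
  ultimately show "\<exists>\<phi>\<in>closed_span M e. (l2_norm M (\<lambda>x. indicator (\<Union>i. A i) x - \<phi> x))\<^sup>2 < \<epsilon>" by (rule bexI)
qed

text \<open>Dynkin's theorem carries the approximation from a generator stable under intersection to
  all measurable sets; simple functions and dominated convergence extend it to all square integrable
  functions.\<close>

lemma (in finite_measure) orthonormal_basisI_generator:
  assumes e: "orthonormal_seq M e" and gen: "sets M = sigma_sets (space M) G" "Int_stable G" "G \<subseteq> Pow (space M)"
    and one: "(\<lambda>_. 1) \<in> closed_span M e"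
    and mem: "\<And>A. A \<in> G \<Longrightarrow> (\<lambda>x. indicator A x) \<in> closed_span M e"
  shows "orthonormal_basis M e"
proof (rule orthonormal_basisI_closed_span[OF e])
  have ind: "(\<lambda>x. indicator A x) \<in> closed_span M e" if "A \<in> sets M" for A
    using gen(2,3) that[unfolded gen(1)]
  proof (induction rule: sigma_sets_induct_disjoint)
    case (compl A)
    have "(\<lambda>x. 1 + (-1) * indicator A x) \<in> closed_span M e"
      by (intro closed_span_add[OF e] closed_span_scale[OF e] one compl)
    then show ?case by (rule closed_span_cong[rotated]) (auto simp: indicator_def)
  next
    case (union A)
    then show ?case by (intro closed_span_indicator_UN[OF e]) (auto simp: gen(1))
  qed (use mem in \<open>auto simp: closed_span_finite_span[OF e] finite_span_zero\<close>)
  fix \<psi> assume \<psi>: "sq_integrable M \<psi>"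
  then obtain s where s: "\<And>i. simple_function M (s i)" "\<And>x. x \<in> space M \<Longrightarrow> (\<lambda>i. s i x) \<longlonglongrightarrow> \<psi> x"
    "\<And>i x. x \<in> space M \<Longrightarrow> cmod (s i x) \<le> 2 * cmod (\<psi> x)"
    using borel_measurable_implies_sequence_metric[OF sq_integrable_measurable[OF \<psi>], of 0]
    unfolding dist_0_norm dist_norm diff_0_right by blast
  have mems: "s i \<in> closed_span M e" for i
  proof (rule closed_span_cong)
    show "(\<lambda>x. \<Sum>y\<in>s i ` space M. y * indicator (s i -` {y} \<inter> space M) x) \<in> closed_span M e"
      using s(1)[of i] by (intro closed_span_sum[OF e] closed_span_scale[OF e] ind) (auto dest: simple_functionD)
    fix x assume "x \<in> space M"
    then have rep: "s i x = (\<Sum>y\<in>s i ` space M. indicator (s i -` {y} \<inter> space M) x *\<^sub>R y)"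
      by (rule simple_function_indicator_representation_banach[OF s(1)])
    have "(\<Sum>y\<in>s i ` space M. y * indicator (s i -` {y} \<inter> space M) x) =
        (\<Sum>y\<in>s i ` space M. indicator (s i -` {y} \<inter> space M) x *\<^sub>R y)"
      by (intro sum.cong) (auto simp: indicator_def)
    then show "(\<Sum>y\<in>s i ` space M. y * indicator (s i -` {y} \<inter> space M) x) = s i x"
      using rep by (rule trans[OF _ sym])
  qed
  note [measurable] = sq_integrable_measurable[OF \<psi>] borel_measurable_simple_function[OF s(1)]
  \<comment> \<open>The simple functions satisfy
    \<open>cmod (s i x) \<le> 2 * cmod (\<psi> x)\<close>, so the error is at most three times
    \<open>cmod (\<psi> x)\<close>; hence the dominating factor 9.\<close>
  have "(\<lambda>i. LINT x|M. (cmod (\<psi> x - s i x))\<^sup>2) \<longlonglongrightarrow> (LINT x|M. 0)"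
  proof (rule integral_dominated_convergence[where w="\<lambda>x. 9 * (cmod (\<psi> x))\<^sup>2"])
    show "integrable M (\<lambda>x. 9 * (cmod (\<psi> x))\<^sup>2)" using \<psi> by (simp add: sq_integrable_def)
    show "AE x in M. (\<lambda>i. (cmod (\<psi> x - s i x))\<^sup>2) \<longlonglongrightarrow> 0"
    proof (rule AE_I2)
      fix x assume "x \<in> space M"
      then have "(\<lambda>i. (cmod (\<psi> x - s i x))\<^sup>2) \<longlonglongrightarrow> (cmod (\<psi> x - \<psi> x))\<^sup>2"
        by (intro tendsto_intros s(2))
      then show "(\<lambda>i. (cmod (\<psi> x - s i x))\<^sup>2) \<longlonglongrightarrow> 0" by simp
    qed
    show "AE x in M. norm ((cmod (\<psi> x - s i x))\<^sup>2) \<le> 9 * (cmod (\<psi> x))\<^sup>2" for i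
    proof (rule AE_I2)
      fix x assume "x \<in> space M"
      then have "cmod (\<psi> x - s i x) \<le> 3 * cmod (\<psi> x)"
        using norm_triangle_ineq4[of "\<psi> x" "s i x"] s(3)[of x i] by simp
      then have "(cmod (\<psi> x - s i x))\<^sup>2 \<le> (3 * cmod (\<psi> x))\<^sup>2" by (intro power_mono) auto
      then show "norm ((cmod (\<psi> x - s i x))\<^sup>2) \<le> 9 * (cmod (\<psi> x))\<^sup>2" by (simp add: power_mult_distrib)
    qed
  qed auto
  then have lim: "(\<lambda>i. (l2_norm M (\<lambda>x. \<psi> x - s i x))\<^sup>2) \<longlonglongrightarrow> 0" by (simp add: l2_norm_sq)
  show "\<psi> \<in> closed_span M e"
  proof (rule closed_span_limit[OF e \<psi>])
    fix \<epsilon> :: real assume "\<epsilon> > 0"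
    then obtain i where "(l2_norm M (\<lambda>x. \<psi> x - s i x))\<^sup>2 < \<epsilon>"
      using order_tendstoD(2)[OF lim] by (auto simp: eventually_sequentially)
    then show "\<exists>\<phi>\<in>closed_span M e. (l2_norm M (\<lambda>x. \<psi> x - \<phi> x))\<^sup>2 < \<epsilon>" using mems by blast
  qed
qed

section \<open>Tensor products of orthonormal bases\<close>

context pair_sigma_finite begin

lemma integral_tensor:
  fixes f g :: "_ \<Rightarrow> 'c :: {real_normed_field, banach, second_countable_topology}"
  assumes [simp]: "integrable M1 f" "integrable M2 g"
  shows "integrable (M1 \<Otimes>\<^sub>M M2) (\<lambda>z. f (fst z) * g (snd z))"
    and "(LINT z|(M1 \<Otimes>\<^sub>M M2). f (fst z) * g (snd z)) = (LINT x|M1. f x) * (LINT y|M2. g y)"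
proof -
  note [measurable] = borel_measurable_integrable[OF assms(1)] borel_measurable_integrable[OF assms(2)]
  show int: "integrable (M1 \<Otimes>\<^sub>M M2) (\<lambda>z. f (fst z) * g (snd z))"
    by (rule Fubini_integrable) (auto simp: norm_mult)
  show "(LINT z|(M1 \<Otimes>\<^sub>M M2). f (fst z) * g (snd z)) = (LINT x|M1. f x) * (LINT y|M2. g y)"
    using integral_fst'[OF int] by simp
qed

end

text \<open>Orthonormal bases are sequences here, so the pairs of indices are enumerated by
  \<open>prod_decode\<close>.\<close>

definition tensor_seq :: "(nat \<Rightarrow> 'x \<Rightarrow> complex) \<Rightarrow> (nat \<Rightarrow> 'y \<Rightarrow> complex) \<Rightarrow> nat \<Rightarrow> 'x \<times> 'y \<Rightarrow> complex" where
  "tensor_seq e f k z = e (fst (prod_decode k)) (fst z) * f (snd (prod_decode k)) (snd z)"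

lemma (in pair_sigma_finite) sq_integrable_tensor:
  assumes "sq_integrable M1 \<psi>" "sq_integrable M2 \<phi>"
  shows "sq_integrable (M1 \<Otimes>\<^sub>M M2) (\<lambda>z. \<psi> (fst z) * \<phi> (snd z))"
    and "(l2_norm (M1 \<Otimes>\<^sub>M M2) (\<lambda>z. \<psi> (fst z) * \<phi> (snd z)))\<^sup>2 = (l2_norm M1 \<psi>)\<^sup>2 * (l2_norm M2 \<phi>)\<^sup>2"
  using integral_tensor[OF sq_integrable_integrable[OF assms(1)] sq_integrable_integrable[OF assms(2)]]
    sq_integrable_measurable[OF assms(1)] sq_integrable_measurable[OF assms(2)]
  by (auto simp: sq_integrable_def l2_norm_sq norm_mult power_mult_distrib)

text \<open>Products of functions are approximated one factor at a time. Indicators of measurable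
  rectangles are such products, and the rectangles generate the product sigma-algebra.\<close>

lemma orthonormal_basis_tensor:
  assumes "finite_measure M1" "finite_measure M2" "orthonormal_basis M1 e" "orthonormal_basis M2 f"
  shows "orthonormal_basis (M1 \<Otimes>\<^sub>M M2) (tensor_seq e f)"
proof -
  interpret M1: finite_measure M1 by fact
  interpret M2: finite_measure M2 by fact
  interpret pair_sigma_finite M1 M2 ..
  have e: "orthonormal_seq M1 e" and f: "orthonormal_seq M2 f"
    using assms by (auto simp: orthonormal_basis_def orthonormal_seq_def)
  have fin: "finite_measure (M1 \<Otimes>\<^sub>M M2)"
    by (rule finite_measure_pair_measure) fact+
  then interpret P: finite_measure "M1 \<Otimes>\<^sub>M M2" .
  have sq: "sq_integrable M1 (e i)" "sq_integrable M2 (f i)" for i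
    using e f by (auto simp: orthonormal_seq_def)
  have inner: "l2_inner (M1 \<Otimes>\<^sub>M M2) (tensor_seq e f k) (tensor_seq e f l) =
      l2_inner M1 (e (fst (prod_decode k))) (e (fst (prod_decode l))) *
      l2_inner M2 (f (snd (prod_decode k))) (f (snd (prod_decode l)))" for k l
    using integral_tensor(2)[OF integrable_mult_cnj[OF sq(1) sq(1)] integrable_mult_cnj[OF sq(2) sq(2)]]
    by (simp add: l2_inner_def tensor_seq_def mult_ac)
  have "tensor_seq e f k = (\<lambda>z. e (fst (prod_decode k)) (fst z) * f (snd (prod_decode k)) (snd z))" for k
    by (auto simp: tensor_seq_def)
  then have T: "orthonormal_seq (M1 \<Otimes>\<^sub>M M2) (tensor_seq e f)"
    using e f sq sq_integrable_tensor(1) unfolding orthonormal_seq_def inner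
    by (auto dest: prod_eqI simp: prod_decode_eq)
  have span: "(\<lambda>z. \<phi> (fst z) * \<eta> (snd z)) \<in> finite_span (tensor_seq e f)"
    if "\<phi> \<in> finite_span e" "\<eta> \<in> finite_span f" for \<phi> \<eta>
  proof -
    obtain n d m c where eq: "\<phi> = (\<lambda>x. \<Sum>i<n. d i * e i x)" "\<eta> = (\<lambda>x. \<Sum>i<m. c i * f i x)"
      using \<open>\<phi> \<in> finite_span e\<close> \<open>\<eta> \<in> finite_span f\<close> by (auto simp: finite_span_def)
    have "(\<lambda>z. \<phi> (fst z) * \<eta> (snd z)) =
        (\<lambda>z. \<Sum>i<n. \<Sum>j<m. (d i * c j) * tensor_seq e f (prod_encode (i, j)) z)"
      unfolding eq sum_product by (simp add: tensor_seq_def mult_ac)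
    then show ?thesis by (simp only: finite_span_sum finite_span_scale finite_span_base)
  qed
  have tensor: "(\<lambda>z. \<psi> (fst z) * \<phi> (snd z)) \<in> closed_span (M1 \<Otimes>\<^sub>M M2) (tensor_seq e f)"
    if \<psi>: "sq_integrable M1 \<psi>" and \<phi>: "sq_integrable M2 \<phi>" for \<psi> \<phi>
    unfolding closed_span_def
  proof (intro CollectI conjI allI impI sq_integrable_tensor \<psi> \<phi>)
    fix \<epsilon> :: real assume \<epsilon>: "\<epsilon> > 0"
    \<comment> \<open>The summand 1 keeps the divisor positive if the norm vanishes.
      \<open>\<psi>'\<close> is fixed first, since the tolerance for \<open>\<phi>'\<close> depends
      on its norm through \<open>l\<close>.\<close>
    define k where "k = (l2_norm M2 \<phi>)\<^sup>2 + 1"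
    have k: "k > 0" by (simp add: k_def add_nonneg_pos)
    obtain \<psi>' where \<psi>': "\<psi>' \<in> finite_span e" "(l2_norm M1 (\<lambda>x. \<psi> x - \<psi>' x))\<^sup>2 < \<epsilon> / (4 * k)"
      using closed_span_of_basis[OF e assms(3) \<psi>] \<epsilon> k unfolding closed_span_def
      by (auto elim!: allE[of _ "\<epsilon> / (4 * k)"])
    define l where "l = (l2_norm M1 \<psi>')\<^sup>2 + 1"
    have l: "l > 0" by (simp add: l_def add_nonneg_pos)
    obtain \<phi>' where \<phi>': "\<phi>' \<in> finite_span f" "(l2_norm M2 (\<lambda>x. \<phi> x - \<phi>' x))\<^sup>2 < \<epsilon> / (4 * l)"
      using closed_span_of_basis[OF f assms(4) \<phi>] \<epsilon> l unfolding closed_span_def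
      by (auto elim!: allE[of _ "\<epsilon> / (4 * l)"])
    have sq': "sq_integrable M1 \<psi>'" "sq_integrable M2 \<phi>'"
      using \<psi>' \<phi>' sq_integrable_finite_span e f by blast+
    have "(l2_norm (M1 \<Otimes>\<^sub>M M2) (\<lambda>z. (\<psi> (fst z) - \<psi>' (fst z)) * \<phi> (snd z) + \<psi>' (fst z) * (\<phi> (snd z) - \<phi>' (snd z))))\<^sup>2
      \<le> 2 * ((l2_norm M1 (\<lambda>x. \<psi> x - \<psi>' x))\<^sup>2 * (l2_norm M2 \<phi>)\<^sup>2) +
        2 * ((l2_norm M1 \<psi>')\<^sup>2 * (l2_norm M2 (\<lambda>x. \<phi> x - \<phi>' x))\<^sup>2)"
      using l2_norm_add_sq_le[OF sq_integrable_tensor(1)[OF sq_integrable_diff[OF \<psi> sq'(1)] \<phi>]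
          sq_integrable_tensor(1)[OF sq'(1) sq_integrable_diff[OF \<phi> sq'(2)]]]
        sq_integrable_tensor(2)[OF sq_integrable_diff[OF \<psi> sq'(1)] \<phi>]
        sq_integrable_tensor(2)[OF sq'(1) sq_integrable_diff[OF \<phi> sq'(2)]] by simp
    also have "\<dots> \<le> 2 * ((l2_norm M1 (\<lambda>x. \<psi> x - \<psi>' x))\<^sup>2 * k) + 2 * (l * (l2_norm M2 (\<lambda>x. \<phi> x - \<phi>' x))\<^sup>2)"
      by (intro add_mono mult_left_mono mult_right_mono) (auto simp: k_def l_def)
    also have "\<dots> < 2 * (\<epsilon> / 4) + 2 * (\<epsilon> / 4)"
    proof -
      have "(l2_norm M1 (\<lambda>x. \<psi> x - \<psi>' x))\<^sup>2 * k < \<epsilon> / 4" using \<psi>'(2) k by (simp add: field_simps)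
      moreover have "l * (l2_norm M2 (\<lambda>x. \<phi> x - \<phi>' x))\<^sup>2 < \<epsilon> / 4" using \<phi>'(2) l by (simp add: field_simps)
      ultimately show ?thesis by linarith
    qed
    finally have "(l2_norm (M1 \<Otimes>\<^sub>M M2) (\<lambda>z. \<psi> (fst z) * \<phi> (snd z) - \<psi>' (fst z) * \<phi>' (snd z)))\<^sup>2 < \<epsilon>"
      by (simp add: algebra_simps)
    then show "\<exists>\<eta>\<in>finite_span (tensor_seq e f). (l2_norm (M1 \<Otimes>\<^sub>M M2) (\<lambda>z. \<psi> (fst z) * \<phi> (snd z) - \<eta> z))\<^sup>2 < \<epsilon>"
      by (intro bexI[OF _ span[OF \<psi>'(1) \<phi>'(1)]])
  qed
  show ?thesis
  proof (rule P.orthonormal_basisI_generator[OF T])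
    show "sets (M1 \<Otimes>\<^sub>M M2) = sigma_sets (space (M1 \<Otimes>\<^sub>M M2)) {a \<times> b |a b. a \<in> sets M1 \<and> b \<in> sets M2}"
      by (simp add: sets_pair_measure space_pair_measure)
    show "{a \<times> b |a b. a \<in> sets M1 \<and> b \<in> sets M2} \<subseteq> Pow (space (M1 \<Otimes>\<^sub>M M2))"
      unfolding space_pair_measure by (rule pair_measure_closed)
    show "(\<lambda>_. 1) \<in> closed_span (M1 \<Otimes>\<^sub>M M2) (tensor_seq e f)"
      using tensor[of "\<lambda>_. 1" "\<lambda>_. 1"] by (simp add: sq_integrable_def)
    fix A assume "A \<in> {a \<times> b |a b. a \<in> sets M1 \<and> b \<in> sets M2}"
    then obtain a b where A: "A = a \<times> b" "a \<in> sets M1" "b \<in> sets M2" by auto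
    show "(\<lambda>x. indicator A x) \<in> closed_span (M1 \<Otimes>\<^sub>M M2) (tensor_seq e f)"
      using tensor[OF M1.sq_integrable_indicator[OF A(2)] M2.sq_integrable_indicator[OF A(3)]]
      by (rule closed_span_cong[rotated]) (auto simp: A indicator_def)
  qed (rule Int_stable_pair_measure_generator)
qed

section \<open>Walsh functions: an orthonormal basis on the circle\<close>

definition rademacher :: "real \<Rightarrow> real" where
  "rademacher x = (if frac x < 1/2 then 1 else - 1)"

text \<open>Walsh functions in Paley's order: the product of the Rademacher functions at
  \<open>2^j * x\<close> over the binary digits 1 of \<open>n\<close> at position \<open>j\<close>.
  Recursion on the last digit matches the doubling map of the circle.\<close>

fun walsh :: "nat \<Rightarrow> real \<Rightarrow> real" where
  "walsh n x = (if n = 0 then 1 else (if odd n then rademacher x else 1) * walsh (n div 2) (2 * x))"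

declare walsh.simps [simp del]

lemma walsh_0 [simp]: "walsh 0 x = 1"
  by (simp add: walsh.simps)

lemma walsh_double: "walsh (2 * n) x = walsh n (2 * x)"
  by (cases "n = 0") (simp_all add: walsh.simps[of "2 * n"])

lemma walsh_Suc_double: "walsh (Suc (2 * n)) x = rademacher x * walsh n (2 * x)"
  by (simp add: walsh.simps[of "Suc (2 * n)"])

lemma walsh_split: "walsh n x = (if frac x < 1/2 then 1 else if odd n then - 1 else 1) * walsh (n div 2) (2 * x)"
  by (cases "n = 0") (simp_all add: walsh.simps[of n] rademacher_def)

lemma frac_add_1 [simp]: "frac (x + 1 :: real) = frac x"
  by (simp add: frac_def)

lemma walsh_periodic: "walsh n (x + 1) = walsh n x"
proof (induction n arbitrary: x rule: less_induct)
  case (less n)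
  show ?case
  proof (cases "n = 0")
    case False
    then have "walsh (n div 2) (2 * x + 1 + 1) = walsh (n div 2) (2 * x)"
      using less[of "n div 2" "2 * x + 1"] less[of "n div 2" "2 * x"] by simp
    then show ?thesis unfolding walsh_split[of n] by (simp add: distrib_left add.assoc)
  qed simp
qed

lemma walsh_measurable [measurable]: "walsh n \<in> borel_measurable borel"
proof (induction n rule: less_induct)
  case (less n)
  show ?case
  proof (cases "n = 0")
    case True then show ?thesis by (simp add: walsh_0[abs_def])
  next
    case False
    then have [measurable]: "walsh (n div 2) \<in> borel_measurable borel" by (intro less) simp
    have [measurable]: "(frac :: real \<Rightarrow> real) \<in> borel_measurable borel"
      unfolding frac_def[abs_def] by measurable
    have "walsh n = (\<lambda>x. (if frac x < 1/2 then 1 else if odd n then - 1 else 1) * walsh (n div 2) (2 * x))"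
      by (rule ext) (rule walsh_split)
    also have "\<dots> \<in> borel_measurable borel" by measurable
    finally show ?thesis .
  qed
qed

lemma abs_walsh [simp]: "\<bar>walsh n x\<bar> = 1"
proof (induction n arbitrary: x rule: less_induct)
  case (less n)
  show ?case
    by (cases "n = 0") (simp, subst walsh_split, simp add: abs_mult less)
qed

text \<open>The doubling map sends either half circle onto the whole circle, each with weight 1/2.
  So the first binary digit of \<open>x\<close> is independent of \<open>2 * x\<close> modulo
  1.\<close>

lemma integral_circle_double:
  fixes h :: "real \<Rightarrow> real"
  assumes [measurable]: "h \<in> borel_measurable borel" and per: "\<And>x. h (x + 1) = h x" and bound: "\<And>x. \<bar>h x\<bar> \<le> B"
  shows "(LINT x|circle. (if frac x < 1/2 then \<alpha> else \<beta>) * h (2 * x)) = (\<alpha> + \<beta>) / 2 * (LINT x|circle. h x)"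
proof -
  have LINT: "(LINT x|circle. f x) = (LBINT x. indicator {0..<1} x * f x)" for f :: "real \<Rightarrow> real"
    unfolding circle_def by (subst integral_restrict_space) (auto simp: mult.commute)
  have int: "integrable lborel (\<lambda>x. indicator {u..<v} x * h (c * x + d))" for u v c d :: real
  proof (rule Bochner_Integration.integrable_bound)
    show "integrable lborel (\<lambda>x. B * indicator {u..<v} x)"
      by (cases "u \<le> v") (auto intro!: integrable_mult_right integrable_real_indicator simp: emeasure_lborel_Ico)
    show "AE x in lborel. norm (indicator {u..<v} x * h (c * x + d)) \<le> norm (B * indicator {u..<v} x)"
      using bound order_trans[OF bound abs_ge_self] by (intro AE_I2) (auto simp: indicator_def)
  qed measurable
  have half: "(LBINT x. indicator {u/2..<u/2+1/2} x * h (2 * x)) = (LINT x|circle. h x) / 2"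
    if "\<And>x. h (x + u) = h x" for u
  proof -
    have "(LINT x|circle. h x) = (LBINT x. indicator {0..<1} x * h x)" by (rule LINT)
    also have "\<dots> = \<bar>2\<bar> *\<^sub>R (LBINT x. indicator {0..<1} (-u + 2 * x) * h (-u + 2 * x))"
      by (rule lborel_integral_real_affine) simp
    also have "(\<lambda>x. indicator {0..<1} (-u + 2 * x) * h (-u + 2 * x)) = (\<lambda>x. indicator {u/2..<u/2+1/2} x * h (2 * x))"
      using that[of "-u + 2 * x" for x] by (auto simp: fun_eq_iff indicator_def)
    finally show ?thesis by simp
  qed
  have "(LINT x|circle. (if frac x < 1/2 then \<alpha> else \<beta>) * h (2 * x)) =
    (LBINT x. \<alpha> * (indicator {0..<1/2} x * h (2 * x + 0)) + \<beta> * (indicator {1/2..<1} x * h (2 * x + 0)))"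
    unfolding LINT
    by (intro Bochner_Integration.integral_cong) (auto simp: indicator_def frac_eq[THEN iffD2])
  also have "\<dots> = \<alpha> * (LBINT x. indicator {0..<1/2} x * h (2 * x + 0)) + \<beta> * (LBINT x. indicator {1/2..<1} x * h (2 * x + 0))"
    using int[of _ _ 2 0] by simp
  also have "\<dots> = (\<alpha> + \<beta>) / 2 * (LINT x|circle. h x)"
    using half[of 0] half[of 1] per by (simp add: field_simps)
  finally show ?thesis .
qed

text \<open>Splitting off the last digits of \<open>m\<close> and \<open>n\<close> leaves the factor
  \<open>(1 + 1) / 2\<close> if they agree and \<open>(1 - 1) / 2\<close> if they differ; the
  remaining digits are treated by induction.\<close>

lemma walsh_orthonormal: "(LINT x|circle. walsh m x * walsh n x) = (if m = n then 1 else 0)"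
proof (induction "m + n" arbitrary: m n rule: less_induct)
  case less
  show ?case
  proof (cases "m = 0 \<and> n = 0")
    case True
    then show ?thesis using emeasure_space_circle by (simp add: measure_def del: emeasure_space_circle)
  next
    case False
    let ?h = "\<lambda>x. walsh (m div 2) x * walsh (n div 2) x"
    let ?\<beta> = "if odd m = odd n then 1 else - 1 :: real"
    have "(LINT x|circle. walsh m x * walsh n x) = (LINT x|circle. (if frac x < 1/2 then 1 else ?\<beta>) * ?h (2 * x))"
      by (intro Bochner_Integration.integral_cong refl) (subst (1 2) walsh_split, auto)
    also have "\<dots> = (1 + ?\<beta>) / 2 * (LINT x|circle. ?h x)"
      by (rule integral_circle_double[where B=1]) (auto simp: walsh_periodic abs_mult)
    also have "(LINT x|circle. ?h x) = (if m div 2 = n div 2 then 1 else 0)"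
      using False by (intro less) (auto intro: add_less_le_mono add_le_less_mono)
    also have "(1 + ?\<beta>) / 2 * (if m div 2 = n div 2 then 1 else 0) = (if m = n then 1 else 0)"
      by (auto simp: parity_cases elim!: oddE evenE)
    finally show ?thesis .
  qed
qed

definition walsh_seq :: "nat \<Rightarrow> real \<Rightarrow> complex" where
  "walsh_seq n x = complex_of_real (walsh n x)"

lemma orthonormal_walsh: "orthonormal_seq circle walsh_seq"
proof -
  have "sq_integrable circle (walsh_seq n)" for n
  proof (rule sq_integrableI_bound[where h="\<lambda>_. 1"])
    show "walsh_seq n \<in> borel_measurable circle"
      by (intro borel_measurable_circle) (simp add: walsh_seq_def[abs_def])
  qed (auto simp: walsh_seq_def)
  moreover have "l2_inner circle (walsh_seq m) (walsh_seq n) = (if m = n then 1 else 0)" for m n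
    using walsh_orthonormal[of m n] by (simp add: l2_inner_def walsh_seq_def flip: of_real_mult)
  ultimately show ?thesis by (simp add: orthonormal_seq_def)
qed

lemma finite_span_walsh_double:
  assumes "u \<in> finite_span walsh_seq"
  shows "(\<lambda>x. u (2 * x)) \<in> finite_span walsh_seq"
    and "(\<lambda>x. complex_of_real (rademacher x) * u (2 * x)) \<in> finite_span walsh_seq"
proof -
  obtain n d where u: "u = (\<lambda>x. \<Sum>i<n. d i * walsh_seq i x)" using assms by (auto simp: finite_span_def)
  have "(\<lambda>x. u (2 * x)) = (\<lambda>x. \<Sum>i<n. d i * walsh_seq (2 * i) x)"
    by (simp add: u walsh_seq_def walsh_double)
  then show "(\<lambda>x. u (2 * x)) \<in> finite_span walsh_seq"
    by (simp only: finite_span_sum finite_span_scale finite_span_base)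
  have "(\<lambda>x. complex_of_real (rademacher x) * u (2 * x)) = (\<lambda>x. \<Sum>i<n. d i * walsh_seq (Suc (2 * i)) x)"
    unfolding u walsh_seq_def walsh_Suc_double by (simp add: sum_distrib_left mult_ac)
  then show "(\<lambda>x. complex_of_real (rademacher x) * u (2 * x)) \<in> finite_span walsh_seq"
    by (simp only: finite_span_sum finite_span_scale finite_span_base)
qed

text \<open>Through the doubling map, a step function of level \<open>n + 1\<close> is one of level
  \<open>n\<close> on either half circle. The indicators of the halves are
  \<open>(1 + r) / 2\<close> and \<open>(1 - r) / 2\<close> with the Rademacher function
  \<open>r\<close>.\<close>

lemma dyadic_in_walsh_span: "(\<lambda>x. h \<lfloor>2 ^ n * frac x\<rfloor>) \<in> finite_span walsh_seq"
proof (induction n arbitrary: h)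
  case 0
  have "\<lfloor>frac x\<rfloor> = 0" for x :: real by (simp add: frac_lt_1 floor_eq_iff)
  then have "(\<lambda>x. h \<lfloor>2 ^ 0 * frac x\<rfloor>) = (\<lambda>x. h 0 * walsh_seq 0 x)" by (simp add: walsh_seq_def)
  then show ?case by (simp only: finite_span_scale finite_span_base)
next
  case (Suc n)
  let ?u = "\<lambda>x. h \<lfloor>2 ^ n * frac x\<rfloor>" and ?v = "\<lambda>x. h (2 ^ n + \<lfloor>2 ^ n * frac x\<rfloor>)"
  have eq: "h \<lfloor>2 ^ Suc n * frac x\<rfloor> =
      (1/2) * ?u (2 * x) + ((1/2) * (of_real (rademacher x) * ?u (2 * x)) +
      ((1/2) * ?v (2 * x) + (-1/2) * (of_real (rademacher x) * ?v (2 * x))))" for x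
  proof (cases "frac x < 1/2")
    case True
    have "frac (2 * x) = 2 * frac x"
      using True by (subst frac_unique_iff) (auto simp: frac_def algebra_simps)
    then show ?thesis using True by (simp add: rademacher_def mult.assoc mult.left_commute)
  next
    case False
    have "frac (2 * x) = 2 * frac x - 1"
    proof (subst frac_unique_iff, intro conjI)
      have "2 * x - (2 * frac x - 1) = of_int (2 * \<lfloor>x\<rfloor> + 1)" by (simp add: frac_def)
      then show "2 * x - (2 * frac x - 1) \<in> \<int>" by (metis Ints_of_int)
    qed (use False frac_lt_1[of x] in auto)
    then have "2 * frac x = 1 + frac (2 * x)" by simp
    then have "2 ^ n * (2 * frac x) = 2 ^ n * (1 + frac (2 * x))" by (rule arg_cong)
    then have "2 ^ Suc n * frac x = of_int (2 ^ n) + 2 ^ n * frac (2 * x)"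
      by (simp add: distrib_left mult.assoc[symmetric] mult.commute[of _ 2])
    then have "\<lfloor>2 ^ Suc n * frac x\<rfloor> = 2 ^ n + \<lfloor>2 ^ n * frac (2 * x)\<rfloor>"
      by (simp only: int_add_floor)
    then show ?thesis using False by (simp add: rademacher_def)
  qed
  show ?case unfolding eq
    by (intro finite_span_add finite_span_scale finite_span_walsh_double Suc[of h] Suc[of "\<lambda>k. h (2 ^ n + k)"])
qed

lemma sets_circle_generator: "sets circle = sigma_sets {0..<1} (range (\<lambda>\<alpha>. {0..<1} \<inter> {..<\<alpha>}))"
proof -
  have "sets circle = (\<inter>) {0..<1} ` sigma_sets UNIV (range lessThan)"
    unfolding sets_circle sets_restrict_space by (subst borel_Iio) (simp add: sets_measure_of)
  also have "\<dots> = sigma_sets {0..<1} ((\<inter>) {0..<1} ` range lessThan)"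
  proof (rule sigma_sets_Int)
    have "{0..<1::real} \<in> sets (sigma UNIV (range lessThan))"
      unfolding borel_Iio[symmetric] by simp
    then show "{0..<1::real} \<in> sigma_sets UNIV (range lessThan)" by (simp add: sets_measure_of)
  qed simp
  finally show ?thesis by (simp add: image_image)
qed

text \<open>The step function \<open>\<phi>\<close> rounds \<open>\<alpha>\<close> down to a
  multiple of \<open>(1/2)^n\<close>. On the unit interval it can differ from the indicator only on
  the dyadic interval \<open>J\<close> that contains \<open>\<alpha>\<close>, whose length is
  \<open>(1/2)^n\<close>.\<close>

lemma initial_interval_in_walsh_span:
  "(\<lambda>x. indicator ({0..<1} \<inter> {..<\<alpha>}) x) \<in> closed_span circle walsh_seq"
proof (rule closed_span_limit[OF orthonormal_walsh])
  show "sq_integrable circle (\<lambda>x. indicator ({0..<1} \<inter> {..<\<alpha>}) x)"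
    by (intro finite_measure.sq_integrable_indicator[OF circle.finite_measure_axioms]) (simp add: sets_circle_generator sigma_sets.Basic)
  fix \<epsilon> :: real assume "\<epsilon> > 0"
  then obtain n :: nat where n: "(1/2)^n < \<epsilon>" using real_arch_pow_inv[of \<epsilon> "1/2"] by auto
  define k where "k = \<lfloor>2 ^ n * \<alpha>\<rfloor>"
  define \<phi> where "\<phi> x = (if \<lfloor>2 ^ n * frac x\<rfloor> < k then 1 else 0 :: complex)" for x :: real
  define J where "J = {of_int k / 2 ^ n ..< of_int k / 2 ^ n + (1/2)^n :: real}"
  have diff: "(cmod (indicator ({0..<1} \<inter> {..<\<alpha>}) x - \<phi> x))\<^sup>2 \<le> indicator J x" if x: "x \<in> {0..<1}" for x
  proof -
    have fr: "frac x = x" using x by (simp add: frac_eq)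
    have "x \<in> J" if "\<not> (x < \<alpha> \<longleftrightarrow> \<lfloor>2 ^ n * x\<rfloor> < k)"
    proof -
      have "\<lfloor>2 ^ n * x\<rfloor> \<le> k" if "x < \<alpha>" unfolding k_def using that by (intro floor_mono) simp
      moreover have "k \<le> \<lfloor>2 ^ n * x\<rfloor>" if "\<alpha> \<le> x" unfolding k_def using that by (intro floor_mono) simp
      ultimately have "\<lfloor>2 ^ n * x\<rfloor> = k" using \<open>\<not> (x < \<alpha> \<longleftrightarrow> _)\<close> by fastforce
      then have "of_int k \<le> 2 ^ n * x" "2 ^ n * x < of_int k + 1" by (auto simp: floor_eq_iff)
      then show ?thesis by (simp add: J_def field_simps power_divide)
    qed
    then show ?thesis using x by (auto simp: \<phi>_def fr indicator_def)
  qed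
  have Jm: "J \<in> sets borel" by (simp add: J_def)
  have "\<phi> \<in> finite_span walsh_seq"
    unfolding \<phi>_def[abs_def] by (rule dyadic_in_walsh_span)
  moreover have "(l2_norm circle (\<lambda>x. indicator ({0..<1} \<inter> {..<\<alpha>}) x - \<phi> x))\<^sup>2 \<le> (1/2)^n"
    unfolding l2_norm_sq
  proof (rule integral_real_bounded)
    have "circle_integral (\<lambda>x. ennreal ((cmod (indicator ({0..<1} \<inter> {..<\<alpha>}) x - \<phi> x))\<^sup>2)) \<le> circle_integral (indicator J)"
      using ennreal_leI[OF diff] by (intro nn_integral_mono) (auto simp: ennreal_indicator)
    also have "\<dots> \<le> (\<integral>\<^sup>+x. indicator J x \<partial>lborel)"
      using Jm by (subst nn_integral_circle, simp, intro nn_integral_mono, simp add: indicator_def)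
    also have "\<dots> = ennreal ((1/2)^n)" using Jm by (simp add: J_def)
    finally show "circle_integral (\<lambda>x. ennreal ((cmod (indicator ({0..<1} \<inter> {..<\<alpha>}) x - \<phi> x))\<^sup>2)) \<le> ennreal ((1/2)^n)" .
  qed simp
  ultimately show "\<exists>\<phi>\<in>closed_span circle walsh_seq. (l2_norm circle (\<lambda>x. indicator ({0..<1} \<inter> {..<\<alpha>}) x - \<phi> x))\<^sup>2 < \<epsilon>"
    using n closed_span_finite_span[OF orthonormal_walsh] by (intro bexI[of _ \<phi>]) auto
qed

lemma orthonormal_basis_walsh: "orthonormal_basis circle walsh_seq"
proof (rule finite_measure.orthonormal_basisI_generator[OF circle.finite_measure_axioms orthonormal_walsh])
  show "sets circle = sigma_sets (space circle) (range (\<lambda>\<alpha>. {0..<1} \<inter> {..<\<alpha>}))"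
    using sets_circle_generator by simp
  show "Int_stable (range (\<lambda>\<alpha>::real. {0..<1} \<inter> {..<\<alpha>}))"
  proof (rule Int_stableI_image)
    fix \<alpha> \<beta> :: real
    have "({0..<1} \<inter> {..<\<alpha>}) \<inter> ({0..<1} \<inter> {..<\<beta>}) = {0..<1} \<inter> {..<min \<alpha> \<beta>}" by auto
    then show "\<exists>\<gamma>\<in>UNIV. ({0..<1} \<inter> {..<\<alpha>}) \<inter> ({0..<1} \<inter> {..<\<beta>}) = {0..<1} \<inter> {..<\<gamma>}" by blast
  qed
  have "walsh_seq 0 = (\<lambda>_. 1)" by (auto simp: walsh_seq_def)
  then show "(\<lambda>_. 1) \<in> closed_span circle walsh_seq"
    using closed_span_finite_span[OF orthonormal_walsh finite_span_base[of walsh_seq 0]] by simp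
qed (use initial_interval_in_walsh_span in auto)

lemma orthonormal_basis_circle_square:
  "orthonormal_basis (circle \<Otimes>\<^sub>M circle) (tensor_seq walsh_seq walsh_seq)"
  by (intro orthonormal_basis_tensor orthonormal_basis_walsh) unfold_locales

section \<open>Geometry of the torus\<close>

text \<open>The map \<open>lattice_basis a b\<close> on pairs instead of vectors, so that the
  fundamental cell is the image of a square with product measure.\<close>

definition chart :: "real \<Rightarrow> real \<Rightarrow> real \<times> real \<Rightarrow> real^2" where
  "chart a b z = vector [(fst z + a * snd z) / sqrt b, sqrt b * snd z]"

definition coords :: "real \<Rightarrow> real \<Rightarrow> real^2 \<Rightarrow> real \<times> real" where
  "coords a b x = (sqrt b * x $ 1 - a * x $ 2 / sqrt b, x $ 2 / sqrt b)"

lemma chart_nth [simp]: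
  "chart a b z $ 1 = (fst z + a * snd z) / sqrt b" "chart a b z $ 2 = sqrt b * snd z"
  by (simp_all add: chart_def vector_2)

lemma chart_coords: "b > 0 \<Longrightarrow> chart a b (coords a b x) = x"
  by (simp add: vec_eq_iff forall_2 coords_def)

lemma coords_chart: "b > 0 \<Longrightarrow> coords a b (chart a b z) = z"
  by (simp add: coords_def prod_eq_iff)

lemma chart_diff: "chart a b z - chart a b w = chart a b (z - w)"
  by (simp add: vec_eq_iff forall_2 algebra_simps diff_divide_distrib add_divide_distrib)

lemma chart_add: "chart a b z + chart a b w = chart a b (z + w)"
  by (simp add: vec_eq_iff forall_2 algebra_simps add_divide_distrib)

lemma norm_chart:
  assumes "b > 0" shows "(norm (chart a b z))\<^sup>2 = quad_form b (fst z + a * snd z) (snd z)"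
proof -
  have "(norm (chart a b z))\<^sup>2 = ((fst z + a * snd z) / sqrt b)\<^sup>2 + (sqrt b * snd z)\<^sup>2"
    unfolding power2_norm_eq_inner inner_vec_def sum_2 chart_nth by (simp add: power2_eq_square)
  also have "\<dots> = quad_form b (fst z + a * snd z) (snd z)"
    using assms unfolding quad_form_def power_divide power_mult_distrib real_sqrt_pow2[OF less_imp_le[OF assms]]
    by (simp add: field_simps power2_eq_square)
  finally show ?thesis .
qed

lemma lattice_basis_chart: "lattice_basis a b *v v = chart a b (v $ 1, v $ 2)"
  by (simp add: vec_eq_iff forall_2 matrix_vector_mult_def sum_2 lattice_basis_def vector_2 add_divide_distrib)

lemma ex_vec_2: "(\<exists>v::real^2. P (v $ 1) (v $ 2)) \<longleftrightarrow> (\<exists>s t. P s t)"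
proof
  assume "\<exists>s t. P s t"
  then obtain s t where "P s t" by auto
  then show "\<exists>v::real^2. P (v $ 1) (v $ 2)" by (intro exI[of _ "vector [s, t]"]) (simp add: vector_2)
qed auto

lemma lattice_iff: "x \<in> lattice a b \<longleftrightarrow> (\<exists>m n. x = chart a b (of_int m, of_int n))"
proof -
  have "x \<in> lattice a b \<longleftrightarrow> (\<exists>v::real^2. (v $ 1 \<in> \<int> \<and> v $ 2 \<in> \<int>) \<and> x = chart a b (v $ 1, v $ 2))"
    by (auto simp: lattice_def lattice_basis_chart forall_2)
  also have "\<dots> \<longleftrightarrow> (\<exists>s t. (s \<in> \<int> \<and> t \<in> \<int>) \<and> x = chart a b (s, t))"
    by (rule ex_vec_2)
  finally show ?thesis unfolding Ints_def image_def by blast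
qed

lemma fundamental_cell_chart: "fundamental_cell a b = chart a b ` ({0..<1} \<times> {0..<1})"
proof -
  have "x \<in> fundamental_cell a b \<longleftrightarrow> (\<exists>v::real^2. (0 \<le> v $ 1 \<and> v $ 1 < 1 \<and> 0 \<le> v $ 2 \<and> v $ 2 < 1) \<and> x = chart a b (v $ 1, v $ 2))" for x
    by (auto simp: fundamental_cell_def lattice_basis_chart forall_2)
  also have "\<dots>x \<longleftrightarrow> (\<exists>s t. (0 \<le> s \<and> s < 1 \<and> 0 \<le> t \<and> t < 1) \<and> x = chart a b (s, t))" for x
    by (rule ex_vec_2)
  finally show ?thesis by (intro set_eqI) (force simp: image_iff)
qed

definition torus_point :: "real \<Rightarrow> real \<Rightarrow> real \<times> real \<Rightarrow> (real^2) set" where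
  "torus_point a b z = torus_proj a b (chart a b z)"

definition frac_pair :: "real \<times> real \<Rightarrow> real \<times> real" where
  "frac_pair z = (frac (fst z), frac (snd z))"

lemma torus_proj_iff: "y \<in> torus_proj a b x \<longleftrightarrow> (\<exists>m n. x = y + chart a b (of_int m, of_int n))"
  by (auto simp: torus_proj_def lattice_rel_def lattice_iff algebra_simps)

lemma torus_proj_eqI:
  assumes "x = y + chart a b (of_int m, of_int n)"
  shows "torus_proj a b x = torus_proj a b y"
proof (intro set_eqI iffI)
  fix u assume "u \<in> torus_proj a b x"
  then obtain i j where "x = u + chart a b (of_int i, of_int j)" by (auto simp: torus_proj_iff)
  then have "y = u + (chart a b (of_int i, of_int j) - chart a b (of_int m, of_int n))"
    using assms by (simp add: algebra_simps)
  then have "y = u + chart a b (of_int (i - m), of_int (j - n))" by (simp add: chart_diff)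
  then show "u \<in> torus_proj a b y" unfolding torus_proj_iff by blast
next
  fix u assume "u \<in> torus_proj a b y"
  then obtain i j where "y = u + chart a b (of_int i, of_int j)" by (auto simp: torus_proj_iff)
  then have "x = u + chart a b (of_int (i + m), of_int (j + n))"
    using assms by (simp add: chart_add add.assoc)
  then show "u \<in> torus_proj a b x" unfolding torus_proj_iff by blast
qed

lemma torus_proj_self: "x \<in> torus_proj a b x"
  unfolding torus_proj_iff by (intro exI[of _ 0]) (simp add: vec_eq_iff forall_2)

lemma torus_point_frac: "torus_point a b (frac_pair z) = torus_point a b z"
proof -
  have "chart a b z = chart a b (frac_pair z) + chart a b (of_int \<lfloor>fst z\<rfloor>, of_int \<lfloor>snd z\<rfloor>)"
    unfolding chart_add by (simp add: frac_pair_def frac_def)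
  then show ?thesis unfolding torus_point_def by (rule torus_proj_eqI[symmetric])
qed

lemma torus_range: "torus a b = range (torus_proj a b)"
  by (auto simp: torus_def quotient_def torus_proj_def)

lemma norm_le_curve_length:
  assumes "g C1_differentiable_on {0..1}"
  shows "norm (g 1 - g 0) \<le> curve_length g"
proof -
  obtain D where D: "\<And>x. x \<in> {0..1} \<Longrightarrow> (g has_vector_derivative D x) (at x)" "continuous_on {0..1} D"
    using assms unfolding C1_differentiable_on_def by blast
  have "(D has_integral (g 1 - g 0)) {0..1}"
    using D(1) by (intro fundamental_theorem_of_calculus) (auto intro: has_vector_derivative_at_within)
  then have "norm (g 1 - g 0) = norm (integral {0..1} D)" by (simp add: integral_unique)
  also have "\<dots> \<le> integral {0..1} (\<lambda>t. norm (D t))"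
    using D(2) by (intro integral_norm_bound_integral integrable_continuous_real continuous_on_norm) auto
  also have "\<dots> = curve_length g"
    unfolding curve_length_def using vector_derivative_at[OF D(1)] by (intro integral_cong) simp
  finally show ?thesis .
qed

lemma line_curve:
  fixes x y :: "real^2"
  defines "g \<equiv> \<lambda>t. x + t *\<^sub>R (y - x)"
  shows "g C1_differentiable_on {0..1}" "curve_length g = norm (y - x)" "g 0 = x" "g 1 = y"
proof -
  have d: "(g has_vector_derivative (y - x)) (at t)" for t
    unfolding g_def by (auto intro!: derivative_eq_intros)
  then show "g C1_differentiable_on {0..1}"
    unfolding C1_differentiable_on_def by (intro exI[of _ "\<lambda>_. y - x"]) auto
  show "curve_length g = norm (y - x)"
    using vector_derivative_at[OF d] by (simp add: curve_length_def)
qed (simp_all add: g_def)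

lemma frac_measurable: "frac \<in> borel \<rightarrow>\<^sub>M circle"
proof -
  have "(frac :: real \<Rightarrow> real) \<in> borel_measurable borel"
    unfolding frac_def[abs_def] by measurable
  then have "frac \<in> borel \<rightarrow>\<^sub>M (lborel :: real measure)" by simp
  then show ?thesis
    unfolding circle_def by (intro measurable_restrict_space2) (auto simp: frac_lt_1)
qed

lemma frac_pair_measurable: "frac_pair \<in> borel \<Otimes>\<^sub>M borel \<rightarrow>\<^sub>M circle \<Otimes>\<^sub>M circle"
  unfolding frac_pair_def[abs_def]
  by (intro measurable_Pair measurable_compose[OF measurable_fst frac_measurable]
      measurable_compose[OF measurable_snd frac_measurable])

lemma Basis_real_2: "(Basis :: (real^2) set) = {axis 1 1, axis 2 1}"
  by (auto simp: Basis_vec_def UNIV_2)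

lemma emeasure_circle_square:
  assumes "A \<in> sets (lborel \<Otimes>\<^sub>M lborel)" "A \<in> sets (circle \<Otimes>\<^sub>M circle)" "A \<subseteq> {0..<1} \<times> {0..<1}"
  shows "emeasure (circle \<Otimes>\<^sub>M circle) A = emeasure (lborel \<Otimes>\<^sub>M lborel) A"
proof -
  have sec: "emeasure circle (Pair x -` A) = emeasure lborel (Pair x -` A)" for x
    unfolding circle_def using assms(3) by (subst emeasure_restrict_space) auto
  have m: "(\<lambda>x. emeasure lborel (Pair x -` A)) \<in> borel_measurable borel"
    using lborel.measurable_emeasure_Pair[OF assms(1)] by simp
  have "emeasure (circle \<Otimes>\<^sub>M circle) A = circle_integral (\<lambda>x. emeasure lborel (Pair x -` A))"
    by (simp add: circle.emeasure_pair_measure_alt[OF assms(2)] sec)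
  also have "\<dots> = interval_integral 0 1 (\<lambda>x. emeasure lborel (Pair x -` A))"
    by (rule nn_integral_circle[OF m])
  also have "\<dots> = (\<integral>\<^sup>+x. emeasure lborel (Pair x -` A) \<partial>lborel)"
  proof (intro nn_integral_cong)
    fix x :: real
    have "x \<notin> {0..<1} \<Longrightarrow> Pair x -` A = {}" using assms(3) by auto
    then show "emeasure lborel (Pair x -` A) * indicator {0..<1} x = emeasure lborel (Pair x -` A)"
      by (cases "x \<in> {0..<1}") simp_all
  qed
  also have "\<dots> = emeasure (lborel \<Otimes>\<^sub>M lborel) A"
    by (rule lborel.emeasure_pair_measure_alt[OF assms(1), symmetric])
  finally show ?thesis .
qed

lemma circle_square_ident_measurable: "(\<lambda>z. z) \<in> circle \<Otimes>\<^sub>M circle \<rightarrow>\<^sub>M borel \<Otimes>\<^sub>M borel"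
proof -
  have "(\<lambda>z. (fst z, snd z)) \<in> circle \<Otimes>\<^sub>M circle \<rightarrow>\<^sub>M borel \<Otimes>\<^sub>M borel"
    by (intro measurable_Pair measurable_compose[OF measurable_fst circle_ident_measurable]
        measurable_compose[OF measurable_snd circle_ident_measurable])
  then show ?thesis by simp
qed

section \<open>The quotient torus: coordinates, geodesic distance and volume\<close>

locale flat_torus =
  fixes a b :: real
  assumes height_pos: "b > 0"
begin

lemma torus_point_range: "torus a b = range (torus_point a b)"
proof -
  have "torus_proj a b x = torus_point a b (coords a b x)" for x
    using chart_coords[OF height_pos] by (simp add: torus_point_def)
  then show ?thesis unfolding torus_range by (auto simp: torus_point_def)
qed

text \<open>The choice of the representative is immaterial: two of them differ by a lattice vector,
  which \<open>frac_pair\<close> removes. On the torus this inverts \<open>torus_point\<close> with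
  values in the half-open unit square.\<close>

definition torus_coords :: "(real^2) set \<Rightarrow> real \<times> real" where
  "torus_coords X = frac_pair (coords a b (SOME x. x \<in> X))"

lemma torus_coords_proj: "torus_coords (torus_proj a b x) = frac_pair (coords a b x)"
proof -
  define y where "y = (SOME y. y \<in> torus_proj a b x)"
  have "y \<in> torus_proj a b x" unfolding y_def by (rule someI) (rule torus_proj_self)
  then obtain m n where xy: "x = y + chart a b (of_int m, of_int n)" by (auto simp: torus_proj_iff)
  have "x = chart a b (coords a b y + (of_int m, of_int n))"
    unfolding chart_add[symmetric] chart_coords[OF height_pos] by (rule xy)
  then have "coords a b x = coords a b y + (of_int m, of_int n)"
    by (simp add: coords_chart[OF height_pos])
  then show ?thesis by (simp add: torus_coords_def y_def[symmetric] frac_pair_def frac_def)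
qed

lemma torus_coords_point: "torus_coords (torus_point a b z) = frac_pair z"
  unfolding torus_point_def torus_coords_proj coords_chart[OF height_pos] ..

lemma torus_point_coords: "X \<in> torus a b \<Longrightarrow> torus_point a b (torus_coords X) = X"
  by (auto simp: torus_point_range torus_coords_point torus_point_frac)

text \<open>A curve is at least as long as the segment between its end points, and segments are
  admissible. The vectors joining two lifts are exactly the lattice translates in
  \<open>flat_dist2\<close>, so the two infima agree.\<close>

lemma geodesic_dist_torus_point:
  "(geodesic_dist (torus_point a b z) (torus_point a b w))\<^sup>2 =
    flat_dist2 a b (fst z - fst w + a * (snd z - snd w)) (snd z - snd w)"
proof -
  define F where "F = flat_dist2 a b (fst z - fst w + a * (snd z - snd w)) (snd z - snd w)"
  define L where "L = {curve_length g |g. g C1_differentiable_on {0..1} \<and> g 0 \<in> torus_point a b z \<and> g 1 \<in> torus_point a b w}"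
  have gd: "geodesic_dist (torus_point a b z) (torus_point a b w) = Inf L"
    by (simp add: geodesic_dist_def L_def)
  have F0: "0 \<le> F" unfolding F_def by (rule flat_dist2_nonneg[OF height_pos])
  have lower: "sqrt F \<le> l" if l: "l \<in> L" for l
  proof -
    obtain g where g: "l = curve_length g" "g C1_differentiable_on {0..1}"
      "g 0 \<in> torus_point a b z" "g 1 \<in> torus_point a b w" using l unfolding L_def by blast
    then obtain m n i j where "chart a b z = g 0 + chart a b (of_int m, of_int n)"
      "chart a b w = g 1 + chart a b (of_int i, of_int j)"
      by (auto simp: torus_point_def torus_proj_iff)
    then have "g 0 = chart a b z - chart a b (of_int m, of_int n)"
      "g 1 = chart a b w - chart a b (of_int i, of_int j)" by (simp_all add: algebra_simps)
    then have "g 0 - g 1 = chart a b (z - (of_int m, of_int n) - (w - (of_int i, of_int j)))"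
      by (simp only: chart_diff)
    also have "z - (of_int m, of_int n) - (w - (of_int i, of_int j)) = z - w + (of_int (i - m), of_int (j - n))"
      by (simp add: prod_eq_iff)
    finally have "g 0 - g 1 = chart a b (z - w + (of_int (i - m), of_int (j - n)))" .
    then have "(norm (g 0 - g 1))\<^sup>2 =
       quad_form b (fst z - fst w + a * (snd z - snd w) + of_int (i - m) + a * of_int (j - n)) (snd z - snd w + of_int (j - n))"
      by (simp add: norm_chart[OF height_pos] algebra_simps)
    then have "F \<le> (norm (g 1 - g 0))\<^sup>2"
      unfolding F_def norm_minus_commute[of "g 1"] by (simp only: flat_dist2_le[OF height_pos])
    then have "sqrt F \<le> norm (g 1 - g 0)" by (rule real_le_lsqrt[rotated]) simp_all
    also have "\<dots> \<le> l" unfolding g(1) by (rule norm_le_curve_length[OF g(2)])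
    finally show ?thesis .
  qed
  have upper: "\<exists>l\<in>L. l\<^sup>2 = quad_form b (fst z - fst w + a * (snd z - snd w) + of_int m + a * of_int n) (snd z - snd w + of_int n)" for m n
  proof -
    define x where "x = chart a b (z + (of_int m, of_int n))"
    have "z = z + (of_int m, of_int n) + (of_int (-m), of_int (-n))" by (simp add: prod_eq_iff)
    then have "chart a b z = x + chart a b (of_int (-m), of_int (-n))"
      unfolding x_def chart_add by (rule arg_cong)
    then have x: "x \<in> torus_point a b z" unfolding torus_point_def torus_proj_iff by blast
    have y: "chart a b w \<in> torus_point a b w" by (simp add: torus_point_def torus_proj_self)
    have "x - chart a b w = chart a b (z + (of_int m, of_int n) - w)" by (simp add: x_def chart_diff)
    then have "(norm (chart a b w - x))\<^sup>2 =
      quad_form b (fst z - fst w + a * (snd z - snd w) + of_int m + a * of_int n) (snd z - snd w + of_int n)"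
      unfolding norm_minus_commute[of "chart a b w"] by (simp add: norm_chart[OF height_pos] algebra_simps)
    moreover have "norm (chart a b w - x) \<in> L"
      unfolding L_def using line_curve[of x "chart a b w"] x y
      by (intro CollectI exI[of _ "\<lambda>t. x + t *\<^sub>R (chart a b w - x)"]) auto
    ultimately show ?thesis by blast
  qed
  have ne: "L \<noteq> {}" using upper[of 0 0] by blast
  have "sqrt F \<le> Inf L" using ne lower by (rule cInf_greatest)
  moreover have "Inf L \<le> sqrt F"
  \<comment> \<open>The lower bound just shown makes \<open>Inf L\<close> nonnegative, so it may be
    compared with each length after squaring.\<close>
  proof (rule real_le_rsqrt)
    show "(Inf L)\<^sup>2 \<le> F"
      unfolding F_def
    proof (rule flat_dist2_greatest)
      fix m n
      obtain l where l: "l \<in> L" "l\<^sup>2 = quad_form b (fst z - fst w + a * (snd z - snd w) + of_int m + a * of_int n) (snd z - snd w + of_int n)"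
        using upper by blast
      have "bdd_below L" using lower by (rule bdd_belowI)
      then have "Inf L \<le> l" using l(1) by (rule cInf_lower[rotated])
      moreover have "0 \<le> Inf L" using \<open>sqrt F \<le> Inf L\<close> F0 by (meson order_trans real_sqrt_ge_zero)
      ultimately show "(Inf L)\<^sup>2 \<le> quad_form b (fst z - fst w + a * (snd z - snd w) + of_int m + a * of_int n) (snd z - snd w + of_int n)"
        unfolding l(2)[symmetric] by (intro power_mono)
    qed
  qed
  ultimately have "Inf L = sqrt F" by simp
  then show ?thesis using F0 by (simp add: gd F_def)
qed

lemma coords_measurable: "coords a b \<in> borel \<rightarrow>\<^sub>M borel \<Otimes>\<^sub>M borel"
  unfolding coords_def[abs_def] by measurable

lemma chart_measurable: "chart a b \<in> borel \<Otimes>\<^sub>M borel \<rightarrow>\<^sub>M borel"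
proof -
  have "chart a b = (\<lambda>z. ((fst z + a * snd z) / sqrt b) *\<^sub>R axis 1 1 + (sqrt b * snd z) *\<^sub>R axis 2 1)"
    by (simp add: fun_eq_iff vec_eq_iff forall_2 axis_def)
  also have "\<dots> \<in> borel \<Otimes>\<^sub>M borel \<rightarrow>\<^sub>M borel" by measurable
  finally show ?thesis .
qed

text \<open>The basis matrix has determinant 1. On a box, the slice at height \<open>t\<close> is an
  interval of length \<open>sqrt b * (u $ 1 - l $ 1)\<close> whatever the shear
  \<open>a * t\<close>, and the range of \<open>t\<close> has length
  \<open>(u $ 2 - l $ 2) / sqrt b\<close>.\<close>

lemma lborel_chart: "lborel = distr (lborel \<Otimes>\<^sub>M lborel) borel (chart a b)"
proof (rule lborel_eqI)
  fix l u :: "real^2" assume le: "\<And>i. i \<in> Basis \<Longrightarrow> l \<bullet> i \<le> u \<bullet> i"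
  have lu: "l $ 1 \<le> u $ 1" "l $ 2 \<le> u $ 2"
    using le[of "axis 1 1"] le[of "axis 2 1"] by (simp_all add: Basis_real_2 inner_axis)
  note [measurable] = chart_measurable
  have s: "sqrt b > 0" using height_pos by simp
  have box: "x \<in> box l u \<longleftrightarrow> l $ 1 < x $ 1 \<and> x $ 1 < u $ 1 \<and> l $ 2 < x $ 2 \<and> x $ 2 < u $ 2" for x
    by (auto simp: box_def Basis_real_2 inner_axis)
  have "chart a b -` box l u \<inter> space (lborel \<Otimes>\<^sub>M lborel) \<in> sets (lborel \<Otimes>\<^sub>M lborel)"
    by measurable
  then have sets: "chart a b -` box l u \<in> sets (lborel \<Otimes>\<^sub>M lborel)" by (simp add: space_pair_measure)
  have "emeasure (distr (lborel \<Otimes>\<^sub>M lborel) borel (chart a b)) (box l u) = emeasure (lborel \<Otimes>\<^sub>M lborel) (chart a b -` box l u)"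
    by (subst emeasure_distr) (auto simp: space_pair_measure)
  also have "\<dots> = (\<integral>\<^sup>+t. emeasure lborel ((\<lambda>s. (s, t)) -` (chart a b -` box l u)) \<partial>lborel)"
    by (rule lborel_pair.emeasure_pair_measure_alt2[OF sets])
  also have "\<dots> = (\<integral>\<^sup>+t. ennreal (sqrt b * (u $ 1 - l $ 1)) * indicator {l $ 2 / sqrt b<..<u $ 2 / sqrt b} t \<partial>lborel)"
  proof (intro nn_integral_cong)
    fix t
    have "(\<lambda>s. (s, t)) -` (chart a b -` box l u) =
      (if l $ 2 / sqrt b < t \<and> t < u $ 2 / sqrt b then {sqrt b * l $ 1 - a * t<..<sqrt b * u $ 1 - a * t} else {})"
      using s by (auto simp: box field_simps)
    moreover have "sqrt b * l $ 1 \<le> sqrt b * u $ 1" using s lu by simp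
    ultimately show "emeasure lborel ((\<lambda>s. (s, t)) -` (chart a b -` box l u)) =
      ennreal (sqrt b * (u $ 1 - l $ 1)) * indicator {l $ 2 / sqrt b<..<u $ 2 / sqrt b} t"
      by (auto simp: algebra_simps)
  qed
  also have "\<dots> = ennreal (sqrt b * (u $ 1 - l $ 1)) * ennreal (u $ 2 / sqrt b - l $ 2 / sqrt b)"
    using s lu by (subst nn_integral_cmult_indicator) (auto simp: divide_right_mono)
  also have "\<dots> = ennreal ((u $ 1 - l $ 1) * (u $ 2 - l $ 2))"
    using s lu by (subst ennreal_mult[symmetric]) (auto simp: divide_right_mono diff_divide_distrib[symmetric])
  also have "(u $ 1 - l $ 1) * (u $ 2 - l $ 2) = (\<Prod>i\<in>Basis. (u - l) \<bullet> i)"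
    by (simp add: Basis_real_2 inner_axis axis_eq_axis)
  finally show "emeasure (distr (lborel \<Otimes>\<^sub>M lborel) borel (chart a b)) (box l u) = (\<Prod>i\<in>Basis. (u - l) \<bullet> i)" .
qed simp

definition torus_sets :: "(real^2) set set set" where
  "torus_sets = {S. S \<subseteq> torus a b \<and> torus_proj a b -` S \<in> sets borel}"

lemma torus_sets_Pow: "torus_sets \<subseteq> Pow (torus a b)"
  by (auto simp: torus_sets_def)

lemma sets_torus_measure: "sets (torus_measure a b) = sigma_sets (torus a b) torus_sets"
  using torus_sets_Pow by (simp add: torus_measure_def torus_sets_def[symmetric])

lemma space_torus_measure: "space (torus_measure a b) = torus a b"
  using torus_sets_Pow by (simp add: torus_measure_def torus_sets_def[symmetric] space_measure_of)

lemma torus_proj_measurable: "torus_proj a b \<in> borel \<rightarrow>\<^sub>M torus_measure a b"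
proof (rule measurable_sigma_sets[OF sets_torus_measure torus_sets_Pow])
  show "torus_proj a b \<in> space borel \<rightarrow> torus a b" by (auto simp: torus_range)
qed (simp add: torus_sets_def)

lemma torus_coords_measurable: "torus_coords \<in> torus_measure a b \<rightarrow>\<^sub>M circle \<Otimes>\<^sub>M circle"
proof (rule measurableI)
  have meas: "(\<lambda>x. frac_pair (coords a b x)) \<in> borel \<rightarrow>\<^sub>M circle \<Otimes>\<^sub>M circle"
    by (rule measurable_compose[OF coords_measurable frac_pair_measurable])
  fix S assume S: "S \<in> sets (circle \<Otimes>\<^sub>M circle)"
  have "torus_proj a b -` (torus_coords -` S \<inter> torus a b) = (\<lambda>x. frac_pair (coords a b x)) -` S"
    by (auto simp: torus_coords_proj torus_range)
  then have "torus_coords -` S \<inter> torus a b \<in> torus_sets"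
    using measurable_sets[OF meas S] by (simp add: torus_sets_def)
  then show "torus_coords -` S \<inter> space (torus_measure a b) \<in> sets (torus_measure a b)"
    unfolding space_torus_measure sets_torus_measure by (rule sigma_sets.Basic)
qed (auto simp: torus_coords_def frac_pair_def space_pair_measure frac_lt_1)

lemma torus_point_measurable: "torus_point a b \<in> circle \<Otimes>\<^sub>M circle \<rightarrow>\<^sub>M torus_measure a b"
  using measurable_compose[OF measurable_compose[OF circle_square_ident_measurable chart_measurable]
    torus_proj_measurable] by (simp add: torus_point_def[abs_def])

text \<open>Replaces the fundamental cell by the unit square, that is, by a product of circles. The
  target sigma-algebra is taken from \<open>torus_measure a b\<close> itself, so only the measures
  of sets have to be compared.\<close>

lemma torus_measure_distr:
  "torus_measure a b = distr (circle \<Otimes>\<^sub>M circle) (torus_measure a b) (torus_point a b)"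
proof (rule measure_eqI)
  fix A assume A: "A \<in> sets (torus_measure a b)"
  let ?Q = "{0..<1::real} \<times> {0..<1::real}"
  let ?S = "torus_point a b -` A \<inter> ?Q"
  have cell: "fundamental_cell a b = (coords a b) -` ?Q"
    unfolding fundamental_cell_chart
  proof (intro set_eqI iffI)
    fix x assume "x \<in> chart a b ` ?Q"
    then show "x \<in> coords a b -` ?Q" by (auto simp only: coords_chart[OF height_pos] vimage_eq)
  next
    fix x assume "x \<in> coords a b -` ?Q"
    then have "chart a b (coords a b x) \<in> chart a b ` ?Q" by (intro imageI) simp
    then show "x \<in> chart a b ` ?Q" by (simp only: chart_coords[OF height_pos])
  qed
  have Q: "?Q \<in> sets (borel \<Otimes>\<^sub>M borel)" by simp
  have cellm: "fundamental_cell a b \<in> sets borel"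
    unfolding cell using measurable_sets[OF coords_measurable Q] by simp
  have Ab: "torus_proj a b -` A \<in> sets borel"
    using measurable_sets[OF torus_proj_measurable A] by simp
  have "emeasure (torus_measure a b) A = emeasure (restrict_space lborel (fundamental_cell a b)) (torus_proj a b -` A \<inter> fundamental_cell a b)"
  proof -
    have sig: "A \<in> sets (sigma (torus a b) torus_sets)"
      using A torus_sets_Pow by (simp add: sets_torus_measure)
    have "torus_proj a b \<in> borel \<rightarrow>\<^sub>M sigma (torus a b) torus_sets"
      using torus_proj_measurable
        measurable_cong_sets[of "borel :: (real^2) measure" borel "torus_measure a b" "sigma (torus a b) torus_sets"]
      by (simp add: sets_torus_measure torus_sets_Pow)
    then have m: "torus_proj a b \<in> restrict_space lborel (fundamental_cell a b) \<rightarrow>\<^sub>M sigma (torus a b) torus_sets"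
      by (intro measurable_restrict_space1) simp
    show ?thesis
      unfolding torus_measure_def torus_sets_def[symmetric]
      by (subst emeasure_distr[OF m sig]) (simp add: space_restrict_space)
  qed
  also have "\<dots> = emeasure lborel (torus_proj a b -` A \<inter> fundamental_cell a b)"
    using cellm by (subst emeasure_restrict_space) auto
  also have "\<dots> = emeasure (lborel \<Otimes>\<^sub>M lborel) (chart a b -` (torus_proj a b -` A \<inter> fundamental_cell a b))"
    by (subst lborel_chart, subst emeasure_distr)
       (use chart_measurable Ab cellm in \<open>auto simp: space_pair_measure cong: measurable_cong_sets\<close>)
  also have "chart a b -` (torus_proj a b -` A \<inter> fundamental_cell a b) = ?S"
    unfolding cell by (auto simp: torus_point_def coords_chart[OF height_pos])
  also have "emeasure (lborel \<Otimes>\<^sub>M lborel) ?S = emeasure (circle \<Otimes>\<^sub>M circle) ?S"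
  proof (rule emeasure_circle_square[symmetric])
    have "torus_point a b \<in> borel \<Otimes>\<^sub>M borel \<rightarrow>\<^sub>M torus_measure a b"
      using measurable_compose[OF chart_measurable torus_proj_measurable] by (simp add: torus_point_def[abs_def])
    from measurable_sets[OF this A] have "torus_point a b -` A \<in> sets (borel \<Otimes>\<^sub>M borel)"
      by (simp add: space_pair_measure)
    then have "?S \<in> sets (borel \<Otimes>\<^sub>M borel)" using Q by auto
    then show "?S \<in> sets (lborel \<Otimes>\<^sub>M lborel)"
      by (simp cong: sets_pair_measure_cong)
    show "?S \<in> sets (circle \<Otimes>\<^sub>M circle)"
      using measurable_sets[OF torus_point_measurable A] by (simp add: space_pair_measure)
  qed simp
  also have "\<dots> = emeasure (distr (circle \<Otimes>\<^sub>M circle) (torus_measure a b) (torus_point a b)) A"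
    using A torus_point_measurable by (subst emeasure_distr) (auto simp: space_pair_measure)
  finally show "emeasure (torus_measure a b) A = \<dots>" .
qed simp

end

text \<open>Composition with \<open>P\<close> preserves integrals because \<open>M\<close> is the
  image measure, and it undoes composition with \<open>c\<close> because \<open>c (P z) = z\<close>.
  Inner products, norms and remainders thus become those on \<open>N\<close>.\<close>

lemma orthonormal_basis_transfer:
  assumes P [measurable]: "P \<in> N \<rightarrow>\<^sub>M M" and c [measurable]: "c \<in> M \<rightarrow>\<^sub>M N" and M: "M = distr N M P"
    and cP: "\<And>z. z \<in> space N \<Longrightarrow> c (P z) = z" and e: "orthonormal_basis N e"
  shows "orthonormal_basis M (\<lambda>i x. e i (c x))"
proof -
  have LINT: "(LINT x|M. h x) = (LINT z|N. h (P z))" if "h \<in> borel_measurable M"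
    for h :: "_ \<Rightarrow> 'c :: {banach, second_countable_topology}"
    using integral_distr[OF P that] M by simp
  have integ: "integrable M h \<longleftrightarrow> integrable N (\<lambda>z. h (P z))" if "h \<in> borel_measurable M"
    for h :: "_ \<Rightarrow> 'c :: {banach, second_countable_topology}"
    using integrable_distr_eq[OF P that] M by simp
  have esq: "sq_integrable N (e i)" for i using e by (simp add: orthonormal_basis_def)
  note [measurable] = sq_integrable_measurable[OF esq]
  have pull: "sq_integrable N (\<lambda>z. \<psi> (P z))" if "sq_integrable M \<psi>" for \<psi>
  proof -
    note [measurable] = sq_integrable_measurable[OF that]
    have "(\<lambda>x. (cmod (\<psi> x))\<^sup>2) \<in> borel_measurable M" by measurable
    then show ?thesis using sq_integrable_integrable[OF that] by (simp add: sq_integrable_def integ)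
  qed
  have ec: "sq_integrable M (\<lambda>x. e i (c x))" for i
  proof -
    have "integrable N (\<lambda>z. (cmod (e i (c (P z))))\<^sup>2) \<longleftrightarrow> integrable N (\<lambda>z. (cmod (e i z))\<^sup>2)"
      by (intro Bochner_Integration.integrable_cong) (auto simp: cP)
    then show ?thesis
      using sq_integrable_integrable[OF esq[of i]] integ[of "\<lambda>x. (cmod (e i (c x)))\<^sup>2"]
      by (simp add: sq_integrable_def)
  qed
  have inner: "l2_inner M \<psi> (\<lambda>x. e i (c x)) = l2_inner N (\<lambda>z. \<psi> (P z)) (e i)"
    if [measurable]: "\<psi> \<in> borel_measurable M" for \<psi> i
    unfolding l2_inner_def
    by (subst LINT) (auto simp: cP intro!: Bochner_Integration.integral_cong)
  have norm: "l2_norm M \<psi> = l2_norm N (\<lambda>z. \<psi> (P z))" if [measurable]: "\<psi> \<in> borel_measurable M" for \<psi>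
    unfolding l2_norm_def by (subst LINT) auto
  show ?thesis
    unfolding orthonormal_basis_def
  proof (intro conjI allI impI)
    show "sq_integrable M (\<lambda>x. e i (c x))" for i by (rule ec)
    fix i j
    have "l2_inner M (\<lambda>x. e i (c x)) (\<lambda>x. e j (c x)) = l2_inner N (\<lambda>z. e i (c (P z))) (e j)"
      by (rule inner) (rule sq_integrable_measurable[OF ec])
    also have "\<dots> = l2_inner N (e i) (e j)"
      unfolding l2_inner_def by (intro Bochner_Integration.integral_cong) (auto simp: cP)
    finally show "l2_inner M (\<lambda>x. e i (c x)) (\<lambda>x. e j (c x)) = (if i = j then 1 else 0)"
      using e by (simp add: orthonormal_basis_def)
  next
    fix \<psi> assume \<psi>: "sq_integrable M \<psi>"
    note [measurable] = sq_integrable_measurable[OF \<psi>] sq_integrable_measurable[OF ec]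
    have "l2_norm M (\<lambda>x. \<psi> x - (\<Sum>i<n. l2_inner M \<psi> (\<lambda>x. e i (c x)) * e i (c x))) =
      l2_norm N (\<lambda>z. \<psi> (P z) - (\<Sum>i<n. l2_inner N (\<lambda>z. \<psi> (P z)) (e i) * e i z))" for n
      by (subst norm, measurable, rule l2_norm_cong) (simp add: inner cP)
    then show "(\<lambda>n. l2_norm M (\<lambda>x. \<psi> x - (\<Sum>i<n. l2_inner M \<psi> (\<lambda>x. e i (c x)) * e i (c x)))) \<longlonglongrightarrow> 0"
      using e pull[OF \<psi>] by (simp add: orthonormal_basis_def)
  qed
qed

section \<open>Both norms as mean values of a profile\<close>

locale torus_profile = flat_torus a b + radial_profile g for a b g
begin

lemma profile_geodesic:
  assumes "X \<in> torus a b" "Y \<in> torus a b"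
  shows "(geodesic_dist X Y)\<^sup>2 = flat_dist2 a b
    (fst (torus_coords X) - fst (torus_coords Y) + a * (snd (torus_coords X) - snd (torus_coords Y)))
    (snd (torus_coords X) - snd (torus_coords Y))"
  using geodesic_dist_torus_point[of "torus_coords X" "torus_coords Y"] assms
  by (simp add: torus_point_coords)

lemma geodesic_commute:
  assumes "X \<in> torus a b" "Y \<in> torus a b"
  shows "(geodesic_dist X Y)\<^sup>2 = (geodesic_dist Y X)\<^sup>2"
  using flat_dist2_minus[OF height_pos, of a
      "fst (torus_coords Y) - fst (torus_coords X) + a * (snd (torus_coords Y) - snd (torus_coords X))"
      "snd (torus_coords Y) - snd (torus_coords X)"]
  by (simp add: profile_geodesic assms algebra_simps)

lemma torus_coords_borel: "torus_coords \<in> torus_measure a b \<rightarrow>\<^sub>M borel \<Otimes>\<^sub>M borel"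
  using measurable_compose[OF torus_coords_measurable circle_square_ident_measurable] by simp

lemma kernel_measurable:
  "(\<lambda>(X, Y). g ((geodesic_dist X Y)\<^sup>2)) \<in> borel_measurable (torus_measure a b \<Otimes>\<^sub>M torus_measure a b)"
proof -
  note [measurable] = torus_coords_borel
  note [simp] = height_pos
  let ?d = "\<lambda>X Y. flat_dist2 a b
    (fst (torus_coords X) - fst (torus_coords Y) + a * (snd (torus_coords X) - snd (torus_coords Y)))
    (snd (torus_coords X) - snd (torus_coords Y))"
  have "(\<lambda>z. g (?d (fst z) (snd z))) \<in> borel_measurable (torus_measure a b \<Otimes>\<^sub>M torus_measure a b)"
    by measurable
  then show ?thesis
    by (rule measurable_cong[THEN iffD1, rotated])
       (auto simp: space_pair_measure space_torus_measure profile_geodesic)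
qed

text \<open>Going up one row displaces the lattice by \<open>a\<close>, which a rotation of the
  circle of \<open>x\<close> absorbs.\<close>

lemma row_mean_periodic:
  "circle_integral (\<lambda>x. ennreal (g (flat_dist2 a b x (y + 1)))) = circle_integral (\<lambda>x. ennreal (g (flat_dist2 a b x y)))"
proof -
  have "circle_integral (\<lambda>x. ennreal (g (flat_dist2 a b x (y + 1)))) =
    circle_integral (\<lambda>x. ennreal (g (flat_dist2 a b (x + a) (y + 1))))"
    using height_pos by (intro nn_integral_circle_shift[symmetric]) (auto simp: flat_dist2_add_1)
  then show ?thesis using flat_dist2_lattice[OF height_pos, of a _ 0 1 y] by simp
qed

text \<open>Translation invariance: at fixed \<open>y\<close> the position of \<open>X\<close>
  amounts to a reflection and a rotation in \<open>x\<close>, and afterwards likewise in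
  \<open>y\<close>; neither changes an integral over the circle.\<close>

lemma nn_integral_profile:
  assumes "X \<in> torus a b"
  shows "(\<integral>\<^sup>+Y. ennreal (g ((geodesic_dist X Y)\<^sup>2)) \<partial>torus_measure a b) = torus_mean g a b"
proof -
  define s t where "s = fst (torus_coords X)" and "t = snd (torus_coords X)"
  interpret pair_sigma_finite circle circle ..
  have fm: "(\<lambda>Y. ennreal (g ((geodesic_dist X Y)\<^sup>2))) \<in> borel_measurable (torus_measure a b)"
    using measurable_compose[OF measurable_Pair1' kernel_measurable] assms
    by (simp add: space_torus_measure)
  have "(\<integral>\<^sup>+Y. ennreal (g ((geodesic_dist X Y)\<^sup>2)) \<partial>torus_measure a b) =
    (\<integral>\<^sup>+w. ennreal (g ((geodesic_dist X (torus_point a b w))\<^sup>2)) \<partial>(circle \<Otimes>\<^sub>M circle))"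
    unfolding arg_cong[OF torus_measure_distr, of "\<lambda>M. integral\<^sup>N M _"]
    by (rule nn_integral_distr[OF torus_point_measurable]) (simp add: fm)
  also have "\<dots> = (\<integral>\<^sup>+w. ennreal (g (flat_dist2 a b (s - fst w + a * (t - snd w)) (t - snd w))) \<partial>(circle \<Otimes>\<^sub>M circle))"
    using geodesic_dist_torus_point[of "torus_coords X"] assms
    by (simp add: torus_point_coords s_def t_def)
  also have "\<dots> = circle_integral (\<lambda>y. circle_integral (\<lambda>x. ennreal (g (flat_dist2 a b (s - x + a * (t - y)) (t - y)))))"
  proof -
    note [simp] = height_pos
    have "(\<lambda>(x, y). ennreal (g (flat_dist2 a b (s - x + a * (t - y)) (t - y)))) \<in> borel_measurable (borel \<Otimes>\<^sub>M borel)"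
      by measurable
    from nn_integral_snd[OF pair_circle_measurable[OF this]] show ?thesis
      by (simp add: case_prod_beta')
  qed
  also have "\<dots> = circle_integral (\<lambda>y. circle_integral (\<lambda>x. ennreal (g (flat_dist2 a b x (t - y)))))"
  proof (rule nn_integral_cong)
    fix y
    have "circle_integral (\<lambda>x. ennreal (g (flat_dist2 a b ((s + a * (t - y)) - x) (t - y)))) =
      circle_integral (\<lambda>x. ennreal (g (flat_dist2 a b x (t - y))))"
      using height_pos by (intro nn_integral_circle_reflect) (auto simp: flat_dist2_add_1)
    then show "circle_integral (\<lambda>x. ennreal (g (flat_dist2 a b (s - x + a * (t - y)) (t - y)))) =
      circle_integral (\<lambda>x. ennreal (g (flat_dist2 a b x (t - y))))" by (simp add: algebra_simps)
  qed
  also have "\<dots> = torus_mean g a b"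
    unfolding torus_mean_def
    by (rule nn_integral_circle_reflect) (auto simp: row_mean_periodic row_mean_measurable height_pos)
  finally show ?thesis .
qed

lemma integral_profile:
  assumes "X \<in> torus a b"
  shows "(LINT Y|torus_measure a b. g ((geodesic_dist X Y)\<^sup>2)) = mean_val a b"
proof -
  have "(\<lambda>Y. g ((geodesic_dist X Y)\<^sup>2)) \<in> borel_measurable (torus_measure a b)"
    using measurable_compose[OF measurable_Pair1' kernel_measurable] assms
    by (simp add: space_torus_measure)
  then show ?thesis
    using nn_integral_profile[OF assms] by (subst integral_eq_nn_integral) (auto simp: mean_val_def)
qed

lemma emeasure_space_torus: "emeasure (torus_measure a b) (space (torus_measure a b)) = 1"
proof -
  have "emeasure (torus_measure a b) (space (torus_measure a b)) =
      emeasure (distr (circle \<Otimes>\<^sub>M circle) (torus_measure a b) (torus_point a b)) (space (torus_measure a b))"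
    by (rule arg_cong[OF torus_measure_distr])
  also have "\<dots> = emeasure (circle \<Otimes>\<^sub>M circle) (torus_point a b -` space (torus_measure a b) \<inter> space (circle \<Otimes>\<^sub>M circle))"
    by (rule emeasure_distr[OF torus_point_measurable sets.top])
  also have "torus_point a b -` space (torus_measure a b) \<inter> space (circle \<Otimes>\<^sub>M circle) = space circle \<times> space circle"
    by (auto simp: space_torus_measure torus_point_range space_pair_measure)
  also have "emeasure (circle \<Otimes>\<^sub>M circle) (space circle \<times> space circle) =
      emeasure circle (space circle) * emeasure circle (space circle)"
    by (rule circle.emeasure_pair_measure_Times) (rule sets.top)+
  finally show ?thesis by (simp only: emeasure_space_circle mult_1)
qed

sublocale homogeneous_kernel "torus_measure a b" "\<lambda>X Y. g ((geodesic_dist X Y)\<^sup>2)" "g 0"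
proof (rule homogeneous_kernel.intro)
  show "finite_measure (torus_measure a b)"
    by (rule finite_measureI) (simp add: emeasure_space_torus)
  show "homogeneous_kernel_axioms (torus_measure a b) (\<lambda>X Y. g ((geodesic_dist X Y)\<^sup>2)) (g 0)"
    using emeasure_space_torus
    by unfold_locales (auto simp: kernel_measurable positive space_torus_measure
      intro: profile_mono arg_cong[OF geodesic_commute])
qed

lemma operator_norm_at: "operator_norm_at g (a, b) = mean_val a b"
proof -
  have "dist_operator g a b = kernel_op"
    by (simp add: fun_eq_iff dist_operator_def kernel_op_def)
  then show ?thesis
    using operator_norm_kernel_op[of "mean_val a b"] integral_profile mean_val_pos[OF height_pos]
    by (simp add: operator_norm_at_def space_torus_measure)
qed

lemma torus_orthonormal_basis:
  "orthonormal_basis (torus_measure a b) (\<lambda>i X. tensor_seq walsh_seq walsh_seq i (torus_coords X))"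
proof (rule orthonormal_basis_transfer[OF torus_point_measurable torus_coords_measurable
      torus_measure_distr _ orthonormal_basis_circle_square])
  fix z assume "z \<in> space (circle \<Otimes>\<^sub>M circle)"
  then show "torus_coords (torus_point a b z) = z"
    by (auto simp: torus_coords_point frac_pair_def space_pair_measure frac_eq prod_eq_iff)
qed

end

lemma radial_profile_square:
  assumes "radial_profile g" shows "radial_profile (\<lambda>t. (g t)\<^sup>2)"
proof -
  interpret radial_profile g by fact
  show ?thesis
  proof
    show "antimono (\<lambda>t. (g t)\<^sup>2)" by (intro antimonoI power_mono profile_mono profile_nonneg)
    show "0 < (g t)\<^sup>2" for t using positive[of t] by simp
  qed
qed

lemma hilbert_schmidt_norm_at:
  assumes "radial_profile g" "b > 0"
  shows "hilbert_schmidt_norm_at g (a, b) = sqrt (radial_profile.mean_val (\<lambda>t. (g t)\<^sup>2) a b)"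
proof -
  interpret torus_profile a b g by (intro torus_profile.intro flat_torus.intro assms)
  interpret sq: torus_profile a b "\<lambda>t. (g t)\<^sup>2"
    by (intro torus_profile.intro flat_torus.intro radial_profile_square assms)
  have "dist_operator g a b = kernel_op"
    by (simp add: fun_eq_iff dist_operator_def kernel_op_def)
  then show ?thesis
    using hilbert_schmidt_kernel_op[OF _ torus_orthonormal_basis] sq.integral_profile
    by (simp add: hilbert_schmidt_norm_at_def space_torus_measure)
qed

section \<open>Maximizers and saddle points\<close>

lemma hex_in_domain: "(1/2, sqrt 3 / 2) \<in> param_domain"
  by (simp add: param_domain_def power_divide)

lemma domain_pos: "(a, b) \<in> param_domain \<Longrightarrow> b > 0"
  by (simp add: param_domain_def)

context radial_profile begin

text \<open>Treats both norms at once: \<open>\<phi>\<close> is the identity for the operator norm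
  and the square root, with the profile squared, for the Hilbert-Schmidt norm. Differentiability is
  asked at positive arguments because of the square root.\<close>

context
  fixes Q :: "real \<times> real \<Rightarrow> real" and \<phi> :: "real \<Rightarrow> real"
  assumes Q: "\<And>a b. b > 0 \<Longrightarrow> Q (a, b) = \<phi> (mean_val a b)"
    and \<phi>_mono: "\<And>u v. 0 \<le> u \<Longrightarrow> u < v \<Longrightarrow> \<phi> u < \<phi> v"
    and \<phi>_deriv: "\<And>u. u > 0 \<Longrightarrow> \<exists>D. (\<phi> has_real_derivative D) (at u)"
begin

lemma Q_le: "b > 0 \<Longrightarrow> b' > 0 \<Longrightarrow> torus_mean g a b \<le> torus_mean g a' b' \<Longrightarrow> Q (a, b) \<le> Q (a', b')"
  using \<phi>_mono[of "mean_val a b" "mean_val a' b'"] mean_val_le_iff[of b b' a a']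
  by (cases "mean_val a b = mean_val a' b'") (auto simp: Q less_le)

lemma Q_less: "b > 0 \<Longrightarrow> b' > 0 \<Longrightarrow> torus_mean g a b < torus_mean g a' b' \<Longrightarrow> Q (a, b) < Q (a', b')"
  using \<phi>_mono[of "mean_val a b" "mean_val a' b'"] mean_val_less_iff[of b b' a a']
  by (simp add: Q)

lemma hex_arg_max: "is_arg_max Q (\<lambda>p. p \<in> param_domain) (1/2, sqrt 3 / 2)"
  unfolding is_arg_max_linorder
  using hex_in_domain hex_maximal by (auto intro!: Q_le dest: domain_pos)

lemma hex_unique_maximizer:
  assumes "strict_antimono_on UNIV g"
  shows "unique_maximizer_on param_domain Q (1/2, sqrt 3 / 2)"
  unfolding unique_maximizer_on_def
proof (intro allI iffI)
  fix q assume q: "is_arg_max Q (\<lambda>p. p \<in> param_domain) q"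
  obtain a b where ab: "q = (a, b)" by (cases q)
  show "q = (1/2, sqrt 3 / 2)"
  proof (rule ccontr)
    assume "q \<noteq> (1/2, sqrt 3 / 2)"
    then have "torus_mean g a b < torus_mean g (1/2) (sqrt 3 / 2)"
      using q ab by (intro hex_maximal_strict assms) (auto simp: is_arg_max_def)
    then have "Q q < Q (1/2, sqrt 3 / 2)"
      unfolding ab using q ab by (intro Q_less) (auto simp: is_arg_max_def dest: domain_pos)
    then show False using q hex_in_domain by (auto simp: is_arg_max_def)
  qed
qed (simp add: hex_arg_max)

lemma square_critical: "critical_point Q (0, 1)"
proof -
  obtain D where D: "(\<phi> has_real_derivative D) (at (mean_val 0 1))"
    using \<phi>_deriv mean_val_pos[of 1 0] by auto
  have "((\<lambda>a. \<phi> (mean_val a 1)) has_real_derivative D * 0) (at 0)"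
    by (rule DERIV_chain2[OF D mean_val_deriv_shift])
  then have 1: "((\<lambda>a. Q (a, 1)) has_real_derivative 0) (at 0)" by (simp add: Q)
  have "((\<lambda>b. \<phi> (mean_val 0 b)) has_real_derivative D * 0) (at 1)"
    by (rule DERIV_chain2[OF D mean_val_deriv_rectangle])
  then have "((\<lambda>b. \<phi> (mean_val 0 b)) has_real_derivative 0) (at 1)" by simp
  \<comment> \<open>The formula for \<open>Q\<close> is available for positive heights, an open
    neighbourhood of 1, which suffices for the two-sided derivative.\<close>
  then have "((\<lambda>b. Q (0, b)) has_real_derivative 0) (at 1)"
    by (rule has_field_derivative_transform_within_open[where S="{0<..}"]) (auto simp: Q)
  with 1 show ?thesis by (simp add: critical_point_def)
qed

lemma square_saddle:
  assumes "strict_antimono_on UNIV g"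
  shows "saddle_point_within param_domain Q (0, 1)"
  unfolding saddle_point_within_def
proof (intro conjI square_critical notI)
  assume "local_max_within param_domain Q (0, 1)"
  then obtain d where d: "d > 0" "\<And>q. q \<in> param_domain \<Longrightarrow> q \<noteq> (0, 1) \<Longrightarrow> dist q (0, 1) < d \<Longrightarrow> Q q \<le> Q (0, 1)"
    by (auto simp: local_max_within_def eventually_at)
  \<comment> \<open>Both witnesses stay in \<open>param_domain\<close>: sliding from the square to
    \<open>(a, 1)\<close> increases \<open>Q\<close>, and below, stretching it to
    \<open>(0, 1 + d/2)\<close> decreases \<open>Q\<close>.\<close>
  define a where "a = min (d/2) (1/2)"
  have a: "0 < a" "a \<le> 1/2" "a < d" using d(1) by (auto simp: a_def)
  have "Q (0, 1) < Q (a, 1)"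
    using a by (intro Q_less steiner_strict assms) auto
  moreover have "Q (a, 1) \<le> Q (0, 1)"
    using a by (intro d(2)) (auto simp: param_domain_def dist_Pair_Pair dist_real_def)
  ultimately show False by simp
next
  assume "local_min_within param_domain Q (0, 1)"
  then obtain d where d: "d > 0" "\<And>q. q \<in> param_domain \<Longrightarrow> q \<noteq> (0, 1) \<Longrightarrow> dist q (0, 1) < d \<Longrightarrow> Q q \<ge> Q (0, 1)"
    by (auto simp: local_min_within_def eventually_at)
  define b where "b = 1 + d/2"
  have b: "b > 1" "\<bar>b - 1\<bar> < d" using d(1) by (auto simp: b_def)
  have "Q (0, b) < Q (0, 1)"
    using b by (intro Q_less torus_mean_rectangle_less assms) auto
  moreover have "1 \<le> b\<^sup>2" using b by simp
  then have "Q (0, b) \<ge> Q (0, 1)"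
    using b by (intro d(2)) (auto simp: param_domain_def dist_Pair_Pair dist_real_def)
  ultimately show False by simp
qed

end
end

theorem theorem1p1:
  fixes f :: "real \<Rightarrow> real"
  assumes pos: "\<And>t. f t > 0"
    and noninc: "antimono f"
    and hs: "\<And>a b. (a, b) \<in> param_domain \<Longrightarrow>
      (\<integral>\<^sup>+X. (\<integral>\<^sup>+Y. ennreal (\<bar>f ((geodesic_dist X Y)\<^sup>2)\<bar>\<^sup>2) \<partial>torus_measure a b) \<partial>torus_measure a b) < \<infinity>"
  shows
    "(is_arg_max (operator_norm_at f) (\<lambda>p. p \<in> param_domain) (1/2, sqrt 3 / 2) \<and>
      is_arg_max (hilbert_schmidt_norm_at f) (\<lambda>p. p \<in> param_domain) (1/2, sqrt 3 / 2)) \<and>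
     (critical_point (operator_norm_at f) (0, 1) \<and>
      critical_point (hilbert_schmidt_norm_at f) (0, 1)) \<and>
     (strict_antimono_on UNIV f \<longrightarrow>
       unique_maximizer_on param_domain (operator_norm_at f) (1/2, sqrt 3 / 2) \<and>
       unique_maximizer_on param_domain (hilbert_schmidt_norm_at f) (1/2, sqrt 3 / 2) \<and>
       saddle_point_within param_domain (operator_norm_at f) (0, 1) \<and>
       saddle_point_within param_domain (hilbert_schmidt_norm_at f) (0, 1))"
proof -
  interpret f: radial_profile f using noninc pos by unfold_locales
  interpret f2: radial_profile "\<lambda>t. (f t)\<^sup>2" by (rule radial_profile_square[OF f.radial_profile_axioms])
  have op: "operator_norm_at f (a, b) = f.mean_val a b" if "b > 0" for a b
    using torus_profile.operator_norm_at[OF torus_profile.intro[OF flat_torus.intro[OF that] f.radial_profile_axioms]] .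
  have op_deriv: "\<exists>D. ((\<lambda>u. u) has_real_derivative D) (at u)" for u :: real
    using DERIV_ident by blast
  have HS: "hilbert_schmidt_norm_at f (a, b) = sqrt (f2.mean_val a b)" if "b > 0" for a b
    by (rule hilbert_schmidt_norm_at[OF f.radial_profile_axioms that])
  have HS_mono: "sqrt u < sqrt v" if "u < v" for u v by (simp add: that)
  have HS_deriv: "\<exists>D. (sqrt has_real_derivative D) (at u)" if "u > 0" for u
    using DERIV_real_sqrt[OF that] by blast
  have strict: "strict_antimono_on UNIV (\<lambda>t. (f t)\<^sup>2)" if "strict_antimono_on UNIV f"
    using that pos by (auto simp: monotone_on_def intro!: power_strict_mono less_imp_le)
  note op = f.hex_arg_max[OF op _ op_deriv] f.square_critical[OF op _ op_deriv]
    f.hex_unique_maximizer[OF op _ op_deriv] f.square_saddle[OF op _ op_deriv]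
  note HS = f2.hex_arg_max[OF HS HS_mono HS_deriv] f2.square_critical[OF HS HS_mono HS_deriv]
    f2.hex_unique_maximizer[OF HS HS_mono HS_deriv strict] f2.square_saddle[OF HS HS_mono HS_deriv strict]
  show ?thesis using op HS by simp
qed

end
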